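(* Let $g\in M^*(\mathbb{R}^d)$ with $\|g\|_2=1$ and let $\Omega\subset\mathbb{R}^{2d}$ be a compact set with finite perimeter and $|\Omega|>0$. Then $$\frac{1}{|\Omega|}\big\|\rho_\Omega-1_\Omega*|V_gg|^2\big\|_1\le\frac{1}{|\Omega|}+4\|g\|_{M^*}\sqrt{\frac{|\partial\Omega|}{|\Omega|}},$$ where $|\partial\Omega|$ is the perimeter of $\Omega$, $\rho_\Omega$ is the accumulated spectrogram of $\Omega$ with respect to $g$, and $\|\cdot\|_1$ is the norm of $L^1(\mathbb{R}^{2d})$.
   Context: For $f\in L^2(\mathbb{R}^d)$ and $z=(x,\xi)\in\mathbb{R}^d\times\mathbb{R}^d$, the short-time Fourier transform is $V_gf(x,\xi)=\int_{\mathbb{R}^d}f(t)\overline{g(t-x)}e^{-2\pi i\xi\cdot t}\,dt$. For compact $\Omega\subset\mathbb{R}^{2d}$, the time-frequency localization operator $H_\Omega$ on $L^2(\mathbb{R}^d)$ is $H_\Omega f(t)=\int_\Omega V_gf(x,\xi)g(t-x)e^{2\pi i\xi\cdot t}\,dx\,d\xi$, i.e. $H_\Omega f=V_g^*(1_\Omega\cdot V_gf)$; it is a compact positive operator. Let $\lambda_1^\Omega\ge\lambda_2^\Omega\ge\dots$ be its non-zero eigenvalues, counted with multiplicity and ordered non-increasingly, and $\{h_k^\Omega\}_{k\ge1}$ a corresponding orthonormal set of eigenfunctions. $|\Omega|$ denotes Lebesgue measure and $A_\Omega=\lceil|\Omega|\rceil$ is the smallest integer $\ge|\Omega|$. The accumulated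 spectrogram of $\Omega$ (with respect to $g$) is $\rho_\Omega(z)=\sum_{k=1}^{A_\Omega}|V_gh_k^\Omega(z)|^2$, $z\in\mathbb{R}^{2d}$. $M^*(\mathbb{R}^d)$ is the class of $g\in L^2(\mathbb{R}^d)$ with $\|g\|_{M^*}^2:=\int_{\mathbb{R}^{2d}}|z|\,|V_gg(z)|^2\,dz<+\infty$ ($|z|$ the Euclidean norm); $\|g\|_{M^*}$ is the non-negative square root. For real-valued $f\in L^1(\mathbb{R}^n)$, $\mathrm{Var}(f)=\sup\{\int_{\mathbb{R}^n}f\,\mathrm{div}\,\phi\,dx:\phi\in C_c^1(\mathbb{R}^n,\mathbb{R}^n),\ |\phi(x)|\le1\ \forall x\}$ (Euclidean norm). A set $\Omega\subset\mathbb{R}^{2d}$ has finite perimeter if $1_\Omega$ has bounded variation, and then its perimeter is $|\partial\Omega|:=\mathrm{Var}(1_\Omega)$. *)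

theory Defs
  imports "HOL-Analysis.Analysis" "HOL-Library.Extended_Nat"
begin

section \<open>Square-integrable functions\<close>

text \<open>
  Elements of \<open>L\<^sup>2\<close> are represented by Borel functions; every class of Lebesgue measurable functions
  modulo null sets contains one. Equality in \<open>L\<^sup>2\<close> is equality almost everywhere.
\<close>

definition L2_space :: "('a::euclidean_space \<Rightarrow> complex) set" where
  "L2_space = {f \<in> borel_measurable lborel. integrable lborel (\<lambda>t. (cmod (f t))\<^sup>2)}"

definition L2_inner :: "('a::euclidean_space \<Rightarrow> complex) \<Rightarrow> ('a \<Rightarrow> complex) \<Rightarrow> complex" where
  "L2_inner f g = (LINT t|lborel. f t * cnj (g t))"

definition norm2 :: "('a::euclidean_space \<Rightarrow> complex) \<Rightarrow> real" where
  "norm2 f = sqrt (LINT t|lborel. (cmod (f t))\<^sup>2)"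

definition norm1 :: "('a::euclidean_space \<Rightarrow> real) \<Rightarrow> real" where
  "norm1 F = (LINT z|lborel. \<bar>F z\<bar>)"

definition convolution ::
    "('a::euclidean_space \<Rightarrow> real) \<Rightarrow> ('a \<Rightarrow> real) \<Rightarrow> 'a \<Rightarrow> real" where
  "convolution F G z = (LINT w|lborel. F w * G (z - w))"


section \<open>Time-frequency localization\<close>

text \<open>
  The phase space \<open>\<real>\<^sup>d \<times> \<real>\<^sup>d\<close> is the product type, whose norm is the Euclidean norm of \<open>\<real>\<^sup>2\<^sup>d\<close>.
\<close>

definition stft ::
    "('a::euclidean_space \<Rightarrow> complex) \<Rightarrow> ('a \<Rightarrow> complex) \<Rightarrow> 'a \<times> 'a \<Rightarrow> complex" where
  "stft g f = (\<lambda>(x, \<xi>). LINT t|lborel. f t * cnj (g (t - x)) * cis (- (2 * pi * (\<xi> \<bullet> t))))"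

text \<open>
  For compact \<open>\<Omega>\<close> and \<open>f, g \<in> L\<^sup>2\<close> the integral below converges absolutely for every \<open>t\<close>.
\<close>

definition loc_op ::
    "('a::euclidean_space \<Rightarrow> complex) \<Rightarrow> ('a \<times> 'a) set \<Rightarrow> ('a \<Rightarrow> complex) \<Rightarrow> 'a \<Rightarrow> complex" where
  "loc_op g \<Omega> f t =
     (LINT z:\<Omega>|lborel. stft g f z * g (t - fst z) * cis (2 * pi * (snd z \<bullet> t)))"

definition eigenfunction_eq ::
    "(('a::euclidean_space \<Rightarrow> complex) \<Rightarrow> 'a \<Rightarrow> complex) \<Rightarrow> complex \<Rightarrow> ('a \<Rightarrow> complex) \<Rightarrow> bool" where
  "eigenfunction_eq H \<mu> f \<longleftrightarrow> f \<in> L2_space \<and> (AE t in lborel. H f t = \<mu> * f t)"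

text \<open>
  \<open>nonzero_eigensystem H N lam h\<close>: the non-zero eigenvalues of \<open>H\<close>, counted with multiplicity and in
  non-increasing order, are \<open>lam 1, lam 2, \<dots>\<close>, and \<open>h 1, h 2, \<dots>\<close> is a corresponding orthonormal set of
  eigenfunctions. Their number \<open>N\<close> may be finite or infinite; values at indices outside
  \<open>1 \<le> k \<le> N\<close> are irrelevant. Each eigenspace for a non-zero \<open>\<mu>\<close> is spanned by the \<open>h k\<close> with
  \<open>lam k = \<mu>\<close>, so that \<open>\<mu>\<close> is listed exactly as often as its multiplicity.
\<close>

definition nonzero_eigensystem ::
    "(('a::euclidean_space \<Rightarrow> complex) \<Rightarrow> 'a \<Rightarrow> complex) \<Rightarrow> enat \<Rightarrow>
      (nat \<Rightarrow> real) \<Rightarrow> (nat \<Rightarrow> 'a \<Rightarrow> complex) \<Rightarrow> bool" where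
  "nonzero_eigensystem H N lam h \<longleftrightarrow>
     (let K = {k. 1 \<le> k \<and> enat k \<le> N} in
       (\<forall>k\<in>K. lam k \<noteq> 0 \<and> eigenfunction_eq H (complex_of_real (lam k)) (h k)) \<and>
       (\<forall>j\<in>K. \<forall>k\<in>K. j \<le> k \<longrightarrow> lam k \<le> lam j) \<and>
       (\<forall>j\<in>K. \<forall>k\<in>K. L2_inner (h j) (h k) = (if j = k then 1 else 0)) \<and>
       (\<forall>\<mu>. \<mu> \<noteq> 0 \<longrightarrow>
          finite {k \<in> K. complex_of_real (lam k) = \<mu>} \<and>
          (\<forall>f. eigenfunction_eq H \<mu> f \<longrightarrow>
             (\<exists>c. AE t in lborel. f t = (\<Sum>k \<in> {k \<in> K. complex_of_real (lam k) = \<mu>}. c k * h k t)))))"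

text \<open>
  The eigenvalues of the localization operator are at most \<open>1\<close> and sum up to \<open>|\<Omega>|\<close>, hence there are at
  least \<open>\<lceil>|\<Omega>|\<rceil>\<close> non-zero ones, and only actual eigenfunctions enter the sum below.
\<close>

definition accumulated_spectrogram ::
    "('a::euclidean_space \<Rightarrow> complex) \<Rightarrow> ('a \<times> 'a) set \<Rightarrow> (nat \<Rightarrow> 'a \<Rightarrow> complex) \<Rightarrow> 'a \<times> 'a \<Rightarrow> real" where
  "accumulated_spectrogram g \<Omega> h z =
     (\<Sum>k = 1..nat \<lceil>measure lborel \<Omega>\<rceil>. (cmod (stft g (h k) z))\<^sup>2)"

definition Mstar :: "('a::euclidean_space \<Rightarrow> complex) set" where
  "Mstar = {g \<in> L2_space. integrable lborel (\<lambda>z. norm z * (cmod (stft g g z))\<^sup>2)}"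

definition Mstar_norm :: "('a::euclidean_space \<Rightarrow> complex) \<Rightarrow> real" where
  "Mstar_norm g = sqrt (LINT z|lborel. norm z * (cmod (stft g g z))\<^sup>2)"


section \<open>Bounded variation and perimeter\<close>

definition C1c_vector_fields :: "('n::euclidean_space \<Rightarrow> 'n) set" where
  "C1c_vector_fields =
     {\<phi>. (\<forall>x. \<phi> differentiable (at x)) \<and>
         (\<forall>b\<in>Basis. continuous_on UNIV (\<lambda>x. frechet_derivative \<phi> (at x) b)) \<and>
         compact (closure {x. \<phi> x \<noteq> 0})}"

definition divergence :: "('n::euclidean_space \<Rightarrow> 'n) \<Rightarrow> 'n \<Rightarrow> real" where
  "divergence \<phi> x = (\<Sum>b\<in>Basis. frechet_derivative \<phi> (at x) b \<bullet> b)"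

definition Variation :: "('n::euclidean_space \<Rightarrow> real) \<Rightarrow> ereal" where
  "Variation f =
     (SUP \<phi> \<in> {\<phi> \<in> C1c_vector_fields. \<forall>x. norm (\<phi> x) \<le> 1}.
        ereal (LINT x|lborel. f x * divergence \<phi> x))"

definition bounded_variation :: "('n::euclidean_space \<Rightarrow> real) \<Rightarrow> bool" where
  "bounded_variation f \<longleftrightarrow> integrable lborel f \<and> Variation f < \<infinity>"

definition finite_perimeter :: "'n::euclidean_space set \<Rightarrow> bool" where
  "finite_perimeter \<Omega> \<longleftrightarrow> bounded_variation (indicat_real \<Omega>)"

definition perimeter :: "'n::euclidean_space set \<Rightarrow> real" where
  "perimeter \<Omega> = real_of_ereal (Variation (indicat_real \<Omega>))"

end

(*
  Put q = 1_Omega * |V_g g|^2, so q(z) = <H pi(z)g, pi(z)g> for the time-frequency shifts pi(z)g.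
  The spectral theorem for H gives q = sum_k lam_k |V_g h_k|^2, and by Moyal's identity every
  |V_g h_k|^2 has integral 1; hence rho - q = sum_k (1_{k <= A} - lam_k) |V_g h_k|^2 has L^1 norm at most
  A - |Omega| + 2 S with S = sum_{k > A} lam_k. Comparing all eigenvalues with lam_A shows
  S <= sum_k lam_k (1 - lam_k), which is the integral of |V_g g(z - w)|^2 over z in Omega and w outside
  Omega, and is at most ||g||_{M*}^2 |bdry Omega|, because |Omega \ (Omega + v)| <= |v| |bdry Omega|. As also
  S <= |Omega|, S is bounded by the geometric mean of the two bounds.

  Only the first n eigenfunctions are ever used, with an error of at most lam_(n+1) in the expansion
  of q, so neither completeness of L^2 nor infinite sums are needed.
*)

theory Submission
  imports Defs "HOL-Probability.Characteristic_Functions" "HOL-Complex_Analysis.Great_Picard"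
begin

text \<open>The eigensystem is given only as a list that spans every eigenspace; nothing in it says
  that the list exhausts the operator. The obstacle is to show that on functions orthogonal to the
  first n eigenfunctions the quadratic form is at most the next eigenvalue times the squared norm. A
  larger value would produce, by compactness, an eigenfunction missing from the list
  (\<open>eigenfunction_exists\<close>, \<open>form_tail_le\<close>). Compactness is found on the
  side of the transforms, which are equicontinuous for bounded families of functions. Moyal's
  identity rests on Plancherel's, which is derived from Gaussian summation. The perimeter is a
  supremum over C^1 fields, so the translation estimate averages a C^1 cutoff along the translation
  vector to obtain an admissible field. The term 1 / |\<Omega>| is the rounding error A - |\<Omega>|
  <= 1. The argument yields the factor 2 in front of the square root; the stated 4 leaves
  slack.\<close>

hide_const (open) Convolution.convolution

section \<open>Integration on Euclidean space\<close>

lemma lborel_distr_minus_right: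
  fixes x :: "'a::euclidean_space"
  shows "distr lborel borel (\<lambda>t. t - x) = lborel"
proof -
  have "(\<lambda>t. t - x) = (+) (- x)" by auto
  then show ?thesis using lborel_distr_plus[of "-x"] by simp
qed

lemma lborel_distr_minus_left:
  fixes x :: "'a::euclidean_space"
  shows "distr lborel borel (\<lambda>t. x - t) = lborel"
  using lborel_affine[of "-1" x] by (simp add: density_1)

lemma nn_integral_lborel_shift:
  fixes x :: "'a::euclidean_space"
  assumes [measurable]: "f \<in> borel_measurable borel"
  shows "(\<integral>\<^sup>+t. f (t - x) \<partial>lborel) = (\<integral>\<^sup>+t. f t \<partial>lborel)"
  by (subst (2) lborel_distr_minus_right[of x, symmetric]) (simp add: nn_integral_distr)

lemma nn_integral_lborel_reflect:
  fixes x :: "'a::euclidean_space"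
  assumes [measurable]: "f \<in> borel_measurable borel"
  shows "(\<integral>\<^sup>+t. f (x - t) \<partial>lborel) = (\<integral>\<^sup>+t. f t \<partial>lborel)"
  by (subst (2) lborel_distr_minus_left[of x, symmetric]) (simp add: nn_integral_distr)

lemma integral_lborel_shift:
  fixes x :: "'a::euclidean_space" and f :: "'a \<Rightarrow> 'b::{banach, second_countable_topology}"
  assumes [measurable]: "f \<in> borel_measurable borel"
  shows "(LINT t|lborel. f (t - x)) = (LINT t|lborel. f t)"
  by (subst (2) lborel_distr_minus_right[of x, symmetric]) (simp add: integral_distr)

lemma integral_lborel_reflect:
  fixes x :: "'a::euclidean_space" and f :: "'a \<Rightarrow> 'b::{banach, second_countable_topology}"
  assumes [measurable]: "f \<in> borel_measurable borel"
  shows "(LINT t|lborel. f (x - t)) = (LINT t|lborel. f t)"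
  by (subst (2) lborel_distr_minus_left[of x, symmetric]) (simp add: integral_distr)

lemma integrable_lborel_shift:
  fixes x :: "'a::euclidean_space" and f :: "'a \<Rightarrow> 'b::{banach, second_countable_topology}"
  assumes "integrable lborel f"
  shows "integrable lborel (\<lambda>t. f (t - x))"
proof -
  have [measurable]: "f \<in> borel_measurable borel" using assms by auto
  show ?thesis
    using assms by (subst (asm) lborel_distr_minus_right[of x, symmetric]) (simp add: integrable_distr_eq)
qed

section \<open>Products and sums of square-integrable functions\<close>

lemma integrable_mult_square_integrable:
  fixes f g :: "'b \<Rightarrow> complex"
  assumes [measurable]: "f \<in> borel_measurable M" "g \<in> borel_measurable M"
    and "integrable M (\<lambda>x. (cmod (f x))\<^sup>2)" "integrable M (\<lambda>x. (cmod (g x))\<^sup>2)"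
  shows "integrable M (\<lambda>x. f x * g x)"
proof (rule Bochner_Integration.integrable_bound)
  show "integrable M (\<lambda>x. (cmod (f x))\<^sup>2 + (cmod (g x))\<^sup>2)"
    using assms by auto
  have "a * b \<le> a\<^sup>2 + b\<^sup>2" if "a \<ge> 0" "b \<ge> 0" for a b :: real
    using sum_squares_bound[of a b] that mult_nonneg_nonneg[of a b] by linarith
  then show "AE x in M. norm (f x * g x) \<le> norm ((cmod (f x))\<^sup>2 + (cmod (g x))\<^sup>2)"
    by (auto simp: norm_mult)
qed measurable

text \<open>Reduced to nonnegative integrals of moduli. The product is bilinear;
  \<open>L2_inner\<close> and the form of the operator are reached by conjugating the second
  factor.\<close>

lemma Cauchy_Schwarz_integral:
  fixes f g :: "'b \<Rightarrow> complex"
  assumes [measurable]: "f \<in> borel_measurable M" "g \<in> borel_measurable M"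
    and f: "integrable M (\<lambda>x. (cmod (f x))\<^sup>2)" and g: "integrable M (\<lambda>x. (cmod (g x))\<^sup>2)"
  shows "(cmod (LINT x|M. f x * g x))\<^sup>2 \<le> (LINT x|M. (cmod (f x))\<^sup>2) * (LINT x|M. (cmod (g x))\<^sup>2)"
proof -
  have i: "integrable M (\<lambda>x. f x * g x)"
    by (rule integrable_mult_square_integrable) (use assms in auto)
  then have j: "integrable M (\<lambda>x. cmod (f x) * cmod (g x))"
    using integrable_norm[OF i] by (simp add: norm_mult)
  have "ennreal ((LINT x|M. cmod (f x) * cmod (g x))\<^sup>2)
      = (\<integral>\<^sup>+x. ennreal (cmod (f x)) * ennreal (cmod (g x)) \<partial>M)\<^sup>2"
    using j by (subst ennreal_mult[symmetric])
      (auto simp: nn_integral_eq_integral ennreal_power simp flip: ennreal_mult)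
  also have "\<dots> \<le> (\<integral>\<^sup>+x. ennreal (cmod (f x)) ^ 2 \<partial>M) * (\<integral>\<^sup>+x. ennreal (cmod (g x)) ^ 2 \<partial>M)"
    by (rule Cauchy_Schwarz_nn_integral) auto
  also have "\<dots> = ennreal ((LINT x|M. (cmod (f x))\<^sup>2) * (LINT x|M. (cmod (g x))\<^sup>2))"
    using f g by (simp add: ennreal_power nn_integral_eq_integral ennreal_mult)
  finally have "(LINT x|M. cmod (f x) * cmod (g x))\<^sup>2
      \<le> (LINT x|M. (cmod (f x))\<^sup>2) * (LINT x|M. (cmod (g x))\<^sup>2)"
    by (subst (asm) ennreal_le_iff) auto
  moreover have "cmod (LINT x|M. f x * g x) \<le> (LINT x|M. cmod (f x) * cmod (g x))"
    using integral_norm_bound[of M "\<lambda>x. f x * g x"] by (simp add: norm_mult)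
  ultimately show ?thesis
    using order_trans[OF power_mono[OF _ norm_ge_zero]] by blast
qed

lemma square_integrable_add:
  fixes f g :: "'b \<Rightarrow> complex"
  assumes [measurable]: "f \<in> borel_measurable M" "g \<in> borel_measurable M"
    and f: "integrable M (\<lambda>x. (cmod (f x))\<^sup>2)" and g: "integrable M (\<lambda>x. (cmod (g x))\<^sup>2)"
  shows "integrable M (\<lambda>x. (cmod (f x + g x))\<^sup>2)"
proof (rule Bochner_Integration.integrable_bound)
  show "integrable M (\<lambda>x. 2 * (cmod (f x))\<^sup>2 + 2 * (cmod (g x))\<^sup>2)"
    using f g by auto
  have "(cmod (a + b))\<^sup>2 \<le> 2 * (cmod a)\<^sup>2 + 2 * (cmod b)\<^sup>2" for a b
  proof -
    have "(cmod (a + b))\<^sup>2 \<le> (cmod a + cmod b)\<^sup>2"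
      by (intro power_mono norm_triangle_ineq) auto
    then show ?thesis
      using sum_squares_bound[of "cmod a" "cmod b"] by (simp add: power2_sum)
  qed
  then show "AE x in M. norm ((cmod (f x + g x))\<^sup>2) \<le> norm (2 * (cmod (f x))\<^sup>2 + 2 * (cmod (g x))\<^sup>2)"
    by auto
qed measurable


lemma borel_measurable_cnj[measurable]:
  assumes "f \<in> borel_measurable M"
  shows "(\<lambda>x. cnj (f x)) \<in> borel_measurable M"
  using assms by (intro borel_measurable_continuous_on[OF _ assms]) (intro continuous_intros)


section \<open>The space of square-integrable functions\<close>

lemma L2_spaceD:
  assumes "f \<in> L2_space"
  shows "f \<in> borel_measurable borel" "integrable lborel (\<lambda>t. (cmod (f t))\<^sup>2)"
  using assms by (auto simp: L2_space_def)

lemma L2_spaceI: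
  assumes "f \<in> borel_measurable borel" "integrable lborel (\<lambda>t. (cmod (f t))\<^sup>2)"
  shows "f \<in> L2_space"
  using assms by (auto simp: L2_space_def)

lemma L2_add: "f \<in> L2_space \<Longrightarrow> g \<in> L2_space \<Longrightarrow> (\<lambda>t. f t + g t) \<in> L2_space"
  by (rule L2_spaceI, rule borel_measurable_add) (auto intro: square_integrable_add simp: L2_spaceD)

lemma L2_scale: "f \<in> L2_space \<Longrightarrow> (\<lambda>t. c * f t) \<in> L2_space"
  by (intro L2_spaceI borel_measurable_times) (auto simp: norm_mult power_mult_distrib L2_spaceD)

lemma L2_diff: "f \<in> L2_space \<Longrightarrow> g \<in> L2_space \<Longrightarrow> (\<lambda>t. f t - g t) \<in> L2_space"
  using L2_add[of f "\<lambda>t. - 1 * g t"] L2_scale[of g "-1"] by simp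

lemma L2_zero: "(\<lambda>t. 0) \<in> L2_space"
  by (auto intro!: L2_spaceI)

lemma L2_sum:
  assumes "\<And>k. k \<in> K \<Longrightarrow> f k \<in> L2_space"
  shows "(\<lambda>t. \<Sum>k\<in>K. f k t) \<in> L2_space"
proof (cases "finite K")
  case True
  then show ?thesis
    using assms by (induction K rule: finite_induct) (auto intro!: L2_add L2_zero)
qed (simp add: L2_zero)

lemma integrable_L2_inner: "f \<in> L2_space \<Longrightarrow> g \<in> L2_space \<Longrightarrow> integrable lborel (\<lambda>t. f t * cnj (g t))"
  using integrable_mult_square_integrable[of f lborel "\<lambda>t. cnj (g t)"]
  by (simp add: L2_spaceD borel_measurable_cnj)

lemma norm2_nonneg: "norm2 f \<ge> 0"
  by (simp add: norm2_def)

lemma norm2_sq: "(norm2 f)\<^sup>2 = (LINT t|lborel. (cmod (f t))\<^sup>2)"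
  by (simp add: norm2_def)

lemma L2_inner_self: "L2_inner f f = complex_of_real ((norm2 f)\<^sup>2)"
  by (simp add: L2_inner_def norm2_sq complex_norm_square[symmetric] del: of_real_power)

lemma L2_inner_cnj: "cnj (L2_inner f g) = L2_inner g f"
  by (simp add: L2_inner_def mult.commute flip: Bochner_Integration.integral_cnj)

lemma L2_inner_Cauchy_Schwarz:
  assumes "f \<in> L2_space" "g \<in> L2_space"
  shows "cmod (L2_inner f g) \<le> norm2 f * norm2 g"
proof (rule power2_le_imp_le)
  show "(cmod (L2_inner f g))\<^sup>2 \<le> (norm2 f * norm2 g)\<^sup>2"
    using Cauchy_Schwarz_integral[of f lborel "\<lambda>t. cnj (g t)"] assms
    by (simp add: L2_inner_def norm2_sq power_mult_distrib L2_spaceD borel_measurable_cnj)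
qed (simp add: norm2_nonneg)

lemma L2_inner_diff_left:
  assumes "f \<in> L2_space" "g \<in> L2_space" "u \<in> L2_space"
  shows "L2_inner (\<lambda>t. f t - g t) u = L2_inner f u - L2_inner g u"
  by (simp add: L2_inner_def ring_distribs integrable_L2_inner assms)

lemma L2_inner_scale_left: "L2_inner (\<lambda>t. c * f t) u = c * L2_inner f u"
  by (simp only: L2_inner_def integral_mult_right_zero[symmetric] mult.assoc)

lemma L2_inner_sum_left:
  assumes "\<And>k. k \<in> K \<Longrightarrow> f k \<in> L2_space" "u \<in> L2_space"
  shows "L2_inner (\<lambda>t. \<Sum>k\<in>K. f k t) u = (\<Sum>k\<in>K. L2_inner (f k) u)"
  by (simp add: L2_inner_def sum_distrib_right Bochner_Integration.integral_sum integrable_L2_inner assms)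

lemma L2_inner_scale_right: "L2_inner u (\<lambda>t. c * f t) = cnj c * L2_inner u f"
  using arg_cong[OF L2_inner_scale_left[of c f u], of cnj] by (simp add: L2_inner_cnj)

lemma L2_inner_diff_right:
  assumes "f \<in> L2_space" "g \<in> L2_space" "u \<in> L2_space"
  shows "L2_inner u (\<lambda>t. f t - g t) = L2_inner u f - L2_inner u g"
  using arg_cong[OF L2_inner_diff_left[OF assms], of cnj] by (simp add: L2_inner_cnj)

text \<open>Eigenfunction equations and spanning hold only almost everywhere; this carries them into
  inner products.\<close>

lemma L2_inner_cong_AE:
  assumes [measurable]: "f \<in> borel_measurable borel" "f' \<in> borel_measurable borel" "u \<in> borel_measurable borel"
    and "AE t in lborel. f t = f' t"
  shows "L2_inner f u = L2_inner f' u"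
  unfolding L2_inner_def by (rule integral_cong_AE) (use assms(4) in auto)

lemma norm2_scale: "norm2 (\<lambda>t. c * f t) = cmod c * norm2 f"
  by (simp add: norm2_def norm_mult power_mult_distrib real_sqrt_mult)

lemma norm2_diff_sq:
  assumes "f \<in> L2_space" "g \<in> L2_space"
  shows "(norm2 (\<lambda>t. f t - g t))\<^sup>2 = (norm2 f)\<^sup>2 - 2 * Re (L2_inner f g) + (norm2 g)\<^sup>2"
proof -
  have "complex_of_real ((norm2 (\<lambda>t. f t - g t))\<^sup>2)
      = L2_inner f f - L2_inner f g - (L2_inner g f - L2_inner g g)"
    unfolding L2_inner_self[symmetric]
    using assms by (simp add: L2_inner_diff_left L2_inner_diff_right L2_diff)
  also have "L2_inner g f = cnj (L2_inner f g)" by (simp add: L2_inner_cnj)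
  finally have eq: "complex_of_real ((norm2 (\<lambda>t. f t - g t))\<^sup>2)
      = L2_inner f f - L2_inner f g - (cnj (L2_inner f g) - L2_inner g g)" .
  show ?thesis
    using arg_cong[OF eq, of Re] unfolding L2_inner_self Re_complex_of_real by simp
qed

lemma norm2_triangle:
  assumes "f \<in> L2_space" "g \<in> L2_space"
  shows "norm2 (\<lambda>t. f t + g t) \<le> norm2 f + norm2 g"
proof (rule power2_le_imp_le)
  \<comment> \<open>Applied to \<open>f\<close> and \<open>-g\<close>, the formula for the norm of a
    difference serves for sums.\<close>
  have g': "(\<lambda>t. -1 * g t) \<in> L2_space" using assms by (intro L2_scale)
  have "(norm2 (\<lambda>t. f t + g t))\<^sup>2 = (norm2 f)\<^sup>2 + 2 * Re (L2_inner f g) + (norm2 g)\<^sup>2"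
    using norm2_diff_sq[OF assms(1) g'] L2_inner_scale_right[of f "-1" g] norm2_scale[of "-1" g] by simp
  also have "Re (L2_inner f g) \<le> norm2 f * norm2 g"
    using L2_inner_Cauchy_Schwarz[OF assms] complex_Re_le_cmod order_trans by blast
  finally show "(norm2 (\<lambda>t. f t + g t))\<^sup>2 \<le> (norm2 f + norm2 g)\<^sup>2"
    by (simp add: power2_sum)
qed (simp add: norm2_nonneg)

lemma norm2_diff_le:
  assumes "f \<in> L2_space" "g \<in> L2_space"
  shows "norm2 (\<lambda>t. f t - g t) \<le> norm2 f + norm2 g"
  using norm2_triangle[OF assms(1) L2_scale[OF assms(2), of "-1"]] norm2_scale[of "-1" g] by simp


section \<open>Continuity of translation\<close>

text \<open>\<open>U\<close> and its translate have equal measure, so their symmetric difference has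
  twice the measure of the part of \<open>U\<close> outside the translate. That part is dominated by
  \<open>U\<close>, and by openness each point of \<open>U\<close> eventually leaves it.\<close>

lemma integral_translate_indicator_open:
  fixes U :: "'a::euclidean_space set" and h :: "nat \<Rightarrow> 'a"
  assumes U: "open U" "emeasure lborel U < \<infinity>" and h: "h \<longlonglongrightarrow> 0"
  shows "(\<lambda>n. LINT t|lborel. \<bar>indicat_real U (t - h n) - indicat_real U t\<bar>) \<longlonglongrightarrow> 0"
proof -
  have [measurable]: "U \<in> sets borel" using U by auto
  have iU: "integrable lborel (indicat_real U)" using U by (simp add: integrable_indicator_iff)
  have iU': "integrable lborel (\<lambda>t. indicat_real U (t - x))" for x
    using integrable_lborel_shift[OF iU] .
  have ip: "integrable lborel (\<lambda>t. indicat_real U t * (1 - indicat_real U (t - x)))" for x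
    by (rule Bochner_Integration.integrable_bound[OF iU]) (auto simp: indicator_def)
  \<comment> \<open>For a, b in {0, 1}, |b - a| = (b - a) + 2 a (1 - b); the term b - a integrates
    to 0 by translation invariance.\<close>
  have eq: "(LINT t|lborel. \<bar>indicat_real U (t - x) - indicat_real U t\<bar>)
      = 2 * (LINT t|lborel. indicat_real U t * (1 - indicat_real U (t - x)))" for x
  proof -
    have "(LINT t|lborel. \<bar>indicat_real U (t - x) - indicat_real U t\<bar>)
        = (LINT t|lborel. (indicat_real U (t - x) - indicat_real U t) + 2 * (indicat_real U t * (1 - indicat_real U (t - x))))"
      by (rule Bochner_Integration.integral_cong) (auto simp: indicator_def)
    also have "\<dots> = (LINT t|lborel. indicat_real U (t - x) - indicat_real U t)
        + (LINT t|lborel. 2 * (indicat_real U t * (1 - indicat_real U (t - x))))"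
      by (rule Bochner_Integration.integral_add) (use iU iU' ip in auto)
    also have "(LINT t|lborel. indicat_real U (t - x) - indicat_real U t) = 0"
      using iU iU' integral_lborel_shift[of "indicat_real U" x] by simp
    finally show ?thesis by simp
  qed
  have "(\<lambda>n. LINT t|lborel. indicat_real U t * (1 - indicat_real U (t - h n))) \<longlonglongrightarrow> integral\<^sup>L (lborel :: 'a measure) (\<lambda>t. 0 :: real)"
  proof (rule integral_dominated_convergence[where w = "indicat_real U"])
    have "(\<lambda>n. indicat_real U t * (1 - indicat_real U (t - h n))) \<longlonglongrightarrow> 0" for t
    proof (cases "t \<in> U")
      case True
      have "(\<lambda>n. t - h n) \<longlonglongrightarrow> t - 0" by (intro tendsto_intros h)
      then have "\<forall>\<^sub>F n in sequentially. t - h n \<in> U"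
        using U True by (simp add: tendsto_def)
      then have "\<forall>\<^sub>F n in sequentially. indicat_real U t * (1 - indicat_real U (t - h n)) = 0"
        by eventually_elim simp
      then show ?thesis by (rule tendsto_eventually)
    qed auto
    then show "AE t in lborel. (\<lambda>n. indicat_real U t * (1 - indicat_real U (t - h n))) \<longlonglongrightarrow> 0" by simp
  qed (use iU in \<open>auto simp: indicator_def\<close>)
  then show ?thesis
    unfolding eq using tendsto_mult_right_zero by fastforce
qed

text \<open>The density argument in sequential form: the vanishing comparison sequence may depend on
  the tolerance \<open>e\<close>.\<close>

lemma tendsto_zero_approx:
  fixes a :: "nat \<Rightarrow> real"
  assumes "\<And>e. e > 0 \<Longrightarrow> \<exists>b. b \<longlonglongrightarrow> 0 \<and> (\<forall>n. \<bar>a n\<bar> \<le> b n + e)"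
  shows "a \<longlonglongrightarrow> 0"
proof (rule LIMSEQ_I)
  fix e :: real assume "e > 0"
  then obtain b where b: "b \<longlonglongrightarrow> 0" "\<And>n. \<bar>a n\<bar> \<le> b n + e/2"
    using assms[of "e/2"] by auto
  obtain N where "\<And>n. n \<ge> N \<Longrightarrow> norm (b n - 0) < e/2"
    using LIMSEQ_D[OF b(1), of "e/2"] \<open>e > 0\<close> by auto
  then have "norm (a n - 0) < e" if "n \<ge> N" for n
    using b(2)[of n] that by fastforce
  then show "\<exists>no. \<forall>n\<ge>no. norm (a n - 0) < e" by blast
qed

text \<open>The error f - g enters once at t - x and once at t, with the same integral; hence the
  factor 2.\<close>

lemma integral_translate_approx:
  fixes f g :: "'a::euclidean_space \<Rightarrow> real"
  assumes f: "integrable lborel f" and g: "integrable lborel g"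
  shows "(LINT t|lborel. \<bar>f (t - x) - f t\<bar>)
    \<le> (LINT t|lborel. \<bar>g (t - x) - g t\<bar>) + 2 * (LINT t|lborel. \<bar>f t - g t\<bar>)"
proof -
  have fx: "integrable lborel (\<lambda>t. f (t - x))" and gx: "integrable lborel (\<lambda>t. g (t - x))"
    using f g by (auto intro: integrable_lborel_shift)
  have [measurable]: "f \<in> borel_measurable borel" "g \<in> borel_measurable borel"
    using f g by auto
  have "(LINT t|lborel. \<bar>f (t - x) - f t\<bar>)
      \<le> (LINT t|lborel. \<bar>g (t - x) - g t\<bar> + (\<bar>f (t - x) - g (t - x)\<bar> + \<bar>f t - g t\<bar>))"
    by (rule integral_mono) (use f g fx gx in auto)
  also have "\<dots> = (LINT t|lborel. \<bar>g (t - x) - g t\<bar>) +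
      ((LINT t|lborel. \<bar>f (t - x) - g (t - x)\<bar>) + (LINT t|lborel. \<bar>f t - g t\<bar>))"
    using f g fx gx by simp
  also have "(LINT t|lborel. \<bar>f (t - x) - g (t - x)\<bar>) = (LINT t|lborel. \<bar>f t - g t\<bar>)"
    by (rule integral_lborel_shift[of "\<lambda>t. \<bar>f t - g t\<bar>"]) measurable
  finally show ?thesis by simp
qed

text \<open>Induction over integrable functions. Only indicators involve the topology: outer
  regularity replaces a measurable set by an open one. Sums follow from the triangle inequality,
  limits from \<open>integral_translate_approx\<close>.\<close>

lemma translation_continuous_L1:
  fixes f :: "'a::euclidean_space \<Rightarrow> real" and h :: "nat \<Rightarrow> 'a"
  assumes "integrable lborel f" and h: "h \<longlonglongrightarrow> 0"
  shows "(\<lambda>n. LINT t|lborel. \<bar>f (t - h n) - f t\<bar>) \<longlonglongrightarrow> 0"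
  using assms(1)
proof (induction f)
  case (base A c)
  have [measurable]: "A \<in> sets borel" using base by auto
  have iA: "integrable lborel (indicat_real A)" using base by (simp add: integrable_indicator_iff)
  have "(\<lambda>n. LINT t|lborel. \<bar>indicat_real A (t - h n) - indicat_real A t\<bar>) \<longlonglongrightarrow> 0"
  proof (rule tendsto_zero_approx)
    fix e :: real assume "e > 0"
    then obtain U where U: "open U" "A \<subseteq> U" "emeasure lborel (U - A) < ennreal (e/4)"
      using outer_regular_lborel[of A "e/4"] base by auto
    have [measurable]: "U \<in> sets borel" using U by auto
    have UA: "U = A \<union> (U - A)" using U by auto
    have "emeasure lborel U \<le> emeasure lborel A + emeasure lborel (U - A)"
      by (subst (1) UA, rule emeasure_subadditive) auto
    also have "\<dots> < \<infinity>" using base U(3) by (simp add: order.strict_trans)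
    finally have fU: "emeasure lborel U < \<infinity>" .
    have iU: "integrable lborel (indicat_real U)" using fU by (simp add: integrable_indicator_iff)
    have "(LINT t|lborel. \<bar>indicat_real A t - indicat_real U t\<bar>) = (LINT t|lborel. indicat_real (U - A) t)"
      by (rule Bochner_Integration.integral_cong) (use U(2) in \<open>auto simp: indicator_def\<close>)
    also have "\<dots> = measure lborel (U - A)" by simp
    also have "\<dots> \<le> e / 4"
      using U(3) \<open>e > 0\<close> unfolding measure_def by (intro enn2real_leI) auto
    finally have "2 * (LINT t|lborel. \<bar>indicat_real A t - indicat_real U t\<bar>) \<le> e" using \<open>e > 0\<close> by simp
    then have "\<bar>LINT t|lborel. \<bar>indicat_real A (t - h n) - indicat_real A t\<bar>\<bar>
       \<le> (LINT t|lborel. \<bar>indicat_real U (t - h n) - indicat_real U t\<bar>) + e" for n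
      using integral_translate_approx[OF iA iU, of "h n"] by simp
    then show "\<exists>b. b \<longlonglongrightarrow> 0 \<and> (\<forall>n. \<bar>LINT t|lborel. \<bar>indicat_real A (t - h n) - indicat_real A t\<bar>\<bar> \<le> b n + e)"
      using integral_translate_indicator_open[OF U(1) fU h] by blast
  qed
  then have "(\<lambda>n. \<bar>c\<bar> * (LINT t|lborel. \<bar>indicat_real A (t - h n) - indicat_real A t\<bar>)) \<longlonglongrightarrow> \<bar>c\<bar> * 0"
    by (intro tendsto_intros)
  moreover have "\<bar>indicat_real A (t - x) *\<^sub>R c - indicat_real A t *\<^sub>R c\<bar>
      = \<bar>c\<bar> * \<bar>indicat_real A (t - x) - indicat_real A t\<bar>" for t x
    by (auto simp: indicator_def)
  ultimately show ?case by simp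
next
  case (add f g)
  note [measurable] = borel_measurable_integrable[OF add(1)] borel_measurable_integrable[OF add(2)]
  have *: "integrable lborel (\<lambda>t. f (t - h n))" "integrable lborel (\<lambda>t. g (t - h n))" for n
    using add(1,2) by (auto intro: integrable_lborel_shift)
  show ?case
  proof (rule tendsto_sandwich[OF _ _ tendsto_const])
    show "(\<lambda>n. (LINT t|lborel. \<bar>f (t - h n) - f t\<bar>) + (LINT t|lborel. \<bar>g (t - h n) - g t\<bar>)) \<longlonglongrightarrow> 0"
      using tendsto_add[OF add(3,4)] by simp
    have "(LINT t|lborel. \<bar>f (t - h n) + g (t - h n) - (f t + g t)\<bar>)
      \<le> (LINT t|lborel. \<bar>f (t - h n) - f t\<bar> + \<bar>g (t - h n) - g t\<bar>)" for n
      by (rule integral_mono) (use add(1,2) * in auto)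
    also have "\<And>n. \<dots> n = (LINT t|lborel. \<bar>f (t - h n) - f t\<bar>) + (LINT t|lborel. \<bar>g (t - h n) - g t\<bar>)"
      by (rule Bochner_Integration.integral_add) (use add(1,2) * in auto)
    finally show "\<forall>\<^sub>F n in sequentially. (LINT t|lborel. \<bar>f (t - h n) + g (t - h n) - (f t + g t)\<bar>)
       \<le> (LINT t|lborel. \<bar>f (t - h n) - f t\<bar>) + (LINT t|lborel. \<bar>g (t - h n) - g t\<bar>)" by simp
  qed simp
next
  case (lim f s)
  show ?case
  proof (rule tendsto_zero_approx)
    fix e :: real assume "e > 0"
    have [measurable]: "f \<in> borel_measurable borel" "\<And>i. s i \<in> borel_measurable borel"
      using lim.hyps(1,4) by auto
    have "(\<lambda>i. LINT t|lborel. \<bar>f t - s i t\<bar>) \<longlonglongrightarrow> integral\<^sup>L (lborel :: 'a measure) (\<lambda>t. 0 :: real)"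
    proof (rule integral_dominated_convergence[where w = "\<lambda>t. 3 * \<bar>f t\<bar>"])
      have "(\<lambda>i. \<bar>f t - s i t\<bar>) \<longlonglongrightarrow> \<bar>f t - f t\<bar>" for t
        using lim.hyps(2)[of t] by (intro tendsto_intros) auto
      then show "AE t in lborel. (\<lambda>i. \<bar>f t - s i t\<bar>) \<longlonglongrightarrow> 0" by simp
      \<comment> \<open>The induction rule bounds the approximants by 2 |f|, so the difference is
        dominated by 3 |f|.\<close>
      have "\<bar>f t - s i t\<bar> \<le> 3 * \<bar>f t\<bar>" for t i using lim.hyps(3)[of t i] by simp
      then show "AE t in lborel. norm \<bar>f t - s i t\<bar> \<le> 3 * \<bar>f t\<bar>" for i by simp
    qed (use lim.hyps(4) in auto)
    then have "\<forall>\<^sub>F i in sequentially. (LINT t|lborel. \<bar>f t - s i t\<bar>) < e / 2"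
      by (rule order_tendstoD) (use \<open>e > 0\<close> in simp)
    then obtain i where "(LINT t|lborel. \<bar>f t - s i t\<bar>) < e / 2"
      using eventually_happens'[OF sequentially_bot] by blast
    then have i: "2 * (LINT t|lborel. \<bar>f t - s i t\<bar>) \<le> e" by simp
    then have "\<bar>LINT t|lborel. \<bar>f (t - h n) - f t\<bar>\<bar> \<le> (LINT t|lborel. \<bar>s i (t - h n) - s i t\<bar>) + e" for n
      using integral_translate_approx[OF lim.hyps(4) lim.hyps(1)[of i], of "h n"] by simp
    then show "\<exists>b. b \<longlonglongrightarrow> 0 \<and> (\<forall>n. \<bar>LINT t|lborel. \<bar>f (t - h n) - f t\<bar>\<bar> \<le> b n + e)"
      using lim.IH[of i] by blast
  qed
qed

lemma translation_continuous_L2: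
  fixes f :: "'a::euclidean_space \<Rightarrow> complex" and h :: "nat \<Rightarrow> 'a"
  assumes f: "f \<in> L2_space" and h: "h \<longlonglongrightarrow> 0"
  shows "(\<lambda>n. norm2 (\<lambda>t. f (t - h n) - f t)) \<longlonglongrightarrow> 0"
proof -
  \<comment> \<open>For the positive and negative parts \<open>p\<close> of the real and imaginary part,
    \<open>(p s - p t)\<^sup>2 \<le> \<bar>(p s)\<^sup>2 - (p t)\<^sup>2\<bar>\<close>, which reduces the claim to \<open>L\<^sup>1\<close>.\<close>
  define P where "P = (\<lambda>(a, b) z. (max (if a then if b then Re z else - Re z else if b then Im z else - Im z) 0)\<^sup>2)"
  define I :: "(bool \<times> bool) set" where "I = UNIV"
  have [measurable]: "f \<in> borel_measurable borel" using f by (rule L2_spaceD)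
  have sq: "(max a 0 - max b 0)\<^sup>2 \<le> \<bar>(max a 0)\<^sup>2 - (max b 0)\<^sup>2\<bar>" for a b :: real
  proof -
    have "(max a 0 - max b 0)\<^sup>2 = \<bar>max a 0 - max b 0\<bar> * \<bar>max a 0 - max b 0\<bar>" by (simp add: power2_eq_square)
    also have "\<dots> \<le> \<bar>max a 0 - max b 0\<bar> * \<bar>max a 0 + max b 0\<bar>" by (intro mult_left_mono) auto
    also have "\<dots> = \<bar>(max a 0)\<^sup>2 - (max b 0)\<^sup>2\<bar>" by (simp only: abs_mult[symmetric] power2_eq_square square_diff_square_factored mult.commute)
    finally show ?thesis .
  qed
  \<comment> \<open>The parallelogram identity, to be applied to the increments of the positive and
    of the negative part.\<close>
  have aux: "(p - q)\<^sup>2 \<le> 2 * p\<^sup>2 + 2 * q\<^sup>2" for p q :: real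
    using zero_le_power2[of "p + q"] by (simp add: power2_sum power2_diff)
  have sq2: "(a - b)\<^sup>2 \<le> 2 * \<bar>(max a 0)\<^sup>2 - (max b 0)\<^sup>2\<bar> + 2 * \<bar>(max (-a) 0)\<^sup>2 - (max (-b) 0)\<^sup>2\<bar>" for a b :: real
  proof -
    have "a - b = (max a 0 - max b 0) - (max (-a) 0 - max (-b) 0)" by auto
    then have "(a - b)\<^sup>2 \<le> 2 * (max a 0 - max b 0)\<^sup>2 + 2 * (max (-a) 0 - max (-b) 0)\<^sup>2"
      using aux[of "max a 0 - max b 0" "max (-a) 0 - max (-b) 0"] by (simp only:)
    then show ?thesis using sq[of a b] sq[of "-a" "-b"] by linarith
  qed
  have I: "I = {(True, True), (True, False), (False, True), (False, False)}" unfolding I_def by auto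
  define D where "D = (\<lambda>a b. \<bar>(max a 0)\<^sup>2 - (max b 0)\<^sup>2\<bar> :: real)"
  have sq3: "(a - b)\<^sup>2 \<le> 2 * D a b + 2 * D (- a) (- b)" for a b using sq2 by (simp add: D_def)
  have le: "(cmod (z - w))\<^sup>2 \<le> 2 * (\<Sum>i\<in>I. \<bar>P i z - P i w\<bar>)" for z w
  proof -
    have "(\<Sum>i\<in>I. \<bar>P i z - P i w\<bar>)
        = D (Re z) (Re w) + D (- Re z) (- Re w) + D (Im z) (Im w) + D (- Im z) (- Im w)"
      by (simp add: I P_def D_def)
    moreover have "(cmod (z - w))\<^sup>2 = (Re z - Re w)\<^sup>2 + (Im z - Im w)\<^sup>2" by (simp add: cmod_power2)
    ultimately show ?thesis
      using sq3[of "Re z" "Re w"] sq3[of "Im z" "Im w"] by linarith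
  qed
  have iP: "integrable lborel (\<lambda>t. P i (f t))" for i
  proof (rule Bochner_Integration.integrable_bound[OF L2_spaceD(2)[OF f]])
    have "(max a 0)\<^sup>2 \<le> a\<^sup>2" for a :: real by (simp add: max_def)
    moreover have "a\<^sup>2 = (- a)\<^sup>2" for a :: real by simp
    ultimately have *: "(max a 0)\<^sup>2 \<le> a\<^sup>2" "(max (-a) 0)\<^sup>2 \<le> a\<^sup>2" for a :: real by metis+
    have m: "(max a 0)\<^sup>2 \<le> a\<^sup>2 + b\<^sup>2" "(max (-a) 0)\<^sup>2 \<le> a\<^sup>2 + b\<^sup>2"
      "(max a 0)\<^sup>2 \<le> b\<^sup>2 + a\<^sup>2" "(max (-a) 0)\<^sup>2 \<le> b\<^sup>2 + a\<^sup>2" for a b :: real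
      using *[of a] zero_le_power2[of b] by linarith+
    have "P i z \<le> (cmod z)\<^sup>2" for z
      by (cases i) (simp add: P_def cmod_power2 m)
    then show "AE t in lborel. norm (P i (f t)) \<le> norm ((cmod (f t))\<^sup>2)"
      by (cases i) (auto simp: P_def)
    show "(\<lambda>t. P i (f t)) \<in> borel_measurable lborel" by (cases i) (simp add: P_def)
  qed
  have iP': "integrable lborel (\<lambda>t. P i (f (t - x)))" for i x
    using integrable_lborel_shift[OF iP] .
  have "(\<lambda>n. 2 * (\<Sum>i\<in>I. LINT t|lborel. \<bar>P i (f (t - h n)) - P i (f t)\<bar>)) \<longlonglongrightarrow> 2 * (\<Sum>i\<in>I. 0)"
    by (intro tendsto_intros tendsto_sum translation_continuous_L1[OF iP h])
  then have lim: "(\<lambda>n. 2 * (\<Sum>i\<in>I. LINT t|lborel. \<bar>P i (f (t - h n)) - P i (f t)\<bar>)) \<longlonglongrightarrow> 0" by simp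
  have "(LINT t|lborel. (cmod (f (t - h n) - f t))\<^sup>2) \<le> 2 * (\<Sum>i\<in>I. LINT t|lborel. \<bar>P i (f (t - h n)) - P i (f t)\<bar>)" for n
  proof -
    have i: "integrable lborel (\<lambda>t. 2 * (\<Sum>i\<in>I. \<bar>P i (f (t - h n)) - P i (f t)\<bar>))"
      using iP iP' by auto
    have "(LINT t|lborel. (cmod (f (t - h n) - f t))\<^sup>2) \<le> (LINT t|lborel. 2 * (\<Sum>i\<in>I. \<bar>P i (f (t - h n)) - P i (f t)\<bar>))"
      by (rule integral_mono'[OF i le]) simp
    also have "\<dots> = 2 * (\<Sum>i\<in>I. LINT t|lborel. \<bar>P i (f (t - h n)) - P i (f t)\<bar>)"
      using iP iP' by (simp add: Bochner_Integration.integral_sum)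
    finally show ?thesis .
  qed
  then have "(\<lambda>n. LINT t|lborel. (cmod (f (t - h n) - f t))\<^sup>2) \<longlonglongrightarrow> 0"
    by (intro tendsto_sandwich[OF _ _ tendsto_const lim]) auto
  then show ?thesis unfolding norm2_def using tendsto_real_sqrt by fastforce
qed


section \<open>The Plancherel identity\<close>

lemma borel_measurable_cis[measurable]:
  assumes "f \<in> borel_measurable M"
  shows "(\<lambda>x. cis (f x)) \<in> borel_measurable M"
  by (rule borel_measurable_continuous_on[OF _ assms]) (intro continuous_intros)

text \<open>Up to the factor \<open>sqrt (2 * pi)\<close> the Gaussian is the standard normal
  density, so its transform is a characteristic function.\<close>

lemma gaussian_fourier_real:
  "integrable lborel (\<lambda>x. exp (- x\<^sup>2 / 2) *\<^sub>R cis (s * x))"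
  "(LINT x|lborel. exp (- x\<^sup>2 / 2) *\<^sub>R cis (s * x)) = sqrt (2 * pi) * exp (- s\<^sup>2 / 2)"
proof -
  have d: "exp (- x\<^sup>2 / 2) = sqrt (2 * pi) * std_normal_density x" for x :: real
    by (simp add: std_normal_density_def)
  have i: "integrable lborel (\<lambda>x. std_normal_density x *\<^sub>R cis (s * x))"
    by (rule Bochner_Integration.integrable_bound[where f=std_normal_density]) (auto simp: normal_density_nonneg)
  then show "integrable lborel (\<lambda>x. exp (- x\<^sup>2 / 2) *\<^sub>R cis (s * x))"
    unfolding d scaleR_scaleR[symmetric] by (rule integrable_scaleR_right)
  have "(LINT x|lborel. std_normal_density x *\<^sub>R cis (s * x)) = char std_normal_distribution s"
    unfolding char_def by (subst integral_density) (auto simp: cis_conv_exp normal_density_nonneg)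
  then have "(LINT x|lborel. std_normal_density x *\<^sub>R cis (s * x)) = exp (- s\<^sup>2 / 2)"
    by (simp add: char_std_normal_distribution)
  then show "(LINT x|lborel. exp (- x\<^sup>2 / 2) *\<^sub>R cis (s * x)) = sqrt (2 * pi) * exp (- s\<^sup>2 / 2)"
    unfolding d scaleR_scaleR[symmetric] by (simp add: scaleR_conv_of_real)
qed

text \<open>Gaussian and character both factor over the coordinates, which reduces the claim to one
  dimension on a product measure.\<close>

lemma gaussian_fourier:
  fixes s :: "'a::euclidean_space"
  shows "integrable lborel (\<lambda>y::'a. exp (- (norm y)\<^sup>2 / 2))" (is ?I)
    and "(LINT y|lborel. exp (- (norm y)\<^sup>2 / 2) *\<^sub>R cis (s \<bullet> y))
      = complex_of_real (sqrt (2 * pi) ^ DIM('a) * exp (- (norm s)\<^sup>2 / 2))" (is ?F)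
proof -
  interpret product_sigma_finite "\<lambda>b::'a. lborel :: real measure" ..
  \<comment> \<open>\<open>L\<close> assembles a vector from its coordinates; by
    \<open>lborel_eq\<close> Lebesgue measure is the image of the product measure under it.\<close>
  define L where "L = (\<lambda>f. \<Sum>b\<in>Basis. f b *\<^sub>R b :: 'a)"
  have [measurable]: "L \<in> borel_measurable (Pi\<^sub>M Basis (\<lambda>b. lborel))"
    unfolding L_def by measurable
  have Lb: "L f \<bullet> b = f b" if "b \<in> Basis" for f b
    using that by (simp add: L_def inner_sum_left inner_Basis if_distrib cong: if_cong)
  have nrm: "(norm y)\<^sup>2 = (\<Sum>b\<in>Basis. (y \<bullet> b)\<^sup>2)" for y :: 'a
    by (subst power2_norm_eq_inner, subst euclidean_inner) (simp add: power2_eq_square)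
  have e1: "exp (- (norm y)\<^sup>2 / 2) = (\<Prod>b\<in>Basis. exp (- (y \<bullet> b)\<^sup>2 / 2))" for y :: 'a
    unfolding nrm by (simp add: exp_sum[symmetric] sum_negf sum_divide_distrib)
  have c1: "cis (s \<bullet> y) = (\<Prod>b\<in>Basis. cis ((s \<bullet> b) * (y \<bullet> b)))" for y :: 'a
    by (simp add: euclidean_inner[of s y] cis_conv_exp exp_sum[symmetric] sum_distrib_left)
  have eq: "exp (- (norm (L f))\<^sup>2 / 2) *\<^sub>R cis (s \<bullet> L f)
      = (\<Prod>b\<in>Basis. exp (- (f b)\<^sup>2 / 2) *\<^sub>R cis ((s \<bullet> b) * f b))" for f
    unfolding e1 c1 by (simp add: Lb scaleR_conv_of_real prod.distrib)
  have "integrable (Pi\<^sub>M Basis (\<lambda>b. lborel)) (\<lambda>f. \<Prod>b\<in>Basis. exp (- (f b)\<^sup>2 / 2) *\<^sub>R cis ((s \<bullet> b) * f b))"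
    by (rule product_integrable_prod[OF finite_Basis gaussian_fourier_real(1)])
  then have i: "integrable lborel (\<lambda>y. exp (- (norm y)\<^sup>2 / 2) *\<^sub>R cis (s \<bullet> y))"
    unfolding eq[symmetric] by (subst lborel_eq, fold L_def, subst integrable_distr_eq) auto
  show ?I using integrable_norm[OF i] by simp
  have "(LINT y|lborel. exp (- (norm y)\<^sup>2 / 2) *\<^sub>R cis (s \<bullet> y))
     = (\<integral>f. (\<Prod>b\<in>Basis. exp (- (f b)\<^sup>2 / 2) *\<^sub>R cis ((s \<bullet> b) * f b)) \<partial>Pi\<^sub>M Basis (\<lambda>b. lborel))"
    unfolding eq[symmetric] by (subst lborel_eq, fold L_def, subst integral_distr) auto
  also have "\<dots> = (\<Prod>b\<in>Basis. LINT x|lborel. exp (- x\<^sup>2 / 2) *\<^sub>R cis ((s \<bullet> b) * x))"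
    by (rule product_integral_prod[OF finite_Basis gaussian_fourier_real(1)])
  also have "\<dots> = (\<Prod>b\<in>Basis. complex_of_real (sqrt (2 * pi) * exp (- (s \<bullet> b)\<^sup>2 / 2)))"
    unfolding gaussian_fourier_real by simp
  also have "\<dots> = complex_of_real (sqrt (2 * pi) ^ DIM('a) * exp (- (norm s)\<^sup>2 / 2))"
    unfolding e1 by (simp add: prod.distrib)
  finally show ?F .
qed

lemma integral_lborel_scale:
  fixes f :: "'a::euclidean_space \<Rightarrow> 'b::{banach, second_countable_topology}"
  assumes [measurable]: "f \<in> borel_measurable borel" and "c > 0"
  shows "(LINT x|lborel. f x) = c ^ DIM('a) *\<^sub>R (LINT x|lborel. f (c *\<^sub>R x))"
  using assms(2)
  by (subst lborel_affine[of c 0]) (auto simp: integral_density integral_distr)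

lemma integrable_lborel_scale:
  fixes f :: "'a::euclidean_space \<Rightarrow> 'b::{banach, second_countable_topology}"
  assumes "integrable lborel f" and "c > 0"
  shows "integrable lborel (\<lambda>x. f (c *\<^sub>R x))"
proof -
  have [measurable]: "f \<in> borel_measurable borel" using assms by auto
  have "integrable (density (distr lborel borel (\<lambda>x. 0 + c *\<^sub>R x)) (\<lambda>_. \<bar>c\<bar>^DIM('a))) f"
    using assms lborel_affine[of c "0::'a"] by simp
  then have "integrable lborel (\<lambda>x. c ^ DIM('a) *\<^sub>R f (c *\<^sub>R x))" using assms(2)
    by (auto simp: integrable_density integrable_distr_eq)
  from integrable_scaleR_right[OF this, of "inverse (c ^ DIM('a))"] show ?thesis
    using assms(2) by simp
qed

section \<open>Autocorrelation and Gaussian summation\<close>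

definition fourier :: "('a::euclidean_space \<Rightarrow> complex) \<Rightarrow> 'a \<Rightarrow> complex" where
  "fourier u \<xi> = (LINT t|lborel. u t * cis (- (2 * pi * (\<xi> \<bullet> t))))"

text \<open>Its Fourier transform is the power spectrum of \<open>u\<close>, and its value at 0 is
  the squared norm; Plancherel's identity is Fourier inversion for it at the single point 0.\<close>

definition autocorrelation :: "('a::euclidean_space \<Rightarrow> complex) \<Rightarrow> 'a \<Rightarrow> complex" where
  "autocorrelation u x = (LINT t|lborel. u t * cnj (u (t - x)))"

lemma borel_measurable_fourier[measurable]:
  assumes [measurable]: "u \<in> borel_measurable borel"
  shows "fourier u \<in> borel_measurable borel"
  unfolding fourier_def by measurable

text \<open>The squared modulus is a double integral over t and s, in which s = t - x is
  substituted. Integrability of \<open>u\<close> makes the double integral absolutely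
  convergent.\<close>

lemma fourier_autocorrelation:
  fixes u :: "'a::euclidean_space \<Rightarrow> complex"
  assumes u: "integrable lborel u"
  shows "integrable lborel (autocorrelation u)"
    and "complex_of_real ((cmod (fourier u \<xi>))\<^sup>2) = fourier (autocorrelation u) \<xi>"
proof -
  have [measurable]: "u \<in> borel_measurable borel" using u by auto
  define e where "e = (\<lambda>x. cis (- (2 * pi * (\<xi> \<bullet> x))))"
  have [measurable]: "e \<in> borel_measurable borel" unfolding e_def by measurable
  have ne: "norm (e x) = 1" for x by (simp add: e_def)
  have i: "integrable (lborel \<Otimes>\<^sub>M lborel) (\<lambda>(x, t). u t * cnj (u (t - x)))"
  proof (rule integrableI_bounded)
    have "(\<integral>\<^sup>+z. ennreal (norm (case z of (x, t) \<Rightarrow> u t * cnj (u (t - x)))) \<partial>(lborel \<Otimes>\<^sub>M lborel))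
        = (\<integral>\<^sup>+t. \<integral>\<^sup>+x. ennreal (norm (u t * cnj (u (t - x)))) \<partial>lborel \<partial>lborel)"
      by (subst lborel_pair.nn_integral_snd[symmetric]) auto
    also have "\<dots> = (\<integral>\<^sup>+t. ennreal (norm (u t)) * (\<integral>\<^sup>+x. ennreal (norm (u (t - x))) \<partial>lborel) \<partial>lborel)"
      by (subst nn_integral_cmult[symmetric]) (auto simp: norm_mult ennreal_mult)
    also have "\<dots> = (\<integral>\<^sup>+t. ennreal (norm (u t)) * (\<integral>\<^sup>+x. ennreal (norm (u x)) \<partial>lborel) \<partial>lborel)"
      using nn_integral_lborel_reflect[of "\<lambda>x. ennreal (norm (u x))"] by simp
    also have "\<dots> = (\<integral>\<^sup>+t. ennreal (norm (u t)) \<partial>lborel) * (\<integral>\<^sup>+x. ennreal (norm (u x)) \<partial>lborel)"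
      by (rule nn_integral_multc) auto
    also have "\<dots> < \<infinity>"
      using u unfolding integrable_iff_bounded by (simp add: ennreal_mult_less_top)
    finally show "(\<integral>\<^sup>+z. ennreal (norm (case z of (x, t) \<Rightarrow> u t * cnj (u (t - x)))) \<partial>(lborel \<Otimes>\<^sub>M lborel)) < \<infinity>" .
  qed measurable
  have i2: "integrable (lborel \<Otimes>\<^sub>M lborel) (\<lambda>(x, t). u t * cnj (u (t - x)) * e x)"
    by (rule Bochner_Integration.integrable_bound[OF i]) (auto simp: norm_mult ne)
  show "integrable lborel (autocorrelation u)"
    unfolding autocorrelation_def using lborel_pair.integrable_fst'[OF i] by simp
  have em: "e t * cnj (e s) = e (t - s)" for t s
    by (simp add: e_def cis_mult cis_cnj inner_diff_right algebra_simps)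
  have "complex_of_real ((cmod (fourier u \<xi>))\<^sup>2) = (LINT t|lborel. u t * e t) * cnj (LINT s|lborel. u s * e s)"
    by (simp add: fourier_def e_def complex_norm_square del: of_real_power)
  also have "\<dots> = (LINT t|lborel. u t * e t * (LINT s|lborel. cnj (u s * e s)))"
    by (simp only: Bochner_Integration.integral_cnj[symmetric] integral_mult_left_zero)
  also have "\<dots> = (LINT t|lborel. LINT x|lborel. u t * cnj (u (t - x)) * e x)"
  proof (rule Bochner_Integration.integral_cong[OF refl])
    fix t
    have "(LINT s|lborel. cnj (u s * e s)) = (LINT x|lborel. cnj (u (t - x) * e (t - x)))"
      using integral_lborel_reflect[of "\<lambda>s. cnj (u s * e s)" t] by simp
    then have "u t * e t * (LINT s|lborel. cnj (u s * e s)) = (LINT x|lborel. u t * e t * cnj (u (t - x) * e (t - x)))"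
      by (simp only: integral_mult_right_zero)
    also have "\<dots> = (LINT x|lborel. u t * cnj (u (t - x)) * e x)"
      using em by (intro Bochner_Integration.integral_cong) (auto simp: mult_ac)
    finally show "u t * e t * (LINT s|lborel. cnj (u s * e s)) = (LINT x|lborel. u t * cnj (u (t - x)) * e x)" .
  qed
  also have "\<dots> = (LINT x|lborel. LINT t|lborel. u t * cnj (u (t - x)) * e x)"
    using lborel_pair.Fubini_integral[OF i2] by simp
  also have "\<dots> = fourier (autocorrelation u) \<xi>"
    by (simp add: fourier_def autocorrelation_def e_def)
  finally show "complex_of_real ((cmod (fourier u \<xi>))\<^sup>2) = fourier (autocorrelation u) \<xi>" .
qed

text \<open>The integrable Gaussian weight permits integrating over the frequency first. Rescaling
  to v then puts all of \<open>r\<close> into the argument of the autocorrelation, so that the limit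
  for small \<open>r\<close> can be taken under a fixed Gaussian.\<close>

lemma gaussian_weighted_fourier:
  fixes u :: "'a::euclidean_space \<Rightarrow> complex"
  assumes u: "integrable lborel u" and r: "r > 0"
  shows "integrable lborel (\<lambda>\<xi>. exp (- (norm (r *\<^sub>R \<xi>))\<^sup>2 / 2) * (cmod (fourier u \<xi>))\<^sup>2)"
    and "complex_of_real (LINT \<xi>|lborel. exp (- (norm (r *\<^sub>R \<xi>))\<^sup>2 / 2) * (cmod (fourier u \<xi>))\<^sup>2)
      = complex_of_real (sqrt (2 * pi) ^ DIM('a) / (2 * pi) ^ DIM('a)) *
        (LINT v|lborel. exp (- (norm v)\<^sup>2 / 2) *\<^sub>R autocorrelation u ((r / (2 * pi)) *\<^sub>R v))"
proof -
  define c where "c = autocorrelation u"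
  have c: "integrable lborel c" unfolding c_def by (rule fourier_autocorrelation[OF u])
  have [measurable]: "c \<in> borel_measurable borel" "u \<in> borel_measurable borel" using c u by auto
  define G where "G = (\<lambda>\<xi>::'a. exp (- (norm (r *\<^sub>R \<xi>))\<^sup>2 / 2))"
  have G: "integrable lborel G" unfolding G_def
    using integrable_lborel_scale[OF gaussian_fourier(1) r] .
  have [measurable]: "G \<in> borel_measurable borel" using G by auto
  have G0: "G x \<ge> 0" for x by (simp add: G_def)
  have GF: "(LINT \<xi>|lborel. G \<xi> *\<^sub>R cis (- (2 * pi * (\<xi> \<bullet> x))))
      = complex_of_real (sqrt (2 * pi) ^ DIM('a) * exp (- (norm ((2 * pi / r) *\<^sub>R x))\<^sup>2 / 2) / r ^ DIM('a))" for x
  proof -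
    have "(LINT \<xi>|lborel. G \<xi> *\<^sub>R cis (- (2 * pi * (\<xi> \<bullet> x))))
       = (1 / r) ^ DIM('a) *\<^sub>R (LINT y|lborel. G ((1/r) *\<^sub>R y) *\<^sub>R cis (- (2 * pi * (((1/r) *\<^sub>R y) \<bullet> x))))"
      by (rule integral_lborel_scale) (use r in auto)
    also have "(\<lambda>y. G ((1/r) *\<^sub>R y) *\<^sub>R cis (- (2 * pi * (((1/r) *\<^sub>R y) \<bullet> x))))
        = (\<lambda>y. exp (- (norm y)\<^sup>2 / 2) *\<^sub>R cis ((- (2 * pi / r) *\<^sub>R x) \<bullet> y))"
      using r by (auto simp: G_def inner_commute)
    also have "(LINT y|lborel. exp (- (norm y)\<^sup>2 / 2) *\<^sub>R cis ((- (2 * pi / r) *\<^sub>R x) \<bullet> y))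
        = complex_of_real (sqrt (2 * pi) ^ DIM('a) * exp (- (norm (- (2 * pi / r) *\<^sub>R x))\<^sup>2 / 2))"
      by (rule gaussian_fourier)
    finally show ?thesis by (simp add: power_divide scaleR_conv_of_real)
  qed
  have i: "integrable (lborel \<Otimes>\<^sub>M lborel) (\<lambda>(\<xi>, x). complex_of_real (G \<xi>) * (c x * cis (- (2 * pi * (\<xi> \<bullet> x)))))"
  proof (rule integrableI_bounded)
    have "(\<integral>\<^sup>+z. ennreal (norm (case z of (\<xi>, x) \<Rightarrow> complex_of_real (G \<xi>) * (c x * cis (- (2 * pi * (\<xi> \<bullet> x)))))) \<partial>(lborel \<Otimes>\<^sub>M lborel))
        = (\<integral>\<^sup>+\<xi>. \<integral>\<^sup>+x. ennreal (norm (complex_of_real (G \<xi>) * (c x * cis (- (2 * pi * (\<xi> \<bullet> x)))))) \<partial>lborel \<partial>lborel)"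
      by (subst lborel.nn_integral_fst[symmetric]) auto
    also have "\<dots> = (\<integral>\<^sup>+\<xi>. ennreal (G \<xi>) * (\<integral>\<^sup>+x. ennreal (norm (c x)) \<partial>lborel) \<partial>lborel)"
      by (subst nn_integral_cmult[symmetric]) (auto simp: norm_mult ennreal_mult G0)
    also have "\<dots> = (\<integral>\<^sup>+\<xi>. ennreal (norm (G \<xi>)) \<partial>lborel) * (\<integral>\<^sup>+x. ennreal (norm (c x)) \<partial>lborel)"
      using G0 by (subst nn_integral_multc) auto
    also have "\<dots> < \<infinity>"
      using c G unfolding integrable_iff_bounded by (simp add: ennreal_mult_less_top)
    finally show "(\<integral>\<^sup>+z. ennreal (norm (case z of (\<xi>, x) \<Rightarrow> complex_of_real (G \<xi>) * (c x * cis (- (2 * pi * (\<xi> \<bullet> x)))))) \<partial>(lborel \<Otimes>\<^sub>M lborel)) < \<infinity>" .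
  qed measurable
  have eq: "complex_of_real (G \<xi> * (cmod (fourier u \<xi>))\<^sup>2)
     = (LINT x|lborel. complex_of_real (G \<xi>) * (c x * cis (- (2 * pi * (\<xi> \<bullet> x)))))" for \<xi>
    using fourier_autocorrelation(2)[OF u, of \<xi>] by (simp add: fourier_def c_def)
  have "integrable lborel (\<lambda>\<xi>. complex_of_real (G \<xi> * (cmod (fourier u \<xi>))\<^sup>2))"
    unfolding eq using lborel_pair.integrable_fst'[OF i] by simp
  then show "integrable lborel (\<lambda>\<xi>. exp (- (norm (r *\<^sub>R \<xi>))\<^sup>2 / 2) * (cmod (fourier u \<xi>))\<^sup>2)"
    unfolding G_def complex_of_real_integrable_eq .
  have "complex_of_real (LINT \<xi>|lborel. G \<xi> * (cmod (fourier u \<xi>))\<^sup>2)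
      = (LINT \<xi>|lborel. complex_of_real (G \<xi> * (cmod (fourier u \<xi>))\<^sup>2))"
    by (rule integral_complex_of_real[symmetric])
  also have "\<dots> = (LINT x|lborel. LINT \<xi>|lborel. complex_of_real (G \<xi>) * (c x * cis (- (2 * pi * (\<xi> \<bullet> x)))))"
    unfolding eq using lborel_pair.Fubini_integral[OF i] by simp
  also have "\<dots> = (LINT x|lborel. c x * (LINT \<xi>|lborel. G \<xi> *\<^sub>R cis (- (2 * pi * (\<xi> \<bullet> x)))))"
    by (simp only: integral_mult_right_zero[symmetric] scaleR_conv_of_real mult_ac)
  also have "\<dots> = (LINT x|lborel. c x * complex_of_real (sqrt (2 * pi) ^ DIM('a) * exp (- (norm ((2 * pi / r) *\<^sub>R x))\<^sup>2 / 2) / r ^ DIM('a)))"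
    unfolding GF ..
  \<comment> \<open>The substitution x = r v / (2 pi) undoes the scaling of the Gaussian's
    transform; its Jacobian cancels the power of \<open>r\<close> and leaves that of 2 pi.\<close>
  also have "\<dots> = (r / (2 * pi)) ^ DIM('a) *\<^sub>R (LINT v|lborel. c ((r / (2 * pi)) *\<^sub>R v) *
      complex_of_real (sqrt (2 * pi) ^ DIM('a) * exp (- (norm ((2 * pi / r) *\<^sub>R ((r / (2 * pi)) *\<^sub>R v)))\<^sup>2 / 2) / r ^ DIM('a)))"
    by (rule integral_lborel_scale) (use r in auto)
  also have "\<dots> = (r / (2 * pi)) ^ DIM('a) *\<^sub>R (LINT v|lborel. complex_of_real (sqrt (2 * pi) ^ DIM('a) / r ^ DIM('a)) *
       (exp (- (norm v)\<^sup>2 / 2) *\<^sub>R c ((r / (2 * pi)) *\<^sub>R v)))"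
    using r by (intro arg_cong2[where f=scaleR] Bochner_Integration.integral_cong) (auto simp: scaleR_conv_of_real)
  also have "\<dots> = complex_of_real (sqrt (2 * pi) ^ DIM('a) / (2 * pi) ^ DIM('a)) *
        (LINT v|lborel. exp (- (norm v)\<^sup>2 / 2) *\<^sub>R c ((r / (2 * pi)) *\<^sub>R v))"
    unfolding integral_mult_right_zero using r by (simp add: scaleR_conv_of_real power_divide)
  finally show "complex_of_real (LINT \<xi>|lborel. exp (- (norm (r *\<^sub>R \<xi>))\<^sup>2 / 2) * (cmod (fourier u \<xi>))\<^sup>2)
      = complex_of_real (sqrt (2 * pi) ^ DIM('a) / (2 * pi) ^ DIM('a)) *
        (LINT v|lborel. exp (- (norm v)\<^sup>2 / 2) *\<^sub>R autocorrelation u ((r / (2 * pi)) *\<^sub>R v))"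
    by (simp add: G_def c_def)
qed

lemma norm2_shift:
  assumes "f \<in> L2_space"
  shows "norm2 (\<lambda>t. f (t - x)) = norm2 f"
  unfolding norm2_def using integral_lborel_shift[of "\<lambda>t. (cmod (f t))\<^sup>2" x] assms L2_spaceD by fastforce

lemma L2_shift:
  assumes "f \<in> L2_space"
  shows "(\<lambda>t. f (t - x)) \<in> L2_space"
proof (rule L2_spaceI)
  have [measurable]: "f \<in> borel_measurable borel" using assms by (rule L2_spaceD)
  show "(\<lambda>t. f (t - x)) \<in> borel_measurable borel" by measurable
  show "integrable lborel (\<lambda>t. (cmod (f (t - x)))\<^sup>2)"
    using integrable_lborel_shift[OF L2_spaceD(2)[OF assms]] .
qed

text \<open>Let r tend to 0 in \<open>gaussian_weighted_fourier\<close>. The left side increases to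
  the full integral, while the right side tends to the autocorrelation at 0, because translation is
  continuous in L^2. Nonnegative integrals are used since square-integrability of the transform is
  part of the claim.\<close>

lemma Plancherel_L1_L2:
  fixes u :: "'a::euclidean_space \<Rightarrow> complex"
  assumes u1: "integrable lborel u" and u2: "integrable lborel (\<lambda>t. (cmod (u t))\<^sup>2)"
  shows "(\<integral>\<^sup>+\<xi>. ennreal ((cmod (fourier u \<xi>))\<^sup>2) \<partial>lborel) = (\<integral>\<^sup>+t. ennreal ((cmod (u t))\<^sup>2) \<partial>lborel)"
proof -
  have [measurable]: "u \<in> borel_measurable borel" using u1 by auto
  have L: "u \<in> L2_space" using u2 by (intro L2_spaceI) auto
  \<comment> \<open>Decreasing \<open>r\<close> makes the Gaussian weights increase, as monotone
    convergence requires.\<close>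
  define r where "r = (\<lambda>n. 1 / real (Suc n))"
  have r: "r n > 0" for n by (simp add: r_def)
  have r0: "r \<longlonglongrightarrow> 0" unfolding r_def by (rule LIMSEQ_Suc[OF lim_1_over_n])
  define c where "c = autocorrelation u"
  have [measurable]: "c \<in> borel_measurable borel"
    using fourier_autocorrelation(1)[OF u1] unfolding c_def by auto
  have c_inner: "c x = L2_inner u (\<lambda>t. u (t - x))" for x
    by (simp add: c_def autocorrelation_def L2_inner_def)
  have cb: "cmod (c x) \<le> (norm2 u)\<^sup>2" for x
    unfolding c_inner using L2_inner_Cauchy_Schwarz[OF L L2_shift[OF L]]
    by (simp add: norm2_shift[OF L] power2_eq_square)
  have c_lim: "(\<lambda>n. c (h n)) \<longlonglongrightarrow> c 0" if h: "h \<longlonglongrightarrow> 0" for h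
  proof -
    have "(\<lambda>n. norm2 u * norm2 (\<lambda>t. u (t - h n) - u t)) \<longlonglongrightarrow> norm2 u * 0"
      by (intro tendsto_intros translation_continuous_L2[OF L h])
    then have lim0: "(\<lambda>n. norm2 u * norm2 (\<lambda>t. u (t - h n) - u t)) \<longlonglongrightarrow> 0" by simp
    have "norm (c (h n) - c 0) \<le> norm2 u * norm2 (\<lambda>t. u (t - h n) - u t)" for n
      unfolding c_inner using L2_inner_Cauchy_Schwarz[OF L L2_diff[OF L2_shift[OF L] L], of "h n"]
      by (simp add: L2_inner_diff_right L2_shift L)
    then have "(\<lambda>n. c (h n) - c 0) \<longlonglongrightarrow> 0"
      by (intro Lim_null_comparison[OF always_eventually lim0] allI)
    then show ?thesis by (simp add: LIM_zero_iff)
  qed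
  define C where "C = sqrt (2 * pi) ^ DIM('a) / (2 * pi) ^ DIM('a)"
  define J where "J = (\<lambda>n. LINT \<xi>|lborel. exp (- (norm (r n *\<^sub>R \<xi>))\<^sup>2 / 2) * (cmod (fourier u \<xi>))\<^sup>2)"
  have "(\<lambda>n. LINT v|lborel. exp (- (norm v)\<^sup>2 / 2) *\<^sub>R c ((r n / (2 * pi)) *\<^sub>R v))
      \<longlonglongrightarrow> (LINT v|lborel. exp (- (norm (v::'a))\<^sup>2 / 2) *\<^sub>R c 0)"
  proof (rule integral_dominated_convergence[where w="\<lambda>v. exp (- (norm v)\<^sup>2 / 2) * (norm2 u)\<^sup>2"])
    show "integrable lborel (\<lambda>v::'a. exp (- (norm v)\<^sup>2 / 2) * (norm2 u)\<^sup>2)"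
      using gaussian_fourier(1)[where 'a='a] by auto
    have "(\<lambda>n. exp (- (norm v)\<^sup>2 / 2) *\<^sub>R c ((r n / (2 * pi)) *\<^sub>R v)) \<longlonglongrightarrow> exp (- (norm v)\<^sup>2 / 2) *\<^sub>R c 0" for v
    proof (intro tendsto_intros c_lim)
      have "(\<lambda>n. (r n / (2 * pi)) *\<^sub>R v) \<longlonglongrightarrow> (0 / (2 * pi)) *\<^sub>R v"
        by (intro tendsto_intros r0) auto
      then show "(\<lambda>n. (r n / (2 * pi)) *\<^sub>R v) \<longlonglongrightarrow> 0" by simp
    qed
    then show "AE v in lborel. (\<lambda>n. exp (- (norm v)\<^sup>2 / 2) *\<^sub>R c ((r n / (2 * pi)) *\<^sub>R v)) \<longlonglongrightarrow> exp (- (norm v)\<^sup>2 / 2) *\<^sub>R c 0"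
      by simp
  qed (auto simp: cb)
  also have "(LINT v|lborel. exp (- (norm (v::'a))\<^sup>2 / 2) *\<^sub>R c 0) = (LINT v|lborel. exp (- (norm (v::'a))\<^sup>2 / 2)) *\<^sub>R c 0"
    by (rule integral_scaleR_left) (use gaussian_fourier(1)[where 'a='a] in auto)
  also have "(LINT v|lborel. exp (- (norm (v::'a))\<^sup>2 / 2)) = sqrt (2 * pi) ^ DIM('a)"
  proof -
    have "complex_of_real (LINT v|lborel. exp (- (norm (v::'a))\<^sup>2 / 2)) = (LINT v|lborel. complex_of_real (exp (- (norm (v::'a))\<^sup>2 / 2)))"
      by (rule integral_complex_of_real[symmetric])
    also have "\<dots> = complex_of_real (sqrt (2 * pi) ^ DIM('a))"
      using gaussian_fourier(2)[of "0::'a"] by (simp add: scaleR_conv_of_real)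
    finally show ?thesis by (simp only: of_real_eq_iff)
  qed
  finally have "(\<lambda>n. complex_of_real C * (LINT v|lborel. exp (- (norm v)\<^sup>2 / 2) *\<^sub>R c ((r n / (2 * pi)) *\<^sub>R v)))
     \<longlonglongrightarrow> complex_of_real C * (sqrt (2 * pi) ^ DIM('a) *\<^sub>R c 0)"
    by (intro tendsto_intros)
  \<comment> \<open>The Gaussian's integral and the constant \<open>C\<close> cancel, since the
    square of \<open>sqrt (2 * pi)\<close> is \<open>2 * pi\<close>.\<close>
  moreover have "complex_of_real C * (sqrt (2 * pi) ^ DIM('a) *\<^sub>R c 0) = c 0"
  proof -
    define q where "q = sqrt (2 * pi)"
    have "q * q = 2 * pi" by (simp add: q_def)
    then have "q ^ DIM('a) * q ^ DIM('a) = (2 * pi) ^ DIM('a)"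
      by (simp only: power_mult_distrib[symmetric])
    then have "C * q ^ DIM('a) = 1"
      unfolding C_def q_def[symmetric] by simp
    moreover have "complex_of_real C * (q ^ DIM('a) *\<^sub>R c 0) = (C * q ^ DIM('a)) *\<^sub>R c 0"
      by (simp only: scaleR_conv_of_real of_real_mult mult.assoc)
    ultimately show ?thesis unfolding q_def by simp
  qed
  moreover have "c 0 = complex_of_real ((norm2 u)\<^sup>2)"
    by (simp add: c_inner L2_inner_self)
  ultimately have "(\<lambda>n. complex_of_real (J n)) \<longlonglongrightarrow> complex_of_real ((norm2 u)\<^sup>2)"
    unfolding J_def gaussian_weighted_fourier(2)[OF u1 r] C_def c_def by simp
  then have J: "J \<longlonglongrightarrow> (norm2 u)\<^sup>2"
    by (subst (asm) tendsto_of_real_iff)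
  have Jn: "(\<integral>\<^sup>+\<xi>. ennreal (exp (- (norm (r n *\<^sub>R \<xi>))\<^sup>2 / 2) * (cmod (fourier u \<xi>))\<^sup>2) \<partial>lborel) = ennreal (J n)" for n
    unfolding J_def by (rule nn_integral_eq_integral[OF gaussian_weighted_fourier(1)[OF u1 r]]) auto
  have "(\<lambda>n. \<integral>\<^sup>+\<xi>. ennreal (exp (- (norm (r n *\<^sub>R \<xi>))\<^sup>2 / 2) * (cmod (fourier u \<xi>))\<^sup>2) \<partial>lborel)
     \<longlonglongrightarrow> (\<integral>\<^sup>+\<xi>. ennreal ((cmod (fourier u \<xi>))\<^sup>2) \<partial>lborel)"
  proof (rule nn_integral_LIMSEQ)
    have "exp (- (norm (r m *\<^sub>R \<xi>))\<^sup>2 / 2) \<le> exp (- (norm (r n *\<^sub>R \<xi>))\<^sup>2 / 2)" if "m \<le> n" for m n and \<xi> :: 'a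
    proof -
      have "r n \<le> r m" using that by (simp add: r_def frac_le)
      then have "norm (r n *\<^sub>R \<xi>) \<le> norm (r m *\<^sub>R \<xi>)"
        using r[of n] by (simp add: mult_right_mono)
      then show ?thesis by (simp add: power_mono)
    qed
    then show "incseq (\<lambda>n \<xi>. ennreal (exp (- (norm (r n *\<^sub>R \<xi>))\<^sup>2 / 2) * (cmod (fourier u \<xi>))\<^sup>2))"
      by (intro monoI le_funI ennreal_leI mult_right_mono) auto
    show "(\<lambda>n. ennreal (exp (- (norm (r n *\<^sub>R \<xi>))\<^sup>2 / 2) * (cmod (fourier u \<xi>))\<^sup>2)) \<longlonglongrightarrow> ennreal ((cmod (fourier u \<xi>))\<^sup>2)" for \<xi>
    proof -
      have "(\<lambda>n. exp (- (norm (r n *\<^sub>R \<xi>))\<^sup>2 / 2) * (cmod (fourier u \<xi>))\<^sup>2) \<longlonglongrightarrow> exp (- (norm (0 *\<^sub>R \<xi>))\<^sup>2 / 2) * (cmod (fourier u \<xi>))\<^sup>2"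
        by (intro tendsto_intros r0) auto
      then show ?thesis by simp
    qed
  qed auto
  moreover have "(\<lambda>n. ennreal (J n)) \<longlonglongrightarrow> ennreal ((norm2 u)\<^sup>2)"
    using J by simp
  ultimately have "(\<integral>\<^sup>+\<xi>. ennreal ((cmod (fourier u \<xi>))\<^sup>2) \<partial>lborel) = ennreal ((norm2 u)\<^sup>2)"
    unfolding Jn by (rule LIMSEQ_unique)
  then show ?thesis using nn_integral_eq_integral[OF u2] by (simp add: norm2_sq)
qed

section \<open>The short-time Fourier transform\<close>

text \<open>This is pi(z)g. It turns the transform into an inner product
  (\<open>stft_eq_inner\<close>) with vectors of constant norm.\<close>

definition tf_shift :: "('a::euclidean_space \<Rightarrow> complex) \<Rightarrow> 'a \<times> 'a \<Rightarrow> 'a \<Rightarrow> complex" where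
  "tf_shift g z t = g (t - fst z) * cis (2 * pi * (snd z \<bullet> t))"

lemma cmod_tf_shift: "cmod (tf_shift g z t) = cmod (g (t - fst z))"
  by (simp add: tf_shift_def norm_mult)

lemma stft_eq_inner: "stft g f z = L2_inner f (tf_shift g z)"
  by (cases z) (simp add: stft_def L2_inner_def tf_shift_def cis_cnj mult.assoc)

lemma stft_eq_fourier: "stft g f (x, \<xi>) = fourier (\<lambda>t. f t * cnj (g (t - x))) \<xi>"
  by (simp add: stft_def fourier_def)

lemma measurable_fst_borel[measurable]: "fst \<in> borel_measurable (borel :: ('a::euclidean_space \<times> 'b::euclidean_space) measure)"
  by (intro borel_measurable_continuous_onI continuous_intros)

lemma measurable_snd_borel[measurable]: "snd \<in> borel_measurable (borel :: ('a::euclidean_space \<times> 'b::euclidean_space) measure)"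
  by (intro borel_measurable_continuous_onI continuous_intros)

lemma borel_measurable_tf_shift[measurable]:
  assumes [measurable]: "g \<in> borel_measurable borel" "a \<in> borel_measurable M" "b \<in> borel_measurable M"
  shows "(\<lambda>x. tf_shift g (a x) (b x)) \<in> borel_measurable M"
  unfolding tf_shift_def by measurable

lemma borel_measurable_stft[measurable]:
  assumes [measurable]: "g \<in> borel_measurable borel" "f \<in> borel_measurable borel"
  shows "stft g f \<in> borel_measurable borel"
proof -
  have "stft g f = (\<lambda>z. LINT t|lborel. f t * cnj (tf_shift g z t))"
    by (auto simp: stft_eq_inner L2_inner_def)
  then show ?thesis by simp
qed

lemma L2_tf_shift:
  assumes "g \<in> L2_space"
  shows "tf_shift g z \<in> L2_space"
proof (rule L2_spaceI)
  have [measurable]: "g \<in> borel_measurable borel" using assms by (rule L2_spaceD)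
  show "tf_shift g z \<in> borel_measurable borel"
    using borel_measurable_tf_shift[of g "\<lambda>_. z" borel "\<lambda>t. t"] by simp
  show "integrable lborel (\<lambda>t. (cmod (tf_shift g z t))\<^sup>2)"
    using L2_spaceD(2)[OF L2_shift[OF assms]] by (simp add: cmod_tf_shift)
qed

lemma norm2_tf_shift:
  assumes "g \<in> L2_space"
  shows "norm2 (tf_shift g z) = norm2 g"
  using norm2_shift[OF assms, of "fst z"] by (simp add: norm2_def cmod_tf_shift)

lemma cmod_stft_le:
  assumes "g \<in> L2_space" "f \<in> L2_space"
  shows "cmod (stft g f z) \<le> norm2 f * norm2 g"
  using L2_inner_Cauchy_Schwarz[OF assms(2) L2_tf_shift[OF assms(1)]]
  by (simp add: stft_eq_inner norm2_tf_shift[OF assms(1)])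

text \<open>The modulus of continuity of the transform depends on \<open>f\<close> only through its
  norm; this is what makes bounded families equicontinuous.\<close>

lemma cmod_stft_diff_le:
  assumes "g \<in> L2_space" "f \<in> L2_space"
  shows "cmod (stft g f z - stft g f w) \<le> norm2 f * norm2 (\<lambda>t. tf_shift g z t - tf_shift g w t)"
proof -
  have "stft g f z - stft g f w = L2_inner f (\<lambda>t. tf_shift g z t - tf_shift g w t)"
    using L2_inner_diff_right[OF L2_tf_shift L2_tf_shift, of g g f z w] assms by (simp add: stft_eq_inner)
  then show ?thesis
    using L2_inner_Cauchy_Schwarz[OF assms(2) L2_diff[OF L2_tf_shift L2_tf_shift]] assms by simp
qed

text \<open>The difference of two shifts is split: \<open>A\<close> changes only the translation and
  is handled by \<open>translation_continuous_L2\<close>, \<open>B\<close> changes only the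
  modulation and is handled by dominated convergence.\<close>

lemma tf_shift_continuous:
  fixes g :: "'a::euclidean_space \<Rightarrow> complex"
  assumes g: "g \<in> L2_space"
  shows "isCont (\<lambda>w. norm2 (\<lambda>t. tf_shift g w t - tf_shift g z t)) z"
  unfolding continuous_at_sequentially
proof (intro allI impI)
  fix w :: "nat \<Rightarrow> 'a \<times> 'a" assume w: "w \<longlonglongrightarrow> z"
  have [measurable]: "g \<in> borel_measurable borel" using g by (rule L2_spaceD)
  define e where "e = (\<lambda>n t. cis (2 * pi * (snd (w n) \<bullet> t)))"
  define e0 where "e0 = (\<lambda>t. cis (2 * pi * (snd z \<bullet> t)))"
  have [measurable]: "e n \<in> borel_measurable borel" "e0 \<in> borel_measurable borel" for n
    unfolding e_def e0_def by measurable
  have ne: "cmod (e n t) = 1" "cmod (e0 t) = 1" for n t by (auto simp: e_def e0_def)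
  define A where "A = (\<lambda>n t. (g (t - fst (w n)) - g (t - fst z)) * e n t)"
  define B where "B = (\<lambda>n t. g (t - fst z) * (e n t - e0 t))"
  have g2: "integrable lborel (\<lambda>t. (cmod (g (t - x)))\<^sup>2)" for x
    using L2_spaceD(2)[OF L2_shift[OF g]] .
  have A2: "A n \<in> L2_space" for n
  proof (rule L2_spaceI)
    show "integrable lborel (\<lambda>t. (cmod (A n t))\<^sup>2)"
      using L2_spaceD(2)[OF L2_diff[OF L2_shift[OF g] L2_shift[OF g]]] by (simp add: A_def norm_mult ne)
  qed (simp add: A_def)
  \<comment> \<open>The 4 is the square of 2, the bound for the difference of two unimodular
    numbers; this gives the dominating function.\<close>
  have Bb: "(cmod (B n t))\<^sup>2 \<le> 4 * (cmod (g (t - fst z)))\<^sup>2" for n t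
  proof -
    have "cmod (e n t - e0 t) \<le> 2" using norm_triangle_ineq4[of "e n t" "e0 t"] ne by simp
    then have "cmod (B n t) \<le> cmod (g (t - fst z)) * 2"
      by (simp add: B_def norm_mult mult_left_mono)
    then have "(cmod (B n t))\<^sup>2 \<le> (cmod (g (t - fst z)) * 2)\<^sup>2" by (rule power_mono) simp
    then show ?thesis by (simp add: power_mult_distrib mult.commute)
  qed
  have B2: "B n \<in> L2_space" for n
  proof (rule L2_spaceI)
    have "integrable lborel (\<lambda>t. 4 * (cmod (g (t - fst z)))\<^sup>2)" using g2 by simp
    then show "integrable lborel (\<lambda>t. (cmod (B n t))\<^sup>2)"
      by (rule Bochner_Integration.integrable_bound) (auto simp: Bb B_def[symmetric], simp add: B_def)
  qed (simp add: B_def)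
  have le: "norm2 (\<lambda>t. tf_shift g (w n) t - tf_shift g z t) \<le> norm2 (A n) + norm2 (B n)" for n
  proof -
    have "(\<lambda>t. tf_shift g (w n) t - tf_shift g z t) = (\<lambda>t. A n t + B n t)"
      by (auto simp: tf_shift_def A_def B_def e_def e0_def algebra_simps)
    then show ?thesis using norm2_triangle[OF A2 B2] by simp
  qed
  have Alim: "(\<lambda>n. norm2 (A n)) \<longlonglongrightarrow> 0"
  proof -
    have h: "(\<lambda>n. fst (w n) - fst z) \<longlonglongrightarrow> 0"
      using tendsto_fst[OF w] by (simp add: LIM_zero_iff)
    have "norm2 (A n) = norm2 (\<lambda>t. g (t - (fst (w n) - fst z)) - g t)" for n
    proof -
      have "norm2 (A n) = norm2 (\<lambda>t. g ((t - fst z) - (fst (w n) - fst z)) - g (t - fst z))"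
        by (simp add: norm2_def A_def norm_mult ne)
      also have "\<dots> = norm2 (\<lambda>t. g (t - (fst (w n) - fst z)) - g t)"
        by (rule norm2_shift[OF L2_diff[OF L2_shift[OF g] g]])
      finally show ?thesis .
    qed
    then show ?thesis using translation_continuous_L2[OF g h] by simp
  qed
  have "(\<lambda>n. LINT t|lborel. (cmod (B n t))\<^sup>2) \<longlonglongrightarrow> integral\<^sup>L (lborel :: 'a measure) (\<lambda>t. 0 :: real)"
  proof (rule integral_dominated_convergence[where w="\<lambda>t. 4 * (cmod (g (t - fst z)))\<^sup>2"])
    have "(\<lambda>n. (cmod (B n t))\<^sup>2) \<longlonglongrightarrow> (cmod (g (t - fst z) * (e0 t - e0 t)))\<^sup>2" for t
    proof -
      have "(\<lambda>n. e n t) \<longlonglongrightarrow> e0 t"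
        unfolding e_def e0_def cis_conv_exp by (intro tendsto_intros w)
      then show ?thesis unfolding B_def by (intro tendsto_intros)
    qed
    then show "AE t in lborel. (\<lambda>n. (cmod (B n t))\<^sup>2) \<longlonglongrightarrow> 0" by simp
    show "(\<lambda>t. (cmod (B n t))\<^sup>2) \<in> borel_measurable lborel" for n by (simp add: B_def)
  qed (use g2 Bb in auto)
  then have Blim: "(\<lambda>n. norm2 (B n)) \<longlonglongrightarrow> 0"
    unfolding norm2_def using tendsto_real_sqrt by fastforce
  have lim: "(\<lambda>n. norm2 (A n) + norm2 (B n)) \<longlonglongrightarrow> 0"
    using tendsto_add[OF Alim Blim] by simp
  have "(\<lambda>n. norm2 (\<lambda>t. tf_shift g (w n) t - tf_shift g z t)) \<longlonglongrightarrow> 0"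
    by (rule tendsto_sandwich[OF _ _ tendsto_const lim]) (auto simp: norm2_nonneg le)
  then show "((\<lambda>w. norm2 (\<lambda>t. tf_shift g w t - tf_shift g z t)) \<circ> w) \<longlonglongrightarrow> norm2 (\<lambda>t. tf_shift g z t - tf_shift g z t)"
    by (simp add: o_def norm2_def)
qed

lemma tf_shift_equicontinuous:
  assumes "g \<in> L2_space" "e > 0"
  shows "\<exists>d>0. \<forall>w. norm (z - w) < d \<longrightarrow> norm2 (\<lambda>t. tf_shift g z t - tf_shift g w t) < e"
proof -
  have sym: "norm2 (\<lambda>t. tf_shift g w t - tf_shift g z t) = norm2 (\<lambda>t. tf_shift g z t - tf_shift g w t)" for w
    by (simp add: norm2_def norm_minus_commute)
  have z0: "norm2 (\<lambda>t. tf_shift g z t - tf_shift g z t) = 0" by (simp add: norm2_def)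
  obtain d where "d > 0" and d: "\<And>w. dist w z < d \<Longrightarrow> dist (norm2 (\<lambda>t. tf_shift g w t - tf_shift g z t)) (norm2 (\<lambda>t. tf_shift g z t - tf_shift g z t)) < e"
    using tf_shift_continuous[OF assms(1), of z] assms(2) unfolding continuous_at_eps_delta by blast
  have "norm2 (\<lambda>t. tf_shift g z t - tf_shift g w t) < e" if "norm (z - w) < d" for w
  proof -
    have "dist w z < d" using that by (simp only: dist_norm norm_minus_commute)
    from d[OF this] show ?thesis unfolding z0 sym dist_real_def by simp
  qed
  with \<open>d > 0\<close> show ?thesis by blast
qed

text \<open>For fixed x the transform is the Fourier transform of \<open>u x\<close>: Plancherel in
  the frequency variable is followed by Tonelli in t and x.\<close>

lemma Moyal:
  fixes f g :: "'a::euclidean_space \<Rightarrow> complex"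
  assumes f: "f \<in> L2_space" and g: "g \<in> L2_space"
  shows "(\<integral>\<^sup>+z. ennreal ((cmod (stft g f z))\<^sup>2) \<partial>lborel) = ennreal ((norm2 f)\<^sup>2 * (norm2 g)\<^sup>2)"
proof -
  have [measurable]: "f \<in> borel_measurable borel" "g \<in> borel_measurable borel"
    using f g L2_spaceD by auto
  define u where "u = (\<lambda>x t. f t * cnj (g (t - x)))"
  have [measurable]: "(\<lambda>(x, t). u x t) \<in> borel_measurable (borel \<Otimes>\<^sub>M borel)" unfolding u_def by measurable
  have fin: "(\<integral>\<^sup>+x. \<integral>\<^sup>+t. ennreal ((cmod (u x t))\<^sup>2) \<partial>lborel \<partial>lborel) = ennreal ((norm2 f)\<^sup>2 * (norm2 g)\<^sup>2)"
  proof -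
    have "(\<integral>\<^sup>+x. \<integral>\<^sup>+t. ennreal ((cmod (u x t))\<^sup>2) \<partial>lborel \<partial>lborel)
       = (\<integral>\<^sup>+t. \<integral>\<^sup>+x. ennreal ((cmod (u x t))\<^sup>2) \<partial>lborel \<partial>lborel)"
      by (rule lborel_pair.Fubini'[symmetric]) (simp add: u_def)
    also have "\<dots> = (\<integral>\<^sup>+t. ennreal ((cmod (f t))\<^sup>2) * (\<integral>\<^sup>+x. ennreal ((cmod (g (t - x)))\<^sup>2) \<partial>lborel) \<partial>lborel)"
      by (subst nn_integral_cmult[symmetric]) (auto simp: u_def norm_mult power_mult_distrib ennreal_mult)
    also have "\<dots> = (\<integral>\<^sup>+t. ennreal ((cmod (f t))\<^sup>2) * (\<integral>\<^sup>+x. ennreal ((cmod (g x))\<^sup>2) \<partial>lborel) \<partial>lborel)"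
      using nn_integral_lborel_reflect[of "\<lambda>x. ennreal ((cmod (g x))\<^sup>2)"] by simp
    also have "\<dots> = (\<integral>\<^sup>+t. ennreal ((cmod (f t))\<^sup>2) \<partial>lborel) * (\<integral>\<^sup>+x. ennreal ((cmod (g x))\<^sup>2) \<partial>lborel)"
      by (rule nn_integral_multc) auto
    also have "\<dots> = ennreal ((norm2 f)\<^sup>2 * (norm2 g)\<^sup>2)"
      using L2_spaceD(2)[OF f] L2_spaceD(2)[OF g]
      by (simp add: nn_integral_eq_integral norm2_sq ennreal_mult)
    finally show ?thesis .
  qed
  \<comment> \<open>Every slice \<open>u x\<close> is integrable, but square-integrability is known
    only for almost every x, and Plancherel is applied to those slices.\<close>
  have "AE x in lborel. (\<integral>\<^sup>+t. ennreal ((cmod (u x t))\<^sup>2) \<partial>lborel) \<noteq> \<infinity>"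
    by (rule nn_integral_noteq_infinite) (auto simp: fin)
  then have ae: "AE x in lborel. (\<integral>\<^sup>+\<xi>. ennreal ((cmod (stft g f (x, \<xi>)))\<^sup>2) \<partial>lborel) = (\<integral>\<^sup>+t. ennreal ((cmod (u x t))\<^sup>2) \<partial>lborel)"
  proof eventually_elim
    case (elim x)
    have [measurable]: "u x \<in> borel_measurable borel" unfolding u_def by measurable
    have "integrable lborel (u x)"
      unfolding u_def by (rule integrable_L2_inner[OF f L2_shift[OF g]])
    moreover have "integrable lborel (\<lambda>t. (cmod (u x t))\<^sup>2)"
      using elim by (intro integrableI_bounded) (auto simp: less_top)
    ultimately show ?case
      using Plancherel_L1_L2[of "u x"] by (simp add: stft_eq_fourier u_def)
  qed
  have "(\<integral>\<^sup>+z. ennreal ((cmod (stft g f z))\<^sup>2) \<partial>lborel)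
      = (\<integral>\<^sup>+x. \<integral>\<^sup>+\<xi>. ennreal ((cmod (stft g f (x, \<xi>)))\<^sup>2) \<partial>lborel \<partial>lborel)"
    by (subst lborel_prod[symmetric], subst lborel.nn_integral_fst[symmetric]) (auto simp: lborel_prod)
  also have "\<dots> = (\<integral>\<^sup>+x. \<integral>\<^sup>+t. ennreal ((cmod (u x t))\<^sup>2) \<partial>lborel \<partial>lborel)"
    by (rule nn_integral_cong_AE[OF ae])
  finally show ?thesis using fin by simp
qed

lemma stft_square_integrable:
  assumes f: "f \<in> L2_space" and g: "g \<in> L2_space"
  shows "integrable lborel (\<lambda>z. (cmod (stft g f z))\<^sup>2)"
    and "(LINT z|lborel. (cmod (stft g f z))\<^sup>2) = (norm2 f)\<^sup>2 * (norm2 g)\<^sup>2"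
proof -
  have [measurable]: "f \<in> borel_measurable borel" "g \<in> borel_measurable borel"
    using f g L2_spaceD by auto
  show "integrable lborel (\<lambda>z. (cmod (stft g f z))\<^sup>2)"
    using Moyal[OF f g] by (intro integrableI_bounded) auto
  then show "(LINT z|lborel. (cmod (stft g f z))\<^sup>2) = (norm2 f)\<^sup>2 * (norm2 g)\<^sup>2"
    using Moyal[OF f g] by (simp add: nn_integral_eq_integral)
qed

text \<open>Moving the translation from the function to the integration variable leaves only a
  phase, so shifts act on moduli of transforms by translating phase space.\<close>

lemma cmod_stft_tf_shift:
  fixes g :: "'a::euclidean_space \<Rightarrow> complex"
  assumes [measurable]: "g \<in> borel_measurable borel"
  shows "cmod (stft g (tf_shift g z) w) = cmod (stft g g (w - z))"
proof -
  \<comment> \<open>The phase left over when the exponent is recentred at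
    \<open>fst z\<close>.\<close>
  define c where "c = cis (- (2 * pi * ((snd w - snd z) \<bullet> fst z)))"
  define F where "F = (\<lambda>t. c * (g t * cnj (g (t - fst (w - z))) * cis (- (2 * pi * (snd (w - z) \<bullet> t)))))"
  have [measurable]: "F \<in> borel_measurable borel" unfolding F_def by measurable
  have "stft g (tf_shift g z) w = (LINT t|lborel. F (t - fst z))"
  proof -
    have "tf_shift g z t * cnj (g (t - fst w)) * cis (- (2 * pi * (snd w \<bullet> t))) = F (t - fst z)" for t
    proof -
      have "cis (2 * pi * (snd z \<bullet> t)) * cis (- (2 * pi * (snd w \<bullet> t)))
          = c * cis (- (2 * pi * (snd (w - z) \<bullet> (t - fst z))))"
        unfolding c_def cis_mult by (rule arg_cong[of _ _ cis]) (simp add: inner_diff_left inner_diff_right algebra_simps)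
      moreover have "t - fst z - fst (w - z) = t - fst w" by simp
      ultimately show ?thesis by (simp add: F_def tf_shift_def mult_ac)
    qed
    then show ?thesis by (cases w) (simp add: stft_def)
  qed
  also have "\<dots> = (LINT t|lborel. F t)" by (rule integral_lborel_shift) simp
  also have "\<dots> = c * stft g g (w - z)"
    unfolding F_def integral_mult_right_zero by (cases "w - z") (simp add: stft_def)
  finally show ?thesis by (simp add: norm_mult c_def)
qed

text \<open>Both sides are the modulus of the inner product of the shifts of \<open>g\<close> by z
  and by w.\<close>

lemma cmod_stft_self_minus:
  fixes g :: "'a::euclidean_space \<Rightarrow> complex"
  assumes "g \<in> borel_measurable borel"
  shows "cmod (stft g g (w - z)) = cmod (stft g g (z - w))"
proof -
  have "stft g (tf_shift g z) w = cnj (stft g (tf_shift g w) z)"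
    by (simp add: stft_eq_inner L2_inner_cnj)
  then show ?thesis
    using cmod_stft_tf_shift[OF assms, of z w] cmod_stft_tf_shift[OF assms, of w z] by simp
qed


section \<open>The localization operator\<close>

text \<open>The adjoint of the transform, applied to \<open>F\<close> cut off at \<Omega>.
  \<open>F\<close> is arbitrary because \<open>eigenfunction_exists\<close> synthesizes a uniform
  limit of transforms that is not yet known to be a transform.\<close>

definition synthesis :: "('a::euclidean_space \<Rightarrow> complex) \<Rightarrow> ('a \<times> 'a) set \<Rightarrow> ('a \<times> 'a \<Rightarrow> complex) \<Rightarrow> 'a \<Rightarrow> complex" where
  "synthesis g \<Omega> F t = (LINT z|lborel. indicator \<Omega> z * F z * tf_shift g z t)"

lemma loc_op_eq_synthesis: "loc_op g \<Omega> f = synthesis g \<Omega> (stft g f)"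
  by (rule ext) (auto simp: loc_op_def synthesis_def set_lebesgue_integral_def tf_shift_def
      indicator_def intro!: Bochner_Integration.integral_cong)

text \<open>Cauchy-Schwarz on the set \<Omega> of finite measure bounds the square at each t;
  Tonelli then uses that all translates of \<open>g\<close> have the same norm.\<close>

lemma synthesis_L2:
  fixes g :: "'a::euclidean_space \<Rightarrow> complex" and \<Omega> :: "('a \<times> 'a) set"
  assumes g: "g \<in> L2_space" and [measurable]: "\<Omega> \<in> sets borel" "F \<in> borel_measurable borel"
    and fin: "emeasure lborel \<Omega> < \<infinity>" and B: "\<And>z. z \<in> \<Omega> \<Longrightarrow> cmod (F z) \<le> B" and B0: "B \<ge> 0"
  shows "synthesis g \<Omega> F \<in> L2_space"
    and "norm2 (synthesis g \<Omega> F) \<le> B * measure lborel \<Omega> * norm2 g"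
proof -
  have [measurable]: "g \<in> borel_measurable borel" using g by (rule L2_spaceD)
  have [measurable]: "synthesis g \<Omega> F \<in> borel_measurable borel"
    unfolding synthesis_def by measurable
  have m: "emeasure lborel \<Omega> = ennreal (measure lborel \<Omega>)" using fin by (simp add: emeasure_eq_ennreal_measure less_top)
  \<comment> \<open>The indicator is written twice: in Cauchy-Schwarz one copy yields the factor
    |\<Omega>| and the other confines the second integral to \<Omega>.\<close>
  have 1: "ennreal (cmod (synthesis g \<Omega> F t)) \<le> (\<integral>\<^sup>+z. indicator \<Omega> z * (ennreal B * (indicator \<Omega> z * ennreal (cmod (g (t - fst z))))) \<partial>lborel)" for t
  proof (cases "integrable lborel (\<lambda>z. indicator \<Omega> z * F z * tf_shift g z t)")
    case True
    have "ennreal (cmod (synthesis g \<Omega> F t)) \<le> (\<integral>\<^sup>+z. ennreal (cmod (indicator \<Omega> z * F z * tf_shift g z t)) \<partial>lborel)"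
      unfolding synthesis_def using integral_norm_bound_ennreal[OF True] .
    also have "\<dots> \<le> (\<integral>\<^sup>+z. indicator \<Omega> z * (ennreal B * (indicator \<Omega> z * ennreal (cmod (g (t - fst z))))) \<partial>lborel)"
      by (intro nn_integral_mono)
        (auto simp: norm_mult cmod_tf_shift indicator_def B ennreal_mult[symmetric] B0 intro!: ennreal_leI mult_right_mono)
    finally show ?thesis .
  next
    \<comment> \<open>A nonintegrable integrand gives the default value 0, so the bound holds at
      every t.\<close>
    case False
    then show ?thesis by (simp add: synthesis_def not_integrable_integral_eq)
  qed
  have 2: "(ennreal (cmod (synthesis g \<Omega> F t)))\<^sup>2 \<le> ennreal (measure lborel \<Omega>) * (\<integral>\<^sup>+z. ennreal (B\<^sup>2) * (indicator \<Omega> z * ennreal ((cmod (g (t - fst z)))\<^sup>2)) \<partial>lborel)" for t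
  proof -
    have "(ennreal (cmod (synthesis g \<Omega> F t)))\<^sup>2
       \<le> (\<integral>\<^sup>+z. indicator \<Omega> z * (ennreal B * (indicator \<Omega> z * ennreal (cmod (g (t - fst z))))) \<partial>lborel)\<^sup>2"
      by (rule power_mono[OF 1]) simp
    also have "\<dots> \<le> (\<integral>\<^sup>+z. (indicator \<Omega> z)\<^sup>2 \<partial>lborel) * (\<integral>\<^sup>+z. (ennreal B * (indicator \<Omega> z * ennreal (cmod (g (t - fst z)))))\<^sup>2 \<partial>lborel)"
      by (rule Cauchy_Schwarz_nn_integral) auto
    also have "(\<integral>\<^sup>+z. (indicator \<Omega> z)\<^sup>2 \<partial>lborel) = (\<integral>\<^sup>+z. indicator \<Omega> z \<partial>lborel)"
      by (rule nn_integral_cong) (auto simp: indicator_def)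
    also have "\<dots> = ennreal (measure lborel \<Omega>)" by (simp add: m)
    also have "(\<integral>\<^sup>+z. (ennreal B * (indicator \<Omega> z * ennreal (cmod (g (t - fst z)))))\<^sup>2 \<partial>lborel)
       = (\<integral>\<^sup>+z. ennreal (B\<^sup>2) * (indicator \<Omega> z * ennreal ((cmod (g (t - fst z)))\<^sup>2)) \<partial>lborel)"
      by (rule nn_integral_cong) (auto simp: indicator_def power_mult_distrib ennreal_power B0)
    finally show ?thesis .
  qed
  have "(\<integral>\<^sup>+t. ennreal ((cmod (synthesis g \<Omega> F t))\<^sup>2) \<partial>lborel)
      \<le> (\<integral>\<^sup>+t. ennreal (measure lborel \<Omega>) * (\<integral>\<^sup>+z. ennreal (B\<^sup>2) * (indicator \<Omega> z * ennreal ((cmod (g (t - fst z)))\<^sup>2)) \<partial>lborel) \<partial>lborel)"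
    by (rule nn_integral_mono) (use 2 in \<open>simp add: ennreal_power\<close>)
  also have "\<dots> = ennreal (measure lborel \<Omega>) * (\<integral>\<^sup>+t. (\<integral>\<^sup>+z. ennreal (B\<^sup>2) * (indicator \<Omega> z * ennreal ((cmod (g (t - fst z)))\<^sup>2)) \<partial>lborel) \<partial>lborel)"
    by (rule nn_integral_cmult) measurable
  also have "(\<integral>\<^sup>+t. (\<integral>\<^sup>+z. ennreal (B\<^sup>2) * (indicator \<Omega> z * ennreal ((cmod (g (t - fst z)))\<^sup>2)) \<partial>lborel) \<partial>lborel)
     = (\<integral>\<^sup>+z. (\<integral>\<^sup>+t. ennreal (B\<^sup>2) * (indicator \<Omega> z * ennreal ((cmod (g (t - fst z)))\<^sup>2)) \<partial>lborel) \<partial>lborel)"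
    by (rule lborel_pair.Fubini') measurable
  also have "\<dots> = (\<integral>\<^sup>+z. ennreal (B\<^sup>2) * (indicator \<Omega> z * (\<integral>\<^sup>+t. ennreal ((cmod (g (t - fst z)))\<^sup>2) \<partial>lborel)) \<partial>lborel)"
    by (simp add: nn_integral_cmult)
  also have "\<dots> = (\<integral>\<^sup>+z. (ennreal (B\<^sup>2) * ennreal ((norm2 g)\<^sup>2)) * indicator \<Omega> z \<partial>lborel)"
  proof -
    have "(\<integral>\<^sup>+t. ennreal ((cmod (g (t - x)))\<^sup>2) \<partial>lborel) = ennreal ((norm2 g)\<^sup>2)" for x
      using nn_integral_lborel_shift[of "\<lambda>t. ennreal ((cmod (g t))\<^sup>2)" x] L2_spaceD(2)[OF g]
      by (simp add: nn_integral_eq_integral norm2_sq)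
    then show ?thesis by (simp add: mult_ac)
  qed
  also have "\<dots> = (ennreal (B\<^sup>2) * ennreal ((norm2 g)\<^sup>2)) * ennreal (measure lborel \<Omega>)"
    by (subst nn_integral_cmult_indicator) (auto simp: m)
  also have "ennreal (measure lborel \<Omega>) * \<dots> = ennreal ((B * measure lborel \<Omega> * norm2 g)\<^sup>2)"
    by (simp add: ennreal_mult[symmetric] B0 norm2_nonneg power_mult_distrib power2_eq_square mult_ac)
  finally have le: "(\<integral>\<^sup>+t. ennreal ((cmod (synthesis g \<Omega> F t))\<^sup>2) \<partial>lborel) \<le> ennreal ((B * measure lborel \<Omega> * norm2 g)\<^sup>2)" .
  have i: "integrable lborel (\<lambda>t. (cmod (synthesis g \<Omega> F t))\<^sup>2)"
    using le by (intro integrableI_bounded) (auto simp: less_top[symmetric] top_unique)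
  then show "synthesis g \<Omega> F \<in> L2_space" by (intro L2_spaceI) auto
  have "(norm2 (synthesis g \<Omega> F))\<^sup>2 \<le> (B * measure lborel \<Omega> * norm2 g)\<^sup>2"
    using le nn_integral_eq_integral[OF i] by (simp add: norm2_sq)
  then show "norm2 (synthesis g \<Omega> F) \<le> B * measure lborel \<Omega> * norm2 g"
    by (rule power2_le_imp_le) (simp add: B0 norm2_nonneg)
qed

text \<open>Fubini. On \<Omega> the integrand is at most \<open>B\<close> times the sum of the
  squares of the two L^2 factors, whose integral over t is the same for all z.\<close>

lemma synthesis_adjoint:
  fixes g :: "'a::euclidean_space \<Rightarrow> complex" and \<Omega> :: "('a \<times> 'a) set"
  assumes g: "g \<in> L2_space" and u: "u \<in> L2_space" and [measurable]: "\<Omega> \<in> sets borel" "F \<in> borel_measurable borel"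
    and fin: "emeasure lborel \<Omega> < \<infinity>" and B: "\<And>z. z \<in> \<Omega> \<Longrightarrow> cmod (F z) \<le> B" and B0: "B \<ge> 0"
  shows "L2_inner (synthesis g \<Omega> F) u = (LINT z|lborel. indicator \<Omega> z * F z * cnj (stft g u z))"
proof -
  have [measurable]: "g \<in> borel_measurable borel" "u \<in> borel_measurable borel" using g u L2_spaceD by auto
  have i: "integrable (lborel \<Otimes>\<^sub>M lborel) (\<lambda>(t, z). indicator \<Omega> z * F z * tf_shift g z t * cnj (u t))"
  proof (rule integrableI_bounded)
    have "(\<integral>\<^sup>+p. ennreal (norm (case p of (t, z) \<Rightarrow> indicator \<Omega> z * F z * tf_shift g z t * cnj (u t))) \<partial>(lborel \<Otimes>\<^sub>M lborel))
       = (\<integral>\<^sup>+z. \<integral>\<^sup>+t. ennreal (norm (indicator \<Omega> z * F z * tf_shift g z t * cnj (u t))) \<partial>lborel \<partial>lborel)"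
      by (subst lborel_pair.nn_integral_snd[symmetric]) auto
    also have "\<dots> \<le> (\<integral>\<^sup>+z. ennreal (B * ((norm2 g)\<^sup>2 + (norm2 u)\<^sup>2)) * indicator \<Omega> z \<partial>lborel)"
    proof (rule nn_integral_mono)
      fix z :: "'a \<times> 'a"
      have it: "integrable lborel (\<lambda>t. (cmod (tf_shift g z t))\<^sup>2 + (cmod (u t))\<^sup>2)"
        using L2_spaceD(2)[OF L2_tf_shift[OF g]] L2_spaceD(2)[OF u] by auto
      have ab: "a * b \<le> a\<^sup>2 + b\<^sup>2" if "a \<ge> 0" "b \<ge> 0" for a b :: real
        using sum_squares_bound[of a b] that mult_nonneg_nonneg[of a b] by linarith
      show "(\<integral>\<^sup>+t. ennreal (norm (indicator \<Omega> z * F z * tf_shift g z t * cnj (u t))) \<partial>lborel)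
          \<le> ennreal (B * ((norm2 g)\<^sup>2 + (norm2 u)\<^sup>2)) * indicator \<Omega> z"
      proof (cases "z \<in> \<Omega>")
        case True
        have "(\<integral>\<^sup>+t. ennreal (norm (indicator \<Omega> z * F z * tf_shift g z t * cnj (u t))) \<partial>lborel)
           \<le> (\<integral>\<^sup>+t. ennreal B * ennreal ((cmod (tf_shift g z t))\<^sup>2 + (cmod (u t))\<^sup>2) \<partial>lborel)"
          using True B[OF True] ab B0
          by (intro nn_integral_mono) (auto simp: norm_mult ennreal_mult[symmetric] mult.assoc simp del: ennreal_plus intro!: ennreal_leI mult_mono)
        also have "\<dots> = ennreal B * ennreal ((norm2 (tf_shift g z))\<^sup>2 + (norm2 u)\<^sup>2)"
          using nn_integral_eq_integral[OF it] L2_spaceD(2)[OF L2_tf_shift[OF g]] L2_spaceD(2)[OF u]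
          by (subst nn_integral_cmult) (auto simp: norm2_sq)
        finally show ?thesis using True by (simp add: norm2_tf_shift[OF g] ennreal_mult B0)
      qed simp
    qed
    also have "\<dots> < \<infinity>"
      by (subst nn_integral_cmult_indicator) (use fin in \<open>auto simp: ennreal_mult_less_top\<close>)
    finally show "(\<integral>\<^sup>+p. ennreal (norm (case p of (t, z) \<Rightarrow> indicator \<Omega> z * F z * tf_shift g z t * cnj (u t))) \<partial>(lborel \<Otimes>\<^sub>M lborel)) < \<infinity>" .
  qed measurable
  have "L2_inner (synthesis g \<Omega> F) u = (LINT t|lborel. LINT z|lborel. indicator \<Omega> z * F z * tf_shift g z t * cnj (u t))"
    by (simp add: L2_inner_def synthesis_def)
  also have "\<dots> = (LINT z|lborel. LINT t|lborel. indicator \<Omega> z * F z * tf_shift g z t * cnj (u t))"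
    using lborel_pair.Fubini_integral[OF i] by simp
  also have "\<dots> = (LINT z|lborel. indicator \<Omega> z * F z * L2_inner (tf_shift g z) u)"
    by (simp only: L2_inner_def integral_mult_right_zero[symmetric] mult.assoc)
  also have "\<dots> = (LINT z|lborel. indicator \<Omega> z * F z * cnj (stft g u z))"
    by (simp add: stft_eq_inner L2_inner_cnj)
  finally show ?thesis .
qed

section \<open>Sets of finite perimeter\<close>

text \<open>Squaring removes the kink: at 0 the difference quotient is \<open>max 0 h\<close>. This
  is the C^1 building block of the cutoffs below.\<close>

lemma DERIV_square_pos_part:
  fixes s :: real
  shows "((\<lambda>s. (max 0 s)\<^sup>2) has_real_derivative 2 * max 0 s) (at s)"
proof (cases "s = 0")
  case True
  have "((\<lambda>h. ((max 0 (0 + h))\<^sup>2 - (max 0 0)\<^sup>2) / h) \<longlongrightarrow> 0) (at (0::real))"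
  proof (rule Lim_transform_eventually)
    have "((\<lambda>h::real. max 0 h) \<longlongrightarrow> max 0 0) (at 0)" by (intro tendsto_intros)
    then show "((\<lambda>h::real. max 0 h) \<longlongrightarrow> 0) (at 0)" by simp
    show "\<forall>\<^sub>F h::real in at 0. max 0 h = ((max 0 (0 + h))\<^sup>2 - (max 0 0)\<^sup>2) / h"
      unfolding eventually_at by (rule exI[of _ 1]) (auto simp: max_def power2_eq_square)
  qed
  then show ?thesis unfolding True DERIV_def by simp
next
  case False
  show ?thesis
  proof (cases "s > 0")
    case True
    have "((\<lambda>s. s\<^sup>2) has_real_derivative 2 * max 0 s) (at s)"
      using True by (auto intro!: derivative_eq_intros)
    then show ?thesis
      by (rule has_field_derivative_transform_within_open[where S="{0<..}"]) (use True in auto)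
  next
    case neg: False
    have "((\<lambda>s. 0) has_real_derivative 2 * max 0 s) (at s)"
      using neg by (auto intro!: derivative_eq_intros)
    then show ?thesis
      by (rule has_field_derivative_transform_within_open[where S="{..<0}"]) (use neg False in auto)
  qed
qed

lemma C1_bump:
  fixes K U :: "'n::euclidean_space set"
  assumes K: "compact K" and U: "open U" "K \<subseteq> U"
  shows "\<exists>\<psi> G S. (\<forall>x. (\<psi> has_derivative (\<lambda>v. G x \<bullet> v)) (at x)) \<and> continuous_on UNIV G \<and>
    (\<forall>x. 0 \<le> \<psi> x \<and> \<psi> x \<le> (1::real)) \<and> (\<forall>x\<in>K. \<psi> x = 1) \<and>
    compact S \<and> S \<subseteq> U \<and> (\<forall>x. x \<notin> S \<longrightarrow> \<psi> x = 0)"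
proof -
  have "\<exists>r>0. cball x r \<subseteq> U" if "x \<in> K" for x
    using that U open_contains_cball by blast
  then obtain r where r: "\<And>x. x \<in> K \<Longrightarrow> r x > 0 \<and> cball x (r x) \<subseteq> U" by metis
  have "K \<subseteq> (\<Union>x\<in>K. ball x (r x))" using r by force
  then obtain C where C: "C \<subseteq> K" "finite C" "K \<subseteq> (\<Union>x\<in>C. ball x (r x))"
    using compactE_image[OF K, of K "\<lambda>x. ball x (r x)"] by blast
  \<comment> \<open>One C^1 hump for each ball of a finite cover, positive inside the ball and zero
    outside; so \<open>B\<close> is positive on \<open>K\<close> and vanishes off the union
    \<open>S\<close> of the closed balls.\<close>
  define B where "B = (\<lambda>x. \<Sum>c\<in>C. (max 0 ((r c)\<^sup>2 - (x - c) \<bullet> (x - c)))\<^sup>2)"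
  define GB where "GB = (\<lambda>x. \<Sum>c\<in>C. (- 4 * max 0 ((r c)\<^sup>2 - (x - c) \<bullet> (x - c))) *\<^sub>R (x - c))"
  have dB: "(B has_derivative (\<lambda>v. GB x \<bullet> v)) (at x)" for x
  proof -
    have "((\<lambda>x. (max 0 ((r c)\<^sup>2 - (x - c) \<bullet> (x - c)))\<^sup>2) has_derivative
        (\<lambda>v. (0 - (v \<bullet> (x - c) + (x - c) \<bullet> v)) * (2 * max 0 ((r c)\<^sup>2 - (x - c) \<bullet> (x - c))))) (at x)" for c
      by (rule DERIV_compose_FDERIV[OF DERIV_square_pos_part]) (auto intro!: derivative_eq_intros)
    then have "(B has_derivative (\<lambda>v. \<Sum>c\<in>C. (0 - (v \<bullet> (x - c) + (x - c) \<bullet> v)) * (2 * max 0 ((r c)\<^sup>2 - (x - c) \<bullet> (x - c))))) (at x)"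
      unfolding B_def by (rule has_derivative_sum)
    also have "(\<lambda>v. \<Sum>c\<in>C. (0 - (v \<bullet> (x - c) + (x - c) \<bullet> v)) * (2 * max 0 ((r c)\<^sup>2 - (x - c) \<bullet> (x - c)))) = (\<lambda>v. GB x \<bullet> v)"
      unfolding GB_def inner_sum_left by (intro ext sum.cong refl) (simp add: inner_commute)
    finally show ?thesis .
  qed
  have contB: "continuous_on UNIV B" unfolding B_def by (intro continuous_intros)
  have contGB: "continuous_on UNIV GB" unfolding GB_def by (intro continuous_intros)
  have B0: "B x \<ge> 0" for x unfolding B_def by (intro sum_nonneg) simp
  have Bpos: "B x > 0" if "x \<in> K" for x
  proof -
    obtain c where c: "c \<in> C" "dist c x < r c" using C(3) \<open>x \<in> K\<close> by auto
    have "(x - c) \<bullet> (x - c) = (dist c x)\<^sup>2" by (subst dist_commute) (simp add: dist_norm power2_norm_eq_inner)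
    also have "\<dots> < (r c)\<^sup>2" using c by (intro power_strict_mono) auto
    finally have "0 < (max 0 ((r c)\<^sup>2 - (x - c) \<bullet> (x - c)))\<^sup>2" by simp
    also have "\<dots> \<le> B x"
      unfolding B_def using c C(2) by (intro member_le_sum) auto
    finally show ?thesis .
  qed
  obtain m where m: "m > 0" "\<And>x. x \<in> K \<Longrightarrow> m \<le> B x"
  proof (cases "K = {}")
    case False
    obtain x0 where "x0 \<in> K" "\<And>x. x \<in> K \<Longrightarrow> B x0 \<le> B x"
      using continuous_attains_inf[OF K False continuous_on_subset[OF contB]] by auto
    then show ?thesis using that Bpos by blast
  qed (use that[of 1] in auto)
  \<comment> \<open>\<open>m\<close> is a positive lower bound of \<open>B\<close> on
    \<open>K\<close>. The expression is 1 where B >= m and 0 where B = 0, and it is C^1 by the same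
    squared positive part.\<close>
  define \<psi> where "\<psi> = (\<lambda>x. 1 - (max 0 (1 - B x / m))\<^sup>2)"
  define G where "G = (\<lambda>x. (2 * max 0 (1 - B x / m) / m) *\<^sub>R GB x)"
  define S where "S = (\<Union>c\<in>C. cball c (r c))"
  show ?thesis
  proof (rule exI[of _ \<psi>], rule exI[of _ G], rule exI[of _ S], intro conjI allI ballI impI)
    show "(\<psi> has_derivative (\<lambda>v. G x \<bullet> v)) (at x)" for x
    proof -
      have "((\<lambda>x. (max 0 (1 - B x / m))\<^sup>2) has_derivative (\<lambda>v. (0 - (GB x \<bullet> v) / m) * (2 * max 0 (1 - B x / m)))) (at x)"
        by (rule DERIV_compose_FDERIV[OF DERIV_square_pos_part])
          (intro has_derivative_diff has_derivative_const bounded_linear.has_derivative[OF bounded_linear_divide] dB)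
      from has_derivative_diff[OF has_derivative_const[of 1] this]
      show ?thesis unfolding \<psi>_def G_def by (rule has_derivative_eq_rhs) (auto simp: mult_ac)
    qed
    show "continuous_on UNIV G" unfolding G_def using m(1) by (intro continuous_intros contB contGB) auto
    have le1: "max 0 (1 - B x / m) \<le> 1" for x using B0[of x] m(1) by simp
    show "0 \<le> \<psi> x" for x unfolding \<psi>_def using power_mono[OF le1[of x], of 2] by simp
    show "\<psi> x \<le> 1" for x unfolding \<psi>_def by simp
    show "\<psi> x = 1" if "x \<in> K" for x unfolding \<psi>_def using m(2)[OF that] m(1) by simp
    show "compact S" unfolding S_def using C(2) by (intro compact_UN) auto
    show "S \<subseteq> U" unfolding S_def using r C(1) by blast
    show "\<psi> x = 0" if "x \<notin> S" for x
    proof -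
      have "max 0 ((r c)\<^sup>2 - (x - c) \<bullet> (x - c)) = 0" if c: "c \<in> C" for c
      proof -
        have "r c \<le> dist c x" using \<open>x \<notin> S\<close> c by (force simp: S_def)
        then have "(r c)\<^sup>2 \<le> (dist c x)\<^sup>2" using r C(1) c by (intro power_mono) force+
        also have "\<dots> = (x - c) \<bullet> (x - c)" by (subst dist_commute) (simp add: dist_norm power2_norm_eq_inner)
        finally show ?thesis by simp
      qed
      then have "B x = 0" unfolding B_def by (intro sum.neutral) simp
      then show ?thesis by (simp add: \<psi>_def)
    qed
  qed
qed

section \<open>Variation tested against increments of a cutoff\<close>

lemma Variation_nonneg: "Variation f \<ge> 0"
proof -
  have 0: "frechet_derivative (\<lambda>_::'a. 0 :: 'a) (at x) = (\<lambda>_. 0)" for x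
    using frechet_derivative_at[of "\<lambda>_. 0 :: 'a" "\<lambda>_. 0" x] by simp
  have "ereal (LINT x|lborel. f x * divergence (\<lambda>_. 0) x) \<le> Variation f"
    unfolding Variation_def by (rule SUP_upper) (simp add: C1c_vector_fields_def 0)
  then show ?thesis by (simp add: divergence_def 0 zero_ereal_def)
qed

text \<open>
  The vector field is \<open>\<phi> z = - (\<integral>\<^sub>0\<^sup>1 \<psi> (z + s v) ds) v\<close>, whose divergence is \<open>\<psi> z - \<psi> (z + v)\<close>.
\<close>

lemma integral_difference_le_Variation:
  fixes f \<psi> :: "'n::euclidean_space \<Rightarrow> real" and v :: 'n
  assumes d: "\<And>x. (\<psi> has_derivative (\<lambda>w. G x \<bullet> w)) (at x)" and contG: "continuous_on UNIV G"
    and \<psi>: "\<And>x. \<bar>\<psi> x\<bar> \<le> 1" and S: "bounded S" "\<And>x. x \<notin> S \<Longrightarrow> \<psi> x = 0"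
  shows "ereal (LINT x|lborel. f x * (\<psi> x - \<psi> (x + v))) \<le> ereal (norm v) * Variation f"
proof (cases "v = 0")
  case True
  then show ?thesis by (simp add: zero_ereal_def[symmetric])
next
  case False
  have cont\<psi>: "continuous_on UNIV \<psi>"
    using d by (intro continuous_at_imp_continuous_on ballI has_derivative_continuous) auto
  \<comment> \<open>\<open>\<Gamma>\<close> will be the gradient of \<open>\<Psi>\<close>, the
    average of \<psi> over the segment from x to x + v, by differentiation under the
    integral.\<close>
  define \<Gamma> where "\<Gamma> = (\<lambda>x. integral (cbox 0 1) (\<lambda>s::real. G (x + s *\<^sub>R v)))"
  define \<Psi> where "\<Psi> = (\<lambda>x. integral (cbox 0 1) (\<lambda>s::real. \<psi> (x + s *\<^sub>R v)))"
  have Gi: "(\<lambda>s::real. G (x + s *\<^sub>R v)) integrable_on cbox 0 1" for x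
    by (intro integrable_continuous continuous_on_compose2[OF contG] continuous_intros) auto
  have \<psi>i: "(\<lambda>s::real. \<psi> (x + s *\<^sub>R v)) integrable_on cbox 0 1" for x
    by (intro integrable_continuous continuous_on_compose2[OF cont\<psi>] continuous_intros) auto
  have d\<Psi>: "(\<Psi> has_derivative (\<lambda>w. \<Gamma> x \<bullet> w)) (at x)" for x
  proof -
    have "(\<Psi> has_derivative integral (cbox 0 1) (\<lambda>s::real. blinfun_inner_right (G (x + s *\<^sub>R v)))) (at x within UNIV)"
      unfolding \<Psi>_def
    proof (rule leibniz_rule[where fx="\<lambda>x s. blinfun_inner_right (G (x + s *\<^sub>R v))"])
      fix x :: 'n and t :: real
      have "((\<lambda>x. x + t *\<^sub>R v) has_derivative (\<lambda>w. w)) (at x)"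
        by (auto intro!: derivative_eq_intros)
      from has_derivative_compose[OF this d]
      show "((\<lambda>x. \<psi> (x + t *\<^sub>R v)) has_derivative blinfun_apply (blinfun_inner_right (G (x + t *\<^sub>R v)))) (at x within UNIV)"
        by simp
    next
      show "continuous_on (UNIV \<times> cbox 0 1) (\<lambda>(x, t). blinfun_inner_right (G (x + t *\<^sub>R v)))"
        unfolding split_beta
        by (intro bounded_linear.continuous_on[OF bounded_linear_blinfun_inner_right]
            continuous_on_compose2[OF contG] continuous_intros) auto
    qed (use \<psi>i in auto)
    moreover have "integral (cbox 0 1) (\<lambda>s::real. blinfun_inner_right (G (x + s *\<^sub>R v))) = blinfun_inner_right (\<Gamma> x)"
      using integral_linear[OF Gi bounded_linear_blinfun_inner_right, of x] by (simp add: o_def \<Gamma>_def)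
    ultimately show ?thesis by simp
  qed
  have cont\<Gamma>: "continuous_on UNIV \<Gamma>"
    unfolding \<Gamma>_def
    by (rule integral_continuous_on_param) (auto simp: split_beta intro!: continuous_on_compose2[OF contG] continuous_intros)
  have ftc: "\<Gamma> x \<bullet> v = \<psi> (x + v) - \<psi> x" for x
  proof -
    have "((\<lambda>s. G (x + s *\<^sub>R v) \<bullet> v) has_integral \<psi> (x + 1 *\<^sub>R v) - \<psi> (x + 0 *\<^sub>R v)) {0..1}"
    proof (rule fundamental_theorem_of_calculus)
      fix s :: real
      have "((\<lambda>s. x + s *\<^sub>R v) has_derivative (\<lambda>t. t *\<^sub>R v)) (at s within {0..1})"
        by (auto intro!: derivative_eq_intros)
      from has_derivative_compose[OF this d]
      show "((\<lambda>s. \<psi> (x + s *\<^sub>R v)) has_vector_derivative G (x + s *\<^sub>R v) \<bullet> v) (at s within {0..1})"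
        unfolding has_vector_derivative_def by simp
    qed simp
    then have "integral (cbox 0 1) (\<lambda>s. G (x + s *\<^sub>R v) \<bullet> v) = \<psi> (x + v) - \<psi> x"
      by (simp add: integral_unique)
    moreover have "integral (cbox 0 1) (\<lambda>s. G (x + s *\<^sub>R v) \<bullet> v) = \<Gamma> x \<bullet> v"
      using integral_linear[OF Gi bounded_linear_inner_left[of v], of x] by (simp add: o_def \<Gamma>_def)
    ultimately show ?thesis by simp
  qed
  \<comment> \<open>Dividing by \<open>norm v\<close> gives a field of length at most 1, and the
    factor returns at the end; this is why v = 0 is set apart.\<close>
  define \<phi> where "\<phi> = (\<lambda>x. - (\<Psi> x / norm v) *\<^sub>R v)"
  have d\<phi>: "(\<phi> has_derivative (\<lambda>w. - ((\<Gamma> x \<bullet> w) / norm v) *\<^sub>R v)) (at x)" for x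
    unfolding \<phi>_def
    by (intro has_derivative_scaleR_left has_derivative_minus bounded_linear.has_derivative[OF bounded_linear_divide] d\<Psi>)
  have F: "frechet_derivative \<phi> (at x) = (\<lambda>w. - ((\<Gamma> x \<bullet> w) / norm v) *\<^sub>R v)" for x
    using frechet_derivative_at[OF d\<phi>] by simp
  have div: "divergence \<phi> x = (\<psi> x - \<psi> (x + v)) / norm v" for x
  proof -
    have "divergence \<phi> x = - (\<Gamma> x \<bullet> v) / norm v"
      unfolding divergence_def F euclidean_inner[of "\<Gamma> x" v]
      by (simp add: sum_negf sum_divide_distrib)
    then show ?thesis unfolding ftc by simp
  qed
  have "\<bar>\<Psi> x\<bar> \<le> 1" for x
  proof -
    have "continuous_on {0..1} (\<lambda>s. \<psi> (x + s *\<^sub>R v))"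
      by (intro continuous_on_compose2[OF cont\<psi>] continuous_intros) auto
    then show ?thesis
      using integral_bound[of 0 1 "\<lambda>s::real. \<psi> (x + s *\<^sub>R v)" 1] \<psi> by (simp add: \<Psi>_def)
  qed
  then have n\<phi>: "norm (\<phi> x) \<le> 1" for x
    using False by (simp add: \<phi>_def)
  \<comment> \<open>A segment of length \<open>norm v\<close> starting at x meets \<open>S\<close>
    only if x lies within that distance of \<open>S\<close>, so averaging keeps the support
    bounded.\<close>
  have supp: "bounded {x. \<phi> x \<noteq> 0}"
  proof -
    obtain b where b: "\<And>x. x \<in> S \<Longrightarrow> norm x \<le> b" using S(1) unfolding bounded_iff by blast
    have "norm x \<le> b + norm v" if "\<phi> x \<noteq> 0" for x
    proof (rule ccontr)
      assume *: "\<not> norm x \<le> b + norm v"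
      have "\<psi> (x + s *\<^sub>R v) = 0" if "s \<in> cbox 0 1" for s
      proof (rule S(2), rule notI)
        assume "x + s *\<^sub>R v \<in> S"
        then have "norm (x + s *\<^sub>R v) \<le> b" by (rule b)
        moreover have "norm (s *\<^sub>R v) \<le> norm v" using that by (simp add: mult_left_le_one_le)
        moreover have "norm x \<le> norm (x + s *\<^sub>R v) + norm (s *\<^sub>R v)"
          using norm_triangle_ineq4[of "x + s *\<^sub>R v" "s *\<^sub>R v"] by simp
        ultimately show False using * by simp
      qed
      then have "\<Psi> x = integral (cbox 0 1) (\<lambda>s::real. 0)"
        unfolding \<Psi>_def by (rule Henstock_Kurzweil_Integration.integral_cong)
      then show False using that by (simp add: \<phi>_def)
    qed
    then show ?thesis unfolding bounded_iff by blast
  qed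
  have "\<phi> \<in> {\<phi> \<in> C1c_vector_fields. \<forall>x. norm (\<phi> x) \<le> 1}"
    unfolding C1c_vector_fields_def
  proof (intro CollectI conjI allI ballI n\<phi>)
    show "\<phi> differentiable (at x)" for x using d\<phi> by (rule differentiableI)
    show "continuous_on UNIV (\<lambda>x. frechet_derivative \<phi> (at x) b)" for b
      unfolding F using False by (intro continuous_intros cont\<Gamma>) auto
    show "compact (closure {x. \<phi> x \<noteq> 0})" using supp by (simp add: compact_closure)
  qed
  then have "ereal (LINT x|lborel. f x * divergence \<phi> x) \<le> Variation f"
    unfolding Variation_def by (rule SUP_upper)
  then have "ereal (norm v) * ereal (LINT x|lborel. f x * divergence \<phi> x) \<le> ereal (norm v) * Variation f"
    by (intro ereal_mult_left_mono) auto
  moreover have "(LINT x|lborel. f x * divergence \<phi> x) = (LINT x|lborel. f x * (\<psi> x - \<psi> (x + v))) / norm v"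
    unfolding div by simp
  ultimately show ?thesis using False by simp
qed

text \<open>The indicator of \<Omega> minus that of \<Omega> + v is 1 exactly on this set and at
  most 0 elsewhere. Integrated against a cutoff of the set it gives the measure up to
  \<open>e\<close>, and moving the translation onto the cutoff produces the quantity bounded by the
  variation.\<close>

lemma measure_translate_diff_le:
  fixes \<Omega> :: "'n::euclidean_space set" and v :: 'n
  assumes "compact \<Omega>" and "finite_perimeter \<Omega>"
  shows "measure lborel {z \<in> \<Omega>. z - v \<notin> \<Omega>} \<le> norm v * perimeter \<Omega>"
proof (rule field_le_epsilon)
  fix e :: real assume e: "e > 0"
  have [measurable]: "\<Omega> \<in> sets borel" using assms(1) by (simp add: compact_imp_closed borel_closed)
  define A where "A = {z \<in> \<Omega>. z - v \<notin> \<Omega>}"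
  have "A = \<Omega> \<inter> - ((\<lambda>z. z - v) -` \<Omega> \<inter> space borel)" by (auto simp: A_def)
  moreover have "(\<lambda>z. z - v) -` \<Omega> \<inter> space borel \<in> sets borel"
    by (rule measurable_sets[of _ borel borel]) auto
  ultimately have [measurable]: "A \<in> sets borel" by auto
  have finO: "emeasure lborel \<Omega> < \<infinity>" using assms(1) by (rule emeasure_compact_finite)
  have fin: "emeasure lborel A < \<infinity>"
    using emeasure_mono[of A \<Omega> lborel] finO by (auto simp: A_def intro: le_less_trans)
  obtain U where U: "open U" "A \<subseteq> U" "emeasure lborel (U - A) < ennreal (e/2)"
    using outer_regular_lborel[of A "e/2"] e by auto
  obtain V where V: "open V" "- A \<subseteq> V" "emeasure lborel (V - - A) < ennreal (e/2)"
    using outer_regular_lborel[of "- A" "e/2"] e by auto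
  have [measurable]: "U \<in> sets borel" "V \<in> sets borel" using U V by auto
  \<comment> \<open>Outer regularity of the complement gives inner regularity of \<open>A\<close>;
    \<open>K\<close> is compact as a closed subset of \<Omega>.\<close>
  define K where "K = - V"
  have KA: "K \<subseteq> A" and AK: "A - K = V - - A" using V(2) by (auto simp: K_def)
  have [measurable]: "K \<in> sets borel" by (auto simp: K_def)
  have KU: "K \<subseteq> U" using KA U(2) by auto
  have cK: "compact K"
  proof -
    have "closed K" using V(1) by (simp add: K_def closed_Compl)
    then have "compact (\<Omega> \<inter> K)" using assms(1) by (rule compact_Int_closed[rotated])
    moreover have "\<Omega> \<inter> K = K" using KA by (auto simp: A_def)
    ultimately show ?thesis by simp
  qed
  obtain \<psi> G S where bump: "\<forall>x. (\<psi> has_derivative (\<lambda>v. G x \<bullet> v)) (at x)" "continuous_on UNIV G"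
    "\<forall>x. 0 \<le> \<psi> x \<and> \<psi> x \<le> (1::real)" "\<forall>x\<in>K. \<psi> x = 1"
    "compact S" "S \<subseteq> U" "\<forall>x. x \<notin> S \<longrightarrow> \<psi> x = 0"
    using C1_bump[OF cK U(1) KU] by blast
  then have \<psi>: "\<And>x. (\<psi> has_derivative (\<lambda>v. G x \<bullet> v)) (at x)" "continuous_on UNIV G"
    "\<And>x. 0 \<le> \<psi> x" "\<And>x. \<psi> x \<le> (1::real)" "\<And>x. x \<in> K \<Longrightarrow> \<psi> x = 1"
    "compact S" "S \<subseteq> U" "\<And>x. x \<notin> S \<Longrightarrow> \<psi> x = 0"
    by blast+
  have [measurable]: "\<psi> \<in> borel_measurable borel"
    using \<psi>(1) by (intro borel_measurable_continuous_onI continuous_at_imp_continuous_on ballI has_derivative_continuous) auto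
  have i\<Omega>: "integrable lborel (indicat_real \<Omega>)" using finO by (simp add: integrable_indicator_iff)
  have i1: "integrable lborel (\<lambda>x. indicat_real \<Omega> x * \<psi> x)"
    by (rule Bochner_Integration.integrable_bound[OF i\<Omega>]) (use \<psi>(3,4) in \<open>auto simp: indicator_def\<close>)
  have i2: "integrable lborel (\<lambda>x. indicat_real \<Omega> x * \<psi> (x + v))"
    by (rule Bochner_Integration.integrable_bound[OF i\<Omega>]) (use \<psi>(3,4) in \<open>auto simp: indicator_def\<close>)
  have i3: "integrable lborel (\<lambda>x. indicat_real \<Omega> (x - v) * \<psi> x)"
    by (rule Bochner_Integration.integrable_bound[OF integrable_lborel_shift[OF i\<Omega>, of v]])
      (use \<psi>(3,4) in \<open>auto simp: indicator_def\<close>)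
  have fUA: "emeasure lborel (U - A) < \<infinity>" using U(3) by (rule less_trans) simp
  have fAK: "emeasure lborel (A - K) < \<infinity>" using V(3) unfolding AK by (rule less_trans) simp
  have fK: "emeasure lborel K < \<infinity>"
    using emeasure_mono[OF KA, of lborel] fin by (auto intro: le_less_trans)
  have iK: "integrable lborel (indicat_real K)" and iUA: "integrable lborel (indicat_real (U - A))"
    using fK fUA by (simp_all add: integrable_indicator_iff)
  have mUA: "measure lborel (U - A) \<le> e / 2"
    using U(3) e unfolding measure_def by (intro enn2real_leI) auto
  have mAK: "measure lborel (A - K) \<le> e / 2"
    using V(3) e unfolding measure_def AK by (intro enn2real_leI) auto
  have "measure lborel A = measure lborel K + measure lborel (A - K)"
  proof -
    have "A = K \<union> (A - K)" using KA by auto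
    then have "measure lborel A = measure lborel (K \<union> (A - K))" by simp
    also have "\<dots> = measure lborel K + measure lborel (A - K)"
      by (rule measure_Union) (use fK fAK in auto)
    finally show ?thesis .
  qed
  then have 1: "measure lborel A - e \<le> measure lborel K - measure lborel (U - A)"
    using mUA mAK by simp
  have "measure lborel K - measure lborel (U - A) = (LINT x|lborel. indicat_real K x - indicat_real (U - A) x)"
    using iK iUA by (subst Bochner_Integration.integral_diff) auto
  \<comment> \<open>On \<open>A\<close> the right side is \<psi>, which is 1 on \<open>K\<close>.
    Off \<open>A\<close> the indicator difference is 0 or -1, and \<psi> is at most the indicator of
    \<open>U\<close>.\<close>
  also have "\<dots> \<le> (LINT x|lborel. indicat_real \<Omega> x * \<psi> x - indicat_real \<Omega> (x - v) * \<psi> x)"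
  proof (rule integral_mono)
    fix x :: 'n
    show "indicat_real K x - indicat_real (U - A) x \<le> indicat_real \<Omega> x * \<psi> x - indicat_real \<Omega> (x - v) * \<psi> x"
    proof (cases "x \<in> A")
      case True
      then have "indicat_real \<Omega> x = 1" "indicat_real \<Omega> (x - v) = 0" by (auto simp: A_def)
      then show ?thesis using True \<psi>(3)[of x] \<psi>(5)[of x] by (cases "x \<in> K") auto
    next
      case False
      then have "x \<notin> K" using KA by auto
      show ?thesis
      proof (cases "x \<in> U")
        case True
        then show ?thesis using False \<open>x \<notin> K\<close> \<psi>(3,4)[of x] by (auto simp: indicator_def)
      next
        case False
        then have "\<psi> x = 0" using \<psi>(7,8) by blast
        then show ?thesis using False \<open>x \<notin> K\<close> by simp
      qed
    qed
  qed (use i1 i3 iK iUA in auto)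
  also have "\<dots> = (LINT x|lborel. indicat_real \<Omega> x * \<psi> x) - (LINT x|lborel. indicat_real \<Omega> (x - v) * \<psi> x)"
    by (rule Bochner_Integration.integral_diff[OF i1 i3])
  also have "(LINT x|lborel. indicat_real \<Omega> (x - v) * \<psi> x) = (LINT x|lborel. indicat_real \<Omega> x * \<psi> (x + v))"
    using integral_lborel_shift[of "\<lambda>x. indicat_real \<Omega> x * \<psi> (x + v)" v] by simp
  also have "(LINT x|lborel. indicat_real \<Omega> x * \<psi> x) - (LINT x|lborel. indicat_real \<Omega> x * \<psi> (x + v))
      = (LINT x|lborel. indicat_real \<Omega> x * (\<psi> x - \<psi> (x + v)))"
    using i1 i2 by (simp add: right_diff_distrib)
  finally have 2: "measure lborel A - e \<le> (LINT x|lborel. indicat_real \<Omega> x * (\<psi> x - \<psi> (x + v)))"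
    using 1 by simp
  have "ereal (LINT x|lborel. indicat_real \<Omega> x * (\<psi> x - \<psi> (x + v))) \<le> ereal (norm v) * Variation (indicat_real \<Omega>)"
    using \<psi>(3,4) by (intro integral_difference_le_Variation[OF \<psi>(1,2) _ compact_imp_bounded[OF \<psi>(6)] \<psi>(8)]) auto
  \<comment> \<open>Finite perimeter excludes infinity, which \<open>real_of_ereal\<close> would
    send to 0.\<close>
  moreover have "Variation (indicat_real \<Omega>) = ereal (perimeter \<Omega>)"
    using assms(2) Variation_nonneg[of "indicat_real \<Omega>"]
    by (cases "Variation (indicat_real \<Omega>)") (auto simp: perimeter_def finite_perimeter_def bounded_variation_def)
  ultimately have "(LINT x|lborel. indicat_real \<Omega> x * (\<psi> x - \<psi> (x + v))) \<le> norm v * perimeter \<Omega>" by simp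
  with 2 show "measure lborel {z \<in> \<Omega>. z - v \<notin> \<Omega>} \<le> norm v * perimeter \<Omega> + e"
    unfolding A_def by simp
qed

lemma perimeter_nonneg: "perimeter \<Omega> \<ge> 0"
  unfolding perimeter_def by (rule real_of_ereal_pos[OF Variation_nonneg])

section \<open>Eigenfunctions of the localization operator\<close>

locale localization =
  fixes g :: "'a::euclidean_space \<Rightarrow> complex" and \<Omega> :: "('a \<times> 'a) set"
  assumes g: "g \<in> L2_space" and g1: "norm2 g = 1" and compact: "compact \<Omega>"
begin

text \<open>The quadratic form of the operator (\<open>H_inner_self\<close>), written as a real
  integral so that order and positivity are immediate.\<close>

definition form :: "('a \<Rightarrow> complex) \<Rightarrow> real" where
  "form u = (LINT z|lborel. indicat_real \<Omega> z * (cmod (stft g u z))\<^sup>2)"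

lemma \<Omega>_borel[measurable]: "\<Omega> \<in> sets borel"
  using compact by (simp add: compact_imp_closed borel_closed)

lemma \<Omega>_finite: "emeasure lborel \<Omega> < \<infinity>"
  using compact by (rule emeasure_compact_finite)

lemma g_borel[measurable]: "g \<in> borel_measurable borel"
  using g by (rule L2_spaceD)

lemma stft_bound: "u \<in> L2_space \<Longrightarrow> cmod (stft g u z) \<le> norm2 u"
  using cmod_stft_le[OF g, of u z] g1 by simp

lemma H_L2: "u \<in> L2_space \<Longrightarrow> loc_op g \<Omega> u \<in> L2_space"
  unfolding loc_op_eq_synthesis
  by (rule synthesis_L2[OF g \<Omega>_borel _ \<Omega>_finite, of _ "norm2 u"])
    (auto simp: stft_bound norm2_nonneg L2_spaceD borel_measurable_stft)

lemma H_inner: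
  assumes "u \<in> L2_space" "w \<in> L2_space"
  shows "L2_inner (loc_op g \<Omega> u) w = (LINT z|lborel. indicator \<Omega> z * stft g u z * cnj (stft g w z))"
  unfolding loc_op_eq_synthesis
  by (rule synthesis_adjoint[OF g assms(2) \<Omega>_borel _ \<Omega>_finite, of _ "norm2 u"])
    (use assms(1) in \<open>auto simp: stft_bound norm2_nonneg L2_spaceD borel_measurable_stft\<close>)

lemma H_symmetric:
  assumes "u \<in> L2_space" "w \<in> L2_space"
  shows "L2_inner (loc_op g \<Omega> u) w = L2_inner u (loc_op g \<Omega> w)"
proof -
  have "L2_inner u (loc_op g \<Omega> w) = cnj (L2_inner (loc_op g \<Omega> w) u)"
    by (simp add: L2_inner_cnj)
  also have "\<dots> = (LINT z|lborel. cnj (indicator \<Omega> z * stft g w z * cnj (stft g u z)))"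
    unfolding H_inner[OF assms(2,1)] by (rule Bochner_Integration.integral_cnj[symmetric])
  also have "\<dots> = L2_inner (loc_op g \<Omega> u) w"
    unfolding H_inner[OF assms]
    by (rule Bochner_Integration.integral_cong) (auto simp: indicator_def mult.commute)
  finally show ?thesis by simp
qed

lemma H_inner_self:
  assumes "u \<in> L2_space"
  shows "L2_inner (loc_op g \<Omega> u) u = complex_of_real (form u)"
proof -
  have "L2_inner (loc_op g \<Omega> u) u = (LINT z|lborel. complex_of_real (indicat_real \<Omega> z * (cmod (stft g u z))\<^sup>2))"
    unfolding H_inner[OF assms assms] mult.assoc complex_norm_square[symmetric]
    by (rule Bochner_Integration.integral_cong) (auto simp: indicator_def)
  then show ?thesis unfolding form_def by (simp only: integral_complex_of_real)
qed

lemma integrable_form: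
  assumes "u \<in> L2_space"
  shows "integrable lborel (\<lambda>z. indicat_real \<Omega> z * (cmod (stft g u z))\<^sup>2)"
proof (rule Bochner_Integration.integrable_bound[OF stft_square_integrable(1)[OF assms g]])
  have [measurable]: "u \<in> borel_measurable borel" using assms by (rule L2_spaceD)
  show "(\<lambda>z. indicat_real \<Omega> z * (cmod (stft g u z))\<^sup>2) \<in> borel_measurable lborel" by measurable
qed (auto simp: indicator_def)

lemma form_nonneg: "form u \<ge> 0"
  unfolding form_def by (rule integral_nonneg_AE) auto

lemma form_le:
  assumes "u \<in> L2_space"
  shows "form u \<le> (norm2 u)\<^sup>2"
proof -
  have "form u \<le> (LINT z|lborel. (cmod (stft g u z))\<^sup>2)"
    unfolding form_def
    by (rule integral_mono[OF integrable_form[OF assms] stft_square_integrable(1)[OF assms g]]) (auto simp: indicator_def)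
  then show ?thesis by (simp add: stft_square_integrable(2)[OF assms g] g1)
qed

text \<open>Cauchy-Schwarz for the semidefinite form of the operator, from the L^2 inequality on
  \<Omega>. With w = H u it will control the norm of H u by \<open>form u\<close>.\<close>

lemma H_Cauchy_Schwarz:
  assumes u: "u \<in> L2_space" and w: "w \<in> L2_space"
  shows "(cmod (L2_inner (loc_op g \<Omega> u) w))\<^sup>2 \<le> form u * form w"
proof -
  have [measurable]: "u \<in> borel_measurable borel" "w \<in> borel_measurable borel"
    using u w by (auto simp: L2_spaceD)
  have sq: "(cmod (indicator \<Omega> z * x))\<^sup>2 = indicat_real \<Omega> z * (cmod x)\<^sup>2" for z x
    by (auto simp: indicator_def)
  have "L2_inner (loc_op g \<Omega> u) w
      = (LINT z|lborel. (indicator \<Omega> z * stft g u z) * (indicator \<Omega> z * cnj (stft g w z)))"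
    unfolding H_inner[OF assms] by (rule Bochner_Integration.integral_cong) (auto simp: indicator_def)
  also have "(cmod \<dots>)\<^sup>2 \<le> (LINT z|lborel. (cmod (indicator \<Omega> z * stft g u z))\<^sup>2)
      * (LINT z|lborel. (cmod (indicator \<Omega> z * cnj (stft g w z)))\<^sup>2)"
    by (rule Cauchy_Schwarz_integral) (use integrable_form[OF u] integrable_form[OF w] in \<open>auto simp: sq\<close>)
  finally show ?thesis unfolding sq form_def by simp
qed

lemma form_scale: "form (\<lambda>t. c * u t) = (cmod c)\<^sup>2 * form u"
proof -
  have "stft g (\<lambda>t. c * u t) z = c * stft g u z" for z
    by (simp add: stft_eq_inner L2_inner_scale_left)
  then have "form (\<lambda>t. c * u t) = (LINT z|lborel. (cmod c)\<^sup>2 * (indicat_real \<Omega> z * (cmod (stft g u z))\<^sup>2))"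
    unfolding form_def by (simp add: norm_mult power_mult_distrib mult_ac)
  then show ?thesis unfolding form_def by simp
qed

text \<open>Symmetry moves the operator onto \<open>e\<close>. Hence the orthogonal complement of
  eigenfunctions is invariant, and the variational argument below stays inside it.\<close>

lemma inner_eigenfunction_right:
  assumes e: "eigenfunction_eq (loc_op g \<Omega>) (complex_of_real \<mu>) e" and u: "u \<in> L2_space"
  shows "L2_inner (loc_op g \<Omega> u) e = complex_of_real \<mu> * L2_inner u e"
proof -
  have e2: "e \<in> L2_space" and ae: "AE t in lborel. loc_op g \<Omega> e t = complex_of_real \<mu> * e t"
    using e by (auto simp: eigenfunction_eq_def)
  have "L2_inner (loc_op g \<Omega> e) u = L2_inner (\<lambda>t. complex_of_real \<mu> * e t) u"
    by (rule L2_inner_cong_AE) (use e2 u ae H_L2[OF e2] L2_scale[OF e2] in \<open>auto simp: L2_spaceD\<close>)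
  also have "\<dots> = complex_of_real \<mu> * L2_inner e u" by (rule L2_inner_scale_left)
  finally have "cnj (L2_inner (loc_op g \<Omega> e) u) = complex_of_real \<mu> * cnj (L2_inner e u)" by simp
  then show ?thesis using H_symmetric[OF u e2] by (simp add: L2_inner_cnj)
qed

text \<open>
  A maximizing sequence of the Rayleigh quotient consists of approximate eigenvectors. On the compact
  set \<open>\<Omega>\<close> their short-time Fourier transforms are equicontinuous, so by Arzela-Ascoli they converge
  uniformly along a subsequence; the synthesis of the limit is the eigenvector.
\<close>

lemma eigenfunction_exists:
  fixes e :: "'k \<Rightarrow> 'a \<Rightarrow> complex"
  assumes e: "\<And>k. k \<in> I \<Longrightarrow> eigenfunction_eq (loc_op g \<Omega>) (complex_of_real (\<nu> k)) (e k)"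
    and u0: "u0 \<in> L2_space" "\<And>k. k \<in> I \<Longrightarrow> L2_inner u0 (e k) = 0"
    and m0: "m0 \<ge> 0" "form u0 > m0 * (norm2 u0)\<^sup>2"
  shows "\<exists>\<mu> v. \<mu> > m0 \<and> eigenfunction_eq (loc_op g \<Omega>) (complex_of_real \<mu>) v \<and>
    (\<forall>k\<in>I. L2_inner v (e k) = 0) \<and> norm2 v \<noteq> 0"
proof -
  define H where "H = loc_op g \<Omega>"
  define M where "M = {u \<in> L2_space. \<forall>k\<in>I. L2_inner u (e k) = 0}"
  have e2: "e k \<in> L2_space" if "k \<in> I" for k using e[OF that] by (simp add: eigenfunction_eq_def)
  have M2: "u \<in> L2_space" if "u \<in> M" for u using that by (simp add: M_def)
  have HM: "H u \<in> M" if "u \<in> M" for u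
    using that inner_eigenfunction_right[OF e] H_L2 by (auto simp: M_def H_def)
  have scM: "(\<lambda>t. c * u t) \<in> M" if "u \<in> M" for c u
    using that L2_scale by (auto simp: M_def L2_inner_scale_left)
  \<comment> \<open>The unit ball always contains 0, so the supremum is over a nonempty set; by
    homogeneity it bounds the Rayleigh quotient on \<open>M\<close>.\<close>
  define R where "R = form ` {u \<in> M. norm2 u \<le> 1}"
  define \<mu> where "\<mu> = Sup R"
  have bdd: "bdd_above R"
  proof (rule bdd_aboveI)
    fix x assume "x \<in> R"
    then obtain u where u: "u \<in> M" "norm2 u \<le> 1" "x = form u" by (auto simp: R_def)
    have "form u \<le> (norm2 u)\<^sup>2" by (rule form_le[OF M2[OF u(1)]])
    also have "\<dots> \<le> 1" using u(2) norm2_nonneg[of u] by (simp add: power_le_one)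
    finally show "x \<le> 1" using u by simp
  qed
  have quotient: "form u \<le> \<mu> * (norm2 u)\<^sup>2" if u: "u \<in> M" for u
  proof (cases "norm2 u = 0")
    case True
    then show ?thesis using form_le[OF M2[OF u]] by simp
  next
    case False
    then have pos: "norm2 u > 0" using norm2_nonneg[of u] by simp
    let ?w = "\<lambda>t. complex_of_real (1 / norm2 u) * u t"
    have "norm2 ?w = 1" using pos by (subst norm2_scale) (simp add: norm_divide)
    then have "norm2 ?w \<le> 1" by (rule eq_refl)
    then have "?w \<in> {u \<in> M. norm2 u \<le> 1}" using scM[OF u] by blast
    then have "form ?w \<in> R" unfolding R_def by (rule imageI)
    then have "form ?w \<le> \<mu>" unfolding \<mu>_def by (rule cSup_upper[OF _ bdd])
    moreover have "form ?w = form u / (norm2 u)\<^sup>2"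
      using pos by (subst form_scale) (simp add: norm_divide power_divide)
    ultimately show ?thesis using pos by (simp add: divide_le_eq)
  qed
  have u0M: "u0 \<in> M" using u0 by (simp add: M_def)
  have "m0 * (norm2 u0)\<^sup>2 < \<mu> * (norm2 u0)\<^sup>2" using m0(2) quotient[OF u0M] by simp
  then have \<mu>: "\<mu> > m0" by (rule mult_right_less_imp_less) simp
  then have \<mu>0: "\<mu> > 0" using m0(1) by simp
  \<comment> \<open>In Cauchy-Schwarz for the form take w = H u, which lies in \<open>M\<close>
    again, bound \<open>form (H u)\<close> by the Rayleigh quotient and cancel.\<close>
  have HQ: "(norm2 (H u))\<^sup>2 \<le> \<mu> * form u" if u: "u \<in> M" for u
  proof (cases "norm2 (H u) = 0")
    case True
    then show ?thesis using \<mu>0 form_nonneg by simp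
  next
    case False
    have "(cmod (L2_inner (H u) (H u)))\<^sup>2 \<le> form u * form (H u)"
      unfolding H_def by (rule H_Cauchy_Schwarz) (use u M2 H_L2 in auto)
    also have "\<dots> \<le> form u * (\<mu> * (norm2 (H u))\<^sup>2)"
      by (rule mult_left_mono[OF quotient[OF HM[OF u]] form_nonneg])
    finally have "(norm2 (H u))\<^sup>2 * (norm2 (H u))\<^sup>2 \<le> (\<mu> * form u) * (norm2 (H u))\<^sup>2"
      unfolding L2_inner_self norm_of_real by (simp add: power2_eq_square mult_ac)
    then show ?thesis by (rule mult_right_le_imp_le) (use False in simp)
  qed
  have "\<exists>u. u \<in> M \<and> norm2 u \<le> 1 \<and> form u > \<mu> - 1 / real (Suc n)" for n
  proof -
    have "(\<lambda>t. 0) \<in> M" using L2_zero by (auto simp: M_def L2_inner_def)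
    moreover have "norm2 (\<lambda>t. 0 :: complex) \<le> 1" by (simp add: norm2_def)
    ultimately have "R \<noteq> {}" unfolding R_def by blast
    moreover have "\<mu> - 1 / real (Suc n) < Sup R" unfolding \<mu>_def by simp
    ultimately obtain x where "x \<in> R" "\<mu> - 1 / real (Suc n) < x"
      using less_cSup_iff[OF _ bdd] by blast
    then show ?thesis unfolding R_def by auto
  qed
  then obtain U where U: "\<And>n. U n \<in> M" "\<And>n. norm2 (U n) \<le> 1" "\<And>n. form (U n) > \<mu> - 1 / real (Suc n)"
    by metis
  have U2: "U n \<in> L2_space" for n using U(1) M2 by blast
  have \<mu>U2: "(\<lambda>t. complex_of_real \<mu> * U n t) \<in> L2_space" for n by (rule L2_scale[OF U2])
  have HU2: "H (U n) \<in> L2_space" for n unfolding H_def by (rule H_L2[OF U2])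
  \<comment> \<open>Expanding the square and using \<open>HQ\<close> bounds it by \<mu> (\<mu> -
    form (U n)): near-maximizers are near-eigenvectors.\<close>
  have resid: "(norm2 (\<lambda>t. H (U n) t - complex_of_real \<mu> * U n t))\<^sup>2 \<le> \<mu> * (1 / real (Suc n))" for n
  proof -
    have 1: "L2_inner (H (U n)) (\<lambda>t. complex_of_real \<mu> * U n t) = complex_of_real (\<mu> * form (U n))"
      unfolding L2_inner_scale_right H_def H_inner_self[OF U2] by simp
    have "(norm2 (\<lambda>t. H (U n) t - complex_of_real \<mu> * U n t))\<^sup>2
       = (norm2 (H (U n)))\<^sup>2 - 2 * (\<mu> * form (U n)) + (\<mu> * norm2 (U n))\<^sup>2"
      unfolding norm2_diff_sq[OF HU2 \<mu>U2] 1 norm2_scale Re_complex_of_real using \<mu>0 by simp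
    also have "\<dots> \<le> \<mu> * form (U n) - 2 * (\<mu> * form (U n)) + \<mu> * \<mu>"
    proof -
      have "(\<mu> * norm2 (U n))\<^sup>2 \<le> (\<mu> * 1)\<^sup>2"
        using U(2)[of n] \<mu>0 norm2_nonneg[of "U n"] by (intro power_mono mult_left_mono) auto
      then show ?thesis using HQ[OF U(1)[of n]] by (simp add: power2_eq_square)
    qed
    also have "\<dots> = \<mu> * (\<mu> - form (U n))" by (simp add: algebra_simps)
    also have "\<dots> \<le> \<mu> * (1 / real (Suc n))"
      using U(3)[of n] \<mu>0 by (intro mult_left_mono) linarith+
    finally show ?thesis .
  qed
  have resid_lim: "(\<lambda>n. norm2 (\<lambda>t. H (U n) t - complex_of_real \<mu> * U n t)) \<longlonglongrightarrow> 0"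
  proof -
    have "(\<lambda>n. \<mu> * (1 / real (Suc n))) \<longlonglongrightarrow> \<mu> * 0"
      by (intro tendsto_intros LIMSEQ_Suc[OF lim_1_over_n])
    then have z: "(\<lambda>n. \<mu> * (1 / real (Suc n))) \<longlonglongrightarrow> 0" by simp
    have "(\<lambda>n. (norm2 (\<lambda>t. H (U n) t - complex_of_real \<mu> * U n t))\<^sup>2) \<longlonglongrightarrow> 0"
      by (rule tendsto_sandwich[OF _ _ tendsto_const z]) (use resid in auto)
    from tendsto_real_sqrt[OF this] show ?thesis by (simp add: norm2_nonneg)
  qed
  have sb: "cmod (stft g (U n) z) \<le> 1" for n z
    using stft_bound[OF U2, of n z] U(2)[of n] by simp
  obtain G k where k: "strict_mono (k :: nat \<Rightarrow> nat)"
    and unif: "\<And>\<epsilon>. 0 < \<epsilon> \<Longrightarrow> \<exists>N. \<forall>n z. n \<ge> N \<and> z \<in> \<Omega> \<longrightarrow> norm (stft g (U (k n)) z - G z) < \<epsilon>"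
  proof (rule Arzela_Ascoli[OF compact, of "\<lambda>n. stft g (U n)" 1])
    show "norm (stft g (U n) z) \<le> 1" for n z by (rule sb)
    show "\<exists>d>0. \<forall>n w. w \<in> \<Omega> \<and> norm (z - w) < d \<longrightarrow> norm (stft g (U n) z - stft g (U n) w) < \<epsilon>"
      if "z \<in> \<Omega>" and \<epsilon>: "\<epsilon> > 0" for z \<epsilon>
    proof -
      obtain d where d: "d > 0" "\<And>w. norm (z - w) < d \<Longrightarrow> norm2 (\<lambda>t. tf_shift g z t - tf_shift g w t) < \<epsilon>"
        using tf_shift_equicontinuous[OF g \<epsilon>, of z] by blast
      have "norm (stft g (U n) z - stft g (U n) w) < \<epsilon>" if "norm (z - w) < d" for n w
      proof -
        have "norm (stft g (U n) z - stft g (U n) w) \<le> norm2 (U n) * norm2 (\<lambda>t. tf_shift g z t - tf_shift g w t)"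
          by (rule cmod_stft_diff_le[OF g U2])
        also have "\<dots> \<le> 1 * norm2 (\<lambda>t. tf_shift g z t - tf_shift g w t)"
          by (rule mult_right_mono[OF U(2) norm2_nonneg])
        finally show ?thesis using d(2)[OF that] by simp
      qed
      then show ?thesis using d(1) by blast
    qed
  qed (rule that)
  have Glim: "(\<lambda>n. stft g (U (k n)) z) \<longlonglongrightarrow> G z" if "z \<in> \<Omega>" for z
    by (rule LIMSEQ_I) (use unif that in blast)
  \<comment> \<open>\<open>G\<close> is controlled on \<Omega> only; the cutoff makes it measurable
    on all of phase space, as a pointwise limit.\<close>
  define F where "F = (\<lambda>z. indicator \<Omega> z * G z)"
  have [measurable]: "U n \<in> borel_measurable borel" for n using U2 by (rule L2_spaceD)
  have Fm: "F \<in> borel_measurable borel"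
  proof (rule borel_measurable_LIMSEQ_metric)
    show "(\<lambda>z. indicator \<Omega> z * stft g (U (k n)) z) \<in> borel_measurable borel" for n by measurable
    show "(\<lambda>n. indicator \<Omega> z * stft g (U (k n)) z) \<longlonglongrightarrow> F z" for z
      using Glim[of z] by (cases "z \<in> \<Omega>") (auto simp: F_def)
  qed
  note [measurable] = Fm
  have Fb: "cmod (F z) \<le> 1" if "z \<in> \<Omega>" for z
  proof -
    have "cmod (G z) \<le> 1"
      by (rule LIMSEQ_le_const2[OF tendsto_norm[OF Glim[OF that]]]) (use sb in blast)
    then show ?thesis using that by (simp add: F_def)
  qed
  define v where "v = synthesis g \<Omega> F"
  have v2: "v \<in> L2_space" unfolding v_def
    by (rule synthesis_L2[OF g \<Omega>_borel Fm \<Omega>_finite Fb]) auto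
  have v_inner: "L2_inner v w = (LINT z|lborel. indicator \<Omega> z * F z * cnj (stft g w z))" if "w \<in> L2_space" for w
    unfolding v_def by (rule synthesis_adjoint[OF g that \<Omega>_borel Fm \<Omega>_finite Fb]) auto
  \<comment> \<open>Pair the difference \<open>D\<close> with itself. Its transform is at most
    \<open>norm2 D\<close>, so uniform closeness on \<Omega> gives a bound linear in
    \<open>norm2 D\<close>, and one factor cancels.\<close>
  have conv: "norm2 (\<lambda>t. H (U (k n)) t - v t) \<le> \<epsilon> * measure lborel \<Omega>"
    if \<epsilon>: "\<And>z. z \<in> \<Omega> \<Longrightarrow> norm (stft g (U (k n)) z - G z) \<le> \<epsilon>" "\<epsilon> > 0" for n \<epsilon>
  proof -
    define D where "D = (\<lambda>t. H (U (k n)) t - v t)"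
    have D2: "D \<in> L2_space" unfolding D_def by (rule L2_diff[OF HU2 v2])
    have [measurable]: "D \<in> borel_measurable borel" using D2 by (rule L2_spaceD)
    have i\<Omega>: "integrable lborel (indicat_real \<Omega>)" using \<Omega>_finite by (simp add: integrable_indicator_iff)
    have bi: "integrable lborel (\<lambda>z. indicator \<Omega> z * f z * cnj (stft g D z))"
      if [measurable]: "f \<in> borel_measurable borel" and f: "\<And>z. z \<in> \<Omega> \<Longrightarrow> cmod (f z) \<le> 1" for f
    proof (rule Bochner_Integration.integrable_bound)
      show "integrable lborel (\<lambda>z. norm2 D * indicat_real \<Omega> z)" using i\<Omega> by simp
      have "norm (indicator \<Omega> z * f z * cnj (stft g D z)) \<le> norm2 D * indicat_real \<Omega> z" for z
        using mult_mono[OF f stft_bound[OF D2], of z z] by (cases "z \<in> \<Omega>") (auto simp: norm_mult)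
      then show "AE z in lborel. norm (indicator \<Omega> z * f z * cnj (stft g D z)) \<le> norm (norm2 D * indicat_real \<Omega> z)"
        by (simp add: norm2_nonneg)
    qed measurable
    have "L2_inner D D = L2_inner (H (U (k n))) D - L2_inner v D"
      unfolding D_def by (rule L2_inner_diff_left[OF HU2 v2 D2[unfolded D_def]])
    also have "\<dots> = (LINT z|lborel. indicator \<Omega> z * stft g (U (k n)) z * cnj (stft g D z) - indicator \<Omega> z * F z * cnj (stft g D z))"
      unfolding H_def H_inner[OF U2 D2] v_inner[OF D2]
      by (rule Bochner_Integration.integral_diff[symmetric]) (auto intro!: bi simp: sb Fb)
    finally have DD: "L2_inner D D = \<dots>" .
    have "cmod (L2_inner D D) \<le> (LINT z|lborel. (\<epsilon> * norm2 D) * indicat_real \<Omega> z)"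
      unfolding DD
    proof (rule order_trans[OF integral_norm_bound integral_mono'])
      show "integrable lborel (\<lambda>z. (\<epsilon> * norm2 D) * indicat_real \<Omega> z)" using i\<Omega> by simp
      show "0 \<le> (\<epsilon> * norm2 D) * indicat_real \<Omega> z" for z
        using \<epsilon>(2) norm2_nonneg[of D] by simp
      fix z
      have "indicator \<Omega> z * stft g (U (k n)) z * cnj (stft g D z) - indicator \<Omega> z * F z * cnj (stft g D z)
         = indicator \<Omega> z * ((stft g (U (k n)) z - G z) * cnj (stft g D z))"
        by (auto simp: F_def indicator_def algebra_simps)
      moreover have "cmod ((stft g (U (k n)) z - G z) * cnj (stft g D z)) \<le> \<epsilon> * norm2 D" if "z \<in> \<Omega>"
        unfolding norm_mult complex_mod_cnj
        by (rule mult_mono[OF \<epsilon>(1)[OF that] stft_bound[OF D2]]) (use \<epsilon>(2) in auto)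
      ultimately show "norm (indicator \<Omega> z * stft g (U (k n)) z * cnj (stft g D z) - indicator \<Omega> z * F z * cnj (stft g D z))
          \<le> (\<epsilon> * norm2 D) * indicat_real \<Omega> z"
        by (cases "z \<in> \<Omega>") auto
    qed
    also have "\<dots> = \<epsilon> * norm2 D * measure lborel \<Omega>" by simp
    finally have "norm2 D * norm2 D \<le> (\<epsilon> * measure lborel \<Omega>) * norm2 D"
      unfolding L2_inner_self norm_of_real by (simp add: power2_eq_square mult_ac)
    moreover have "0 \<le> \<epsilon> * measure lborel \<Omega>" using \<epsilon>(2) by simp
    ultimately have "norm2 D \<le> \<epsilon> * measure lborel \<Omega>"
      using norm2_nonneg[of D] by (cases "norm2 D = 0") (auto simp: mult_le_cancel_right)
    then show ?thesis by (simp add: D_def)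
  qed
  have conv_lim: "(\<lambda>n. norm2 (\<lambda>t. H (U (k n)) t - v t)) \<longlonglongrightarrow> 0"
  proof (rule LIMSEQ_I)
    fix r :: real assume r: "r > 0"
    define \<epsilon> where "\<epsilon> = r / (measure lborel \<Omega> + 1)"
    have m: "measure lborel \<Omega> + 1 > 0" using measure_nonneg[of lborel \<Omega>] by linarith
    then have \<epsilon>1: "\<epsilon> > 0" unfolding \<epsilon>_def using r by (rule divide_pos_pos[rotated])
    moreover have "\<epsilon> * (measure lborel \<Omega> + 1) = r" unfolding \<epsilon>_def using m by simp
    ultimately have \<epsilon>: "\<epsilon> > 0" "\<epsilon> * measure lborel \<Omega> < r" by (simp_all add: distrib_left)
    obtain N where N: "\<And>n z. n \<ge> N \<Longrightarrow> z \<in> \<Omega> \<Longrightarrow> norm (stft g (U (k n)) z - G z) < \<epsilon>"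
      using unif[OF \<epsilon>(1)] by blast
    have "norm (norm2 (\<lambda>t. H (U (k n)) t - v t) - 0) < r" if "n \<ge> N" for n
    proof -
      have "norm2 (\<lambda>t. H (U (k n)) t - v t) \<le> \<epsilon> * measure lborel \<Omega>"
        by (rule conv[OF less_imp_le[OF N[OF that]] \<epsilon>(1)])
      then show ?thesis using \<epsilon>(2) norm2_nonneg[of "\<lambda>t. H (U (k n)) t - v t"] by simp
    qed
    then show "\<exists>no. \<forall>n\<ge>no. norm (norm2 (\<lambda>t. H (U (k n)) t - v t) - 0) < r" by blast
  qed
  define W where "W = (\<lambda>n. norm2 (\<lambda>t. complex_of_real \<mu> * U (k n) t - v t))"
  have W: "W \<longlonglongrightarrow> 0"
  proof (rule tendsto_sandwich[OF _ _ tendsto_const])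
    have "W n \<le> norm2 (\<lambda>t. H (U (k n)) t - v t) + norm2 (\<lambda>t. H (U (k n)) t - complex_of_real \<mu> * U (k n) t)" for n
      using norm2_diff_le[OF L2_diff[OF HU2 v2] L2_diff[OF HU2 \<mu>U2], of "k n" "k n"] by (simp add: W_def)
    then show "\<forall>\<^sub>F n in sequentially. W n \<le> norm2 (\<lambda>t. H (U (k n)) t - v t) + norm2 (\<lambda>t. H (U (k n)) t - complex_of_real \<mu> * U (k n) t)"
      by simp
    show "\<forall>\<^sub>F n in sequentially. 0 \<le> W n" by (simp add: W_def norm2_nonneg)
    show "(\<lambda>n. norm2 (\<lambda>t. H (U (k n)) t - v t) + norm2 (\<lambda>t. H (U (k n)) t - complex_of_real \<mu> * U (k n) t)) \<longlonglongrightarrow> 0"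
      using tendsto_add[OF conv_lim LIMSEQ_subseq_LIMSEQ[OF resid_lim k]] by (simp add: o_def)
  qed
  \<comment> \<open>Since \<mu> U (k n) tends to v in norm, the transforms converge pointwise.
    Comparison with the uniform limit identifies the transform of v on \<Omega>, and thereby H v at
    every t.\<close>
  have stft_v: "stft g v z = complex_of_real \<mu> * G z" if "z \<in> \<Omega>" for z
  proof (rule LIMSEQ_unique)
    show "(\<lambda>n. complex_of_real \<mu> * stft g (U (k n)) z) \<longlonglongrightarrow> complex_of_real \<mu> * G z"
      by (intro tendsto_intros Glim that)
    have "norm (complex_of_real \<mu> * stft g (U (k n)) z - stft g v z) \<le> W n" for n
    proof -
      have "stft g (\<lambda>t. complex_of_real \<mu> * U (k n) t - v t) z = complex_of_real \<mu> * stft g (U (k n)) z - stft g v z"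
        by (simp add: stft_eq_inner L2_inner_diff_left[OF \<mu>U2 v2 L2_tf_shift[OF g]] L2_inner_scale_left)
      then show ?thesis unfolding W_def using stft_bound[OF L2_diff[OF \<mu>U2 v2], of "k n" z] by simp
    qed
    then have "(\<lambda>n. complex_of_real \<mu> * stft g (U (k n)) z - stft g v z) \<longlonglongrightarrow> 0"
      by (intro Lim_null_comparison[OF always_eventually W] allI)
    then show "(\<lambda>n. complex_of_real \<mu> * stft g (U (k n)) z) \<longlonglongrightarrow> stft g v z" by (simp add: LIM_zero_iff)
  qed
  have Hv: "loc_op g \<Omega> v t = complex_of_real \<mu> * v t" for t
  proof -
    have "loc_op g \<Omega> v t = (LINT z|lborel. complex_of_real \<mu> * (indicator \<Omega> z * F z * tf_shift g z t))"
      unfolding loc_op_eq_synthesis synthesis_def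
      by (rule Bochner_Integration.integral_cong) (auto simp: indicator_def F_def stft_v)
    then show ?thesis by (simp add: v_def synthesis_def)
  qed
  have orth: "L2_inner v (e i) = 0" if "i \<in> I" for i
  proof -
    have "cmod (L2_inner v (e i)) \<le> W n * norm2 (e i)" for n
    proof -
      have "L2_inner (\<lambda>t. complex_of_real \<mu> * U (k n) t - v t) (e i) = - L2_inner v (e i)"
        using U(1)[of "k n"] that by (simp add: L2_inner_diff_left[OF \<mu>U2 v2 e2] L2_inner_scale_left M_def)
      then show ?thesis
        using L2_inner_Cauchy_Schwarz[OF L2_diff[OF \<mu>U2 v2] e2[OF that], of "k n"] by (simp add: W_def)
    qed
    moreover have "(\<lambda>n. W n * norm2 (e i)) \<longlonglongrightarrow> 0 * norm2 (e i)" by (intro tendsto_intros W)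
    ultimately have "cmod (L2_inner v (e i)) \<le> 0"
      by (intro LIMSEQ_le_const[of "\<lambda>n. W n * norm2 (e i)" 0]) auto
    then show ?thesis by simp
  qed
  \<comment> \<open>If v vanished, the norms along the subsequence would tend to 0, while
    \<open>form (U (k n))\<close>, at most the squared norm, stays close to \<mu> > 0.\<close>
  have "norm2 v \<noteq> 0"
  proof
    assume v0: "norm2 v = 0"
    have le: "\<mu> * norm2 (U (k n)) \<le> W n" for n
    proof -
      have "norm2 (\<lambda>t. (complex_of_real \<mu> * U (k n) t - v t) + v t) \<le> W n + norm2 v"
        unfolding W_def by (rule norm2_triangle[OF L2_diff[OF \<mu>U2 v2] v2])
      then show ?thesis using v0 \<mu>0 by (simp add: norm2_scale)
    qed
    have le2: "\<mu> - 1 / real (Suc (k n)) \<le> (W n / \<mu>)\<^sup>2" for n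
    proof -
      have "\<mu> - 1 / real (Suc (k n)) \<le> (norm2 (U (k n)))\<^sup>2"
        using U(3)[of "k n"] form_le[OF U2[of "k n"]] by linarith
      also have "\<dots> \<le> (W n / \<mu>)\<^sup>2"
        using le[of n] \<mu>0 by (intro power_mono norm2_nonneg) (simp add: pos_le_divide_eq mult.commute)
      finally show ?thesis .
    qed
    have l1: "(\<lambda>n. \<mu> - 1 / real (Suc (k n))) \<longlonglongrightarrow> \<mu> - 0"
      using LIMSEQ_subseq_LIMSEQ[OF LIMSEQ_Suc[OF lim_1_over_n] k] by (intro tendsto_intros) (simp add: o_def)
    have l2: "(\<lambda>n. (W n / \<mu>)\<^sup>2) \<longlonglongrightarrow> (0 / \<mu>)\<^sup>2"
      using \<mu>0 by (intro tendsto_intros W) auto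
    have "\<mu> - 0 \<le> (0 / \<mu>)\<^sup>2"
      by (rule LIMSEQ_le[OF l1 l2]) (use le2 in blast)
    then show False using \<mu>0 by simp
  qed
  then show ?thesis
    using \<mu> v2 Hv orth by (intro exI[of _ \<mu>] exI[of _ v]) (auto simp: eigenfunction_eq_def)
qed


lemma eigenvalue_eq_form:
  assumes "eigenfunction_eq (loc_op g \<Omega>) (complex_of_real \<mu>) e" "L2_inner e e = 1"
  shows "form e = \<mu>"
proof -
  have "complex_of_real (form e) = complex_of_real \<mu> * L2_inner e e"
    using inner_eigenfunction_right[OF assms(1), of e] H_inner_self[of e] assms(1)
    by (simp add: eigenfunction_eq_def)
  then show ?thesis using assms(2) by simp
qed

end

section \<open>Truncated spectral expansion along the given eigensystem\<close>

locale localization_eigensystem = localization g \<Omega>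
  for g :: "'a::euclidean_space \<Rightarrow> complex" and \<Omega> +
  fixes N :: enat and lam :: "nat \<Rightarrow> real" and h :: "nat \<Rightarrow> 'a \<Rightarrow> complex"
  assumes eigensystem: "nonzero_eigensystem (loc_op g \<Omega>) N lam h"
begin

definition K :: "nat set" where "K = {k. 1 \<le> k \<and> enat k \<le> N}"

text \<open>
  Padding the eigensystem with the eigenvalue \<open>0\<close> outside \<open>K\<close> treats finite and infinite \<open>N\<close> alike.
\<close>

definition l :: "nat \<Rightarrow> real" where "l k = (if k \<in> K then lam k else 0)"

definition p :: "nat \<Rightarrow> 'a \<times> 'a \<Rightarrow> real" where "p k z = (if k \<in> K then (cmod (stft g (h k) z))\<^sup>2 else 0)"

definition q :: "'a \<times> 'a \<Rightarrow> real" where "q z = form (tf_shift g z)"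

lemma eigen:
  assumes "k \<in> K"
  shows "eigenfunction_eq (loc_op g \<Omega>) (complex_of_real (lam k)) (h k)" "lam k \<noteq> 0"
  using eigensystem assms unfolding nonzero_eigensystem_def Let_def K_def by auto

lemma h_L2: "k \<in> K \<Longrightarrow> h k \<in> L2_space"
  using eigen(1) by (auto simp: eigenfunction_eq_def)

lemma orthonormal: "j \<in> K \<Longrightarrow> k \<in> K \<Longrightarrow> L2_inner (h j) (h k) = (if j = k then 1 else 0)"
  using eigensystem unfolding nonzero_eigensystem_def Let_def K_def by auto

lemma lam_antimono: "j \<in> K \<Longrightarrow> k \<in> K \<Longrightarrow> j \<le> k \<Longrightarrow> lam k \<le> lam j"
  using eigensystem unfolding nonzero_eigensystem_def Let_def K_def by auto

lemma eigenfunction_spanned: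
  assumes "\<mu> \<noteq> 0" "eigenfunction_eq (loc_op g \<Omega>) (complex_of_real \<mu>) f"
  obtains c where "finite {k \<in> K. lam k = \<mu>}"
    "AE t in lborel. f t = (\<Sum>k \<in> {k \<in> K. lam k = \<mu>}. c k * h k t)"
proof -
  have "complex_of_real \<mu> \<noteq> 0" using assms(1) by simp
  with eigensystem have "finite {k \<in> K. complex_of_real (lam k) = complex_of_real \<mu>} \<and>
      (\<exists>c. AE t in lborel. f t = (\<Sum>k \<in> {k \<in> K. complex_of_real (lam k) = complex_of_real \<mu>}. c k * h k t))"
    unfolding nonzero_eigensystem_def Let_def K_def[symmetric] using assms(2) by blast
  then show ?thesis using that by (auto simp only: of_real_eq_iff)
qed

lemma lam_eq_form: "k \<in> K \<Longrightarrow> form (h k) = lam k"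
  using eigenvalue_eq_form[OF eigen(1)] orthonormal by simp

lemma norm2_h: "k \<in> K \<Longrightarrow> norm2 (h k) = 1"
  using orthonormal[of k k] norm2_nonneg[of "h k"] by (auto simp: L2_inner_self power2_eq_1_iff simp flip: of_real_power)

lemma l_nonneg: "l k \<ge> 0"
  using form_nonneg[of "h k"] lam_eq_form by (auto simp: l_def)

lemma l_le_1: "l k \<le> 1"
  using form_le[OF h_L2, of k] lam_eq_form norm2_h by (auto simp: l_def)

text \<open>\<open>K\<close> is an initial segment of the positive integers, so padding with zeros
  keeps the order. Index 0 lies outside \<open>K\<close> and has \<open>l 0 = 0\<close>, hence the
  start at 1.\<close>

lemma l_antimono:
  assumes "1 \<le> j" "j \<le> k"
  shows "l k \<le> l j"
proof (cases "k \<in> K")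
  case True
  then have "j \<in> K" using assms by (auto simp: K_def intro: order_trans[of "enat j" "enat k"])
  then show ?thesis using True lam_antimono[of j k] assms by (simp add: l_def)
next
  case False
  then show ?thesis using l_nonneg[of j] by (simp add: l_def)
qed

text \<open>Otherwise \<open>eigenfunction_exists\<close> supplies an eigenfunction with eigenvalue
  above \<open>l (Suc n)\<close>, orthogonal to the first n listed ones. Every listed function with
  that eigenvalue has index at most n, so by spanning the new one is orthogonal to itself.\<close>

lemma form_tail_le:
  assumes u: "u \<in> L2_space" and orth: "\<And>k. k \<in> K \<inter> {1..n} \<Longrightarrow> L2_inner u (h k) = 0"
  shows "form u \<le> l (Suc n) * (norm2 u)\<^sup>2"
proof (rule ccontr)
  assume "\<not> ?thesis"
  then obtain \<mu> v where \<mu>: "\<mu> > l (Suc n)" and v: "eigenfunction_eq (loc_op g \<Omega>) (complex_of_real \<mu>) v"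
    and v0: "\<And>k. k \<in> K \<inter> {1..n} \<Longrightarrow> L2_inner v (h k) = 0" and nv: "norm2 v \<noteq> 0"
    using eigenfunction_exists[of "K \<inter> {1..n}" lam h u "l (Suc n)"] eigen(1) u orth l_nonneg[of "Suc n"]
    by (auto simp: not_le)
  have v2: "v \<in> L2_space" using v by (simp add: eigenfunction_eq_def)
  have "\<mu> \<noteq> 0" using \<mu> l_nonneg[of "Suc n"] by auto
  then obtain c where fin: "finite {k \<in> K. lam k = \<mu>}"
    and c: "AE t in lborel. v t = (\<Sum>k \<in> {k \<in> K. lam k = \<mu>}. c k * h k t)"
    using eigenfunction_spanned[OF _ v] by blast
  let ?J = "{k \<in> K. lam k = \<mu>}"
  have J: "L2_inner v (h k) = 0" if k: "k \<in> ?J" for k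
  proof (rule v0)
    have "k \<le> n"
    proof (rule ccontr)
      assume "\<not> k \<le> n"
      then have "l k \<le> l (Suc n)" by (intro l_antimono) auto
      then show False using k \<mu> by (simp add: l_def)
    qed
    then show "k \<in> K \<inter> {1..n}" using k by (auto simp: K_def)
  qed
  have s2: "(\<lambda>t. \<Sum>k\<in>?J. c k * h k t) \<in> L2_space"
    by (intro L2_sum L2_scale h_L2) auto
  have "L2_inner v v = L2_inner (\<lambda>t. \<Sum>k\<in>?J. c k * h k t) v"
    by (rule L2_inner_cong_AE[OF _ _ _ c]) (use v2 s2 in \<open>auto simp: L2_spaceD\<close>)
  also have "\<dots> = (\<Sum>k\<in>?J. L2_inner (\<lambda>t. c k * h k t) v)"
    by (rule L2_inner_sum_left[OF L2_scale[OF h_L2] v2]) auto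
  also have "\<dots> = (\<Sum>k\<in>?J. c k * cnj (L2_inner v (h k)))"
    by (simp add: L2_inner_scale_left L2_inner_cnj)
  also have "\<dots> = 0" by (rule sum.neutral) (use J in auto)
  finally show False using nv by (simp add: L2_inner_self)
qed

text \<open>Let w be u minus its projection onto the first n eigenfunctions. Their span is
  invariant, so the form splits without cross terms and \<open>form w\<close> is
  \<open>form u\<close> minus the sum. The two bounds are \<open>form_nonneg\<close> and
  \<open>form_tail_le\<close> for w.\<close>

lemma form_expansion:
  assumes u: "u \<in> L2_space"
  shows "(\<Sum>k\<in>K \<inter> {1..n}. lam k * (cmod (L2_inner u (h k)))\<^sup>2) \<le> form u"
    and "form u \<le> (\<Sum>k\<in>K \<inter> {1..n}. lam k * (cmod (L2_inner u (h k)))\<^sup>2) + l (Suc n) * (norm2 u)\<^sup>2"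
proof -
  define J where "J = K \<inter> {1..n}"
  have J: "finite J" "\<And>k. k \<in> J \<Longrightarrow> k \<in> K" by (auto simp: J_def)
  define c where "c k = L2_inner u (h k)" for k
  define s where "s = (\<lambda>t. \<Sum>k\<in>J. c k * h k t)"
  define w where "w = (\<lambda>t. u t - s t)"
  have s2: "s \<in> L2_space" unfolding s_def by (intro L2_sum L2_scale h_L2 J)
  have w2: "w \<in> L2_space" unfolding w_def by (rule L2_diff[OF u s2])
  have s_left: "L2_inner s f = (\<Sum>k\<in>J. c k * L2_inner (h k) f)" if "f \<in> L2_space" for f
    unfolding s_def using L2_inner_sum_left[OF L2_scale[OF h_L2[OF J(2)]] that, of J "\<lambda>k. k" c]
    by (simp add: L2_inner_scale_left)
  have s_right: "L2_inner f s = (\<Sum>k\<in>J. cnj (c k) * L2_inner f (h k))" if "f \<in> L2_space" for f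
    using arg_cong[OF s_left[OF that], of cnj] by (simp add: L2_inner_cnj)
  have wh: "L2_inner w (h j) = 0" if "j \<in> J" for j
  proof -
    have "L2_inner s (h j) = (\<Sum>k\<in>J. c k * L2_inner (h k) (h j))" by (rule s_left[OF h_L2[OF J(2)[OF that]]])
    also have "\<dots> = (\<Sum>k\<in>J. if k = j then c k else 0)"
      by (rule sum.cong) (use orthonormal J(2) that in auto)
    also have "\<dots> = c j" using J(1) that by simp
    finally show ?thesis
      by (simp add: w_def L2_inner_diff_left[OF u s2 h_L2[OF J(2)[OF that]]] c_def)
  qed
  have ws: "L2_inner w s = 0"
    unfolding s_right[OF w2] by (rule sum.neutral) (simp add: wh)
  have Hws: "L2_inner (loc_op g \<Omega> w) s = 0"
    unfolding s_right[OF H_L2[OF w2]]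
    by (rule sum.neutral) (use inner_eigenfunction_right[OF eigen(1)[OF J(2)] w2] wh in auto)
  have w_left: "L2_inner w f = L2_inner u f - L2_inner s f" if "f \<in> L2_space" for f
    unfolding w_def by (rule L2_inner_diff_left[OF u s2 that])
  have w_right: "L2_inner f w = L2_inner f u - L2_inner f s" if "f \<in> L2_space" for f
    unfolding w_def by (rule L2_inner_diff_right[OF u s2 that])
  have cc: "x * cnj x = complex_of_real ((cmod x)\<^sup>2)" for x by (rule complex_norm_square[symmetric])
  have "complex_of_real ((norm2 w)\<^sup>2) = L2_inner w u - L2_inner w s"
    unfolding L2_inner_self[symmetric] by (rule w_right[OF w2])
  also have "\<dots> = L2_inner u u - L2_inner s u"
    unfolding ws w_left[OF u] by simp
  also have "L2_inner s u = (\<Sum>k\<in>J. complex_of_real ((cmod (c k))\<^sup>2))"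
    unfolding s_left[OF u] cc[symmetric] by (simp add: c_def L2_inner_cnj)
  finally have "complex_of_real ((norm2 w)\<^sup>2) = complex_of_real ((norm2 u)\<^sup>2 - (\<Sum>k\<in>J. (cmod (c k))\<^sup>2))"
    by (simp add: L2_inner_self)
  then have nw: "(norm2 w)\<^sup>2 \<le> (norm2 u)\<^sup>2"
    unfolding of_real_eq_iff by (simp add: sum_nonneg)
  have "complex_of_real (form w) = L2_inner (loc_op g \<Omega> w) u - L2_inner (loc_op g \<Omega> w) s"
    unfolding H_inner_self[OF w2, symmetric] by (rule w_right[OF H_L2[OF w2]])
  also have "\<dots> = L2_inner u (loc_op g \<Omega> u) - L2_inner s (loc_op g \<Omega> u)"
    unfolding Hws H_symmetric[OF w2 u] w_left[OF H_L2[OF u]] by simp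
  also have "L2_inner u (loc_op g \<Omega> u) = complex_of_real (form u)"
    using H_symmetric[OF u u] H_inner_self[OF u] by simp
  also have "L2_inner s (loc_op g \<Omega> u) = (\<Sum>k\<in>J. complex_of_real (lam k * (cmod (c k))\<^sup>2))"
    unfolding s_left[OF H_L2[OF u]]
  proof (rule sum.cong[OF refl])
    fix k assume k: "k \<in> J"
    have "L2_inner (h k) (loc_op g \<Omega> u) = cnj (complex_of_real (lam k) * c k)"
      using inner_eigenfunction_right[OF eigen(1)[OF J(2)[OF k]] u] by (metis L2_inner_cnj c_def)
    then show "c k * L2_inner (h k) (loc_op g \<Omega> u) = complex_of_real (lam k * (cmod (c k))\<^sup>2)"
      using cc[of "c k"] by (simp add: mult_ac)
  qed
  finally have "complex_of_real (form w) = complex_of_real (form u - (\<Sum>k\<in>J. lam k * (cmod (c k))\<^sup>2))"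
    by simp
  then have fw: "form w = form u - (\<Sum>k\<in>J. lam k * (cmod (c k))\<^sup>2)" by (simp only: of_real_eq_iff)
  then show "(\<Sum>k\<in>K \<inter> {1..n}. lam k * (cmod (L2_inner u (h k)))\<^sup>2) \<le> form u"
    using form_nonneg[of w] by (simp add: J_def c_def)
  have "form w \<le> l (Suc n) * (norm2 w)\<^sup>2"
    by (rule form_tail_le[OF w2]) (use wh in \<open>simp add: J_def\<close>)
  also have "\<dots> \<le> l (Suc n) * (norm2 u)\<^sup>2" by (rule mult_left_mono[OF nw l_nonneg])
  finally show "form u \<le> (\<Sum>k\<in>K \<inter> {1..n}. lam k * (cmod (L2_inner u (h k)))\<^sup>2) + l (Suc n) * (norm2 u)\<^sup>2"
    using fw by (simp add: J_def c_def)
qed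

text \<open>All shifts of the window have norm 1, so the error in \<open>form_expansion\<close> is
  \<open>l (Suc n)\<close> uniformly in z.\<close>

lemma q_expansion:
  shows "(\<Sum>k=1..n. l k * p k z) \<le> q z" and "q z \<le> (\<Sum>k=1..n. l k * p k z) + l (Suc n)"
proof -
  have "(\<Sum>k=1..n. l k * p k z) = (\<Sum>k\<in>K \<inter> {1..n}. l k * p k z)"
    by (rule sum.mono_neutral_right) (auto simp: l_def)
  also have "\<dots> = (\<Sum>k\<in>K \<inter> {1..n}. lam k * (cmod (L2_inner (tf_shift g z) (h k)))\<^sup>2)"
  proof (rule sum.cong[OF refl])
    fix k assume "k \<in> K \<inter> {1..n}"
    have "cmod (stft g (h k) z) = cmod (L2_inner (tf_shift g z) (h k))"
      unfolding stft_eq_inner by (metis L2_inner_cnj complex_mod_cnj)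
    then show "l k * p k z = lam k * (cmod (L2_inner (tf_shift g z) (h k)))\<^sup>2"
      using \<open>k \<in> K \<inter> {1..n}\<close> by (simp add: l_def p_def)
  qed
  finally show "(\<Sum>k=1..n. l k * p k z) \<le> q z" "q z \<le> (\<Sum>k=1..n. l k * p k z) + l (Suc n)"
    using form_expansion[OF L2_tf_shift[OF g, of z], of n] by (simp_all add: q_def norm2_tf_shift[OF g] g1)
qed

end

section \<open>The error of the accumulated spectrogram\<close>

text \<open>Covariance gives the window's spectrogram at w - z; its symmetry turns this into z - w,
  as the convolution requires.\<close>

lemma (in localization) form_tf_shift:
  "form (tf_shift g z) = convolution (indicat_real \<Omega>) (\<lambda>w. (cmod (stft g g w))\<^sup>2) z"
  unfolding form_def Defs.convolution_def cmod_stft_tf_shift[OF g_borel] cmod_stft_self_minus[OF g_borel, of _ z] ..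

lemma (in localization) nn_integral_stft_window: "(\<integral>\<^sup>+w. ennreal ((cmod (stft g g w))\<^sup>2) \<partial>lborel) = 1"
  using Moyal[OF g g] by (simp add: g1)

lemma (in localization) ennreal_form_tf_shift:
  "ennreal (form (tf_shift g z)) = (\<integral>\<^sup>+w. indicator \<Omega> w * ennreal ((cmod (stft g g (z - w)))\<^sup>2) \<partial>lborel)"
proof -
  have "ennreal (form (tf_shift g z)) = (\<integral>\<^sup>+w. ennreal (indicat_real \<Omega> w * (cmod (stft g (tf_shift g z) w))\<^sup>2) \<partial>lborel)"
    unfolding form_def
    by (rule nn_integral_eq_integral[symmetric, OF integrable_form[OF L2_tf_shift[OF g]]]) simp
  also have "\<dots> = (\<integral>\<^sup>+w. indicator \<Omega> w * ennreal ((cmod (stft g g (z - w)))\<^sup>2) \<partial>lborel)"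
    unfolding cmod_stft_tf_shift[OF g_borel] cmod_stft_self_minus[OF g_borel, of _ z]
    by (rule nn_integral_cong) (auto simp: indicator_def)
  finally show ?thesis .
qed

lemma (in localization) emeasure_\<Omega>: "emeasure lborel \<Omega> = ennreal (measure lborel \<Omega>)"
  using \<Omega>_finite by (simp add: emeasure_eq_ennreal_measure less_top)

lemma (in localization) borel_measurable_form_tf_shift[measurable]:
  "(\<lambda>z. form (tf_shift g z)) \<in> borel_measurable borel"
  unfolding form_tf_shift Defs.convolution_def by measurable

text \<open>The window's spectrogram has integral 1, so convolving with it preserves the mass of the
  indicator.\<close>

lemma (in localization) form_tf_shift_integral:
  shows "integrable lborel (\<lambda>z. form (tf_shift g z))"
    and "(LINT z|lborel. form (tf_shift g z)) = measure lborel \<Omega>"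
proof -
  have "(\<integral>\<^sup>+z. ennreal (form (tf_shift g z)) \<partial>lborel)
      = (\<integral>\<^sup>+w. \<integral>\<^sup>+z. indicator \<Omega> w * ennreal ((cmod (stft g g (z - w)))\<^sup>2) \<partial>lborel \<partial>lborel)"
    unfolding ennreal_form_tf_shift by (rule lborel_pair.Fubini') measurable
  also have "\<dots> = (\<integral>\<^sup>+w. indicator \<Omega> w * (\<integral>\<^sup>+z. ennreal ((cmod (stft g g (z - w)))\<^sup>2) \<partial>lborel) \<partial>lborel)"
    by (simp add: nn_integral_cmult)
  also have "\<dots> = (\<integral>\<^sup>+w. indicator \<Omega> w \<partial>lborel)"
    using nn_integral_lborel_shift[of "\<lambda>z. ennreal ((cmod (stft g g z))\<^sup>2)"] nn_integral_stft_window by simp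
  finally have eq: "(\<integral>\<^sup>+z. ennreal (form (tf_shift g z)) \<partial>lborel) = ennreal (measure lborel \<Omega>)"
    by (simp add: emeasure_\<Omega>)
  show i: "integrable lborel (\<lambda>z. form (tf_shift g z))"
    using eq by (intro integrableI_nonneg) (auto simp: form_nonneg)
  show "(LINT z|lborel. form (tf_shift g z)) = measure lborel \<Omega>"
    using eq nn_integral_eq_integral[OF i] form_nonneg by (simp add: integral_nonneg_AE)
qed

text \<open>Seen from z, the window's mass 1 splits into a part inside \<Omega>, which is the form,
  and a part outside. Integrating over z in \<Omega> leaves the outside part to be bounded.\<close>

lemma (in localization) measure_le_form_plus_perimeter:
  assumes gM: "g \<in> Mstar" and per: "finite_perimeter \<Omega>"
  shows "measure lborel \<Omega> \<le> (LINT z|lborel. indicat_real \<Omega> z * form (tf_shift g z)) + perimeter \<Omega> * (Mstar_norm g)\<^sup>2"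
proof -
  define \<phi> where "\<phi> = (\<lambda>w. (cmod (stft g g w))\<^sup>2)"
  have [measurable]: "\<phi> \<in> borel_measurable borel" unfolding \<phi>_def by measurable
  have i: "integrable lborel (\<lambda>z. indicat_real \<Omega> z * form (tf_shift g z))"
    by (rule Bochner_Integration.integrable_bound[OF form_tf_shift_integral(1)]) (auto simp: indicator_def)
  have iM: "integrable lborel (\<lambda>z. norm z * \<phi> z)" using gM by (simp add: Mstar_def \<phi>_def)
  have M: "(Mstar_norm g)\<^sup>2 = (LINT z|lborel. norm z * \<phi> z)"
    unfolding Mstar_norm_def \<phi>_def by (rule real_sqrt_pow2) (rule integral_nonneg_AE, simp)
  have window: "(\<integral>\<^sup>+w. ennreal (\<phi> (z - w)) \<partial>lborel) = 1" for z
    using nn_integral_lborel_reflect[of "\<lambda>w. ennreal (\<phi> w)" z] nn_integral_stft_window by (simp add: \<phi>_def)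
  have outside: "(\<integral>\<^sup>+z. indicator \<Omega> z * (\<integral>\<^sup>+w. indicator (- \<Omega>) w * ennreal (\<phi> (z - w)) \<partial>lborel) \<partial>lborel)
      \<le> ennreal (perimeter \<Omega> * (Mstar_norm g)\<^sup>2)"
  proof -
    have "(\<integral>\<^sup>+w. indicator (- \<Omega>) w * ennreal (\<phi> (z - w)) \<partial>lborel)
        = (\<integral>\<^sup>+v. indicator (- \<Omega>) (z - v) * ennreal (\<phi> v) \<partial>lborel)" for z
      using nn_integral_lborel_reflect[of "\<lambda>w. indicator (- \<Omega>) w * ennreal (\<phi> (z - w))" z] by simp
    then have "(\<integral>\<^sup>+z. indicator \<Omega> z * (\<integral>\<^sup>+w. indicator (- \<Omega>) w * ennreal (\<phi> (z - w)) \<partial>lborel) \<partial>lborel)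
        = (\<integral>\<^sup>+z. \<integral>\<^sup>+v. indicator \<Omega> z * (indicator (- \<Omega>) (z - v) * ennreal (\<phi> v)) \<partial>lborel \<partial>lborel)"
      by (simp add: nn_integral_cmult)
    also have "\<dots> = (\<integral>\<^sup>+v. \<integral>\<^sup>+z. indicator \<Omega> z * (indicator (- \<Omega>) (z - v) * ennreal (\<phi> v)) \<partial>lborel \<partial>lborel)"
      by (rule lborel_pair.Fubini') measurable
    \<comment> \<open>With v = z - w held fixed, z ranges over \<Omega> minus (\<Omega> + v). The
      factor \<open>norm v\<close> from its measure is the weight in
      \<open>Mstar_norm\<close>.\<close>
    also have "\<dots> \<le> (\<integral>\<^sup>+v. ennreal (perimeter \<Omega> * (norm v * \<phi> v)) \<partial>lborel)"
    proof (rule nn_integral_mono)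
      fix v :: "'a \<times> 'a"
      define B where "B = {z \<in> \<Omega>. z - v \<notin> \<Omega>}"
      have "(\<lambda>z. z - v) -` (- \<Omega>) \<inter> space borel \<in> sets borel"
        by (rule measurable_sets[of _ borel borel]) auto
      moreover have "B = \<Omega> \<inter> ((\<lambda>z. z - v) -` (- \<Omega>) \<inter> space borel)" by (auto simp: B_def)
      ultimately have [measurable]: "B \<in> sets borel" by auto
      have finB: "emeasure lborel B < \<infinity>"
        using emeasure_mono[of B \<Omega> lborel] \<Omega>_finite by (auto simp: B_def intro: le_less_trans)
      have "(\<integral>\<^sup>+z. indicator \<Omega> z * (indicator (- \<Omega>) (z - v) * ennreal (\<phi> v)) \<partial>lborel)
          = (\<integral>\<^sup>+z. ennreal (\<phi> v) * indicator B z \<partial>lborel)"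
        by (rule nn_integral_cong) (auto simp: B_def indicator_def)
      also have "\<dots> = ennreal (\<phi> v) * ennreal (measure lborel B)"
        using finB by (simp add: nn_integral_cmult_indicator emeasure_eq_ennreal_measure less_top)
      also have "\<dots> \<le> ennreal (\<phi> v) * ennreal (norm v * perimeter \<Omega>)"
        using measure_translate_diff_le[OF compact per, of v] by (intro mult_left_mono ennreal_leI) (auto simp: B_def)
      also have "\<dots> = ennreal (perimeter \<Omega> * (norm v * \<phi> v))"
        by (simp add: ennreal_mult[symmetric] \<phi>_def perimeter_nonneg mult_ac)
      finally show "(\<integral>\<^sup>+z. indicator \<Omega> z * (indicator (- \<Omega>) (z - v) * ennreal (\<phi> v)) \<partial>lborel)
          \<le> ennreal (perimeter \<Omega> * (norm v * \<phi> v))" .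
    qed
    also have "\<dots> = ennreal (LINT v|lborel. perimeter \<Omega> * (norm v * \<phi> v))"
      by (rule nn_integral_eq_integral) (use iM in \<open>auto simp: perimeter_nonneg \<phi>_def\<close>)
    finally show ?thesis by (simp add: M)
  qed
  have "ennreal (measure lborel \<Omega>) = (\<integral>\<^sup>+z. indicator \<Omega> z \<partial>lborel)"
    by (simp add: emeasure_\<Omega>)
  also have "\<dots> = (\<integral>\<^sup>+z. indicator \<Omega> z * ((\<integral>\<^sup>+w. indicator \<Omega> w * ennreal (\<phi> (z - w)) \<partial>lborel)
      + (\<integral>\<^sup>+w. indicator (- \<Omega>) w * ennreal (\<phi> (z - w)) \<partial>lborel)) \<partial>lborel)"
  proof (rule nn_integral_cong)
    fix z :: "'a \<times> 'a"
    have "(\<integral>\<^sup>+w. indicator \<Omega> w * ennreal (\<phi> (z - w)) \<partial>lborel) + (\<integral>\<^sup>+w. indicator (- \<Omega>) w * ennreal (\<phi> (z - w)) \<partial>lborel)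
       = (\<integral>\<^sup>+w. indicator \<Omega> w * ennreal (\<phi> (z - w)) + indicator (- \<Omega>) w * ennreal (\<phi> (z - w)) \<partial>lborel)"
      by (rule nn_integral_add[symmetric]) measurable
    also have "\<dots> = (\<integral>\<^sup>+w. ennreal (\<phi> (z - w)) \<partial>lborel)"
      by (rule nn_integral_cong) (auto simp: indicator_def)
    finally show "indicator \<Omega> z = indicator \<Omega> z * ((\<integral>\<^sup>+w. indicator \<Omega> w * ennreal (\<phi> (z - w)) \<partial>lborel)
      + (\<integral>\<^sup>+w. indicator (- \<Omega>) w * ennreal (\<phi> (z - w)) \<partial>lborel))"
      using window by simp
  qed
  also have "\<dots> = (\<integral>\<^sup>+z. indicator \<Omega> z * (\<integral>\<^sup>+w. indicator \<Omega> w * ennreal (\<phi> (z - w)) \<partial>lborel) \<partial>lborel)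
      + (\<integral>\<^sup>+z. indicator \<Omega> z * (\<integral>\<^sup>+w. indicator (- \<Omega>) w * ennreal (\<phi> (z - w)) \<partial>lborel) \<partial>lborel)"
    unfolding distrib_left by (rule nn_integral_add) measurable
  also have "(\<integral>\<^sup>+z. indicator \<Omega> z * (\<integral>\<^sup>+w. indicator \<Omega> w * ennreal (\<phi> (z - w)) \<partial>lborel) \<partial>lborel)
      = (\<integral>\<^sup>+z. ennreal (indicat_real \<Omega> z * form (tf_shift g z)) \<partial>lborel)"
    unfolding \<phi>_def ennreal_form_tf_shift[symmetric]
    by (rule nn_integral_cong) (auto simp: indicator_def)
  also have "\<dots> = ennreal (LINT z|lborel. indicat_real \<Omega> z * form (tf_shift g z))"
    by (rule nn_integral_eq_integral[OF i]) (simp add: form_nonneg)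
  finally have "ennreal (measure lborel \<Omega>) \<le> ennreal (LINT z|lborel. indicat_real \<Omega> z * form (tf_shift g z))
      + ennreal (perimeter \<Omega> * (Mstar_norm g)\<^sup>2)"
    using outside by (simp add: add_left_mono)
  moreover have "0 \<le> (LINT z|lborel. indicat_real \<Omega> z * form (tf_shift g z))"
    by (rule integral_nonneg_AE) (simp add: form_nonneg)
  ultimately show ?thesis
    using perimeter_nonneg[of \<Omega>] by (simp add: ennreal_plus[symmetric] ennreal_le_iff del: ennreal_plus)
qed

section \<open>Eigenvalue sums and the L^1 error\<close>

context localization_eigensystem
begin

abbreviation (input) area :: real where "area \<equiv> measure lborel \<Omega>"

lemma p_nonneg: "p k z \<ge> 0"
  by (simp add: p_def)

lemma p_integral:
  shows "integrable lborel (p k)" and "(LINT z|lborel. p k z) = (if k \<in> K then 1 else 0)"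
  using stft_square_integrable[OF h_L2 g, of k] norm2_h[of k] g1
  by (cases "k \<in> K"; simp add: p_def[abs_def])+

lemma p_integral_\<Omega>:
  shows "integrable lborel (\<lambda>z. indicat_real \<Omega> z * p k z)" and "(LINT z|lborel. indicat_real \<Omega> z * p k z) = l k"
  using integrable_form[OF h_L2, of k] lam_eq_form[of k]
  by (cases "k \<in> K"; simp add: p_def l_def form_def)+

lemma q_integral:
  shows "integrable lborel q" and "(LINT z|lborel. q z) = area"
  using form_tf_shift_integral by (simp_all add: q_def[abs_def])

lemma q_integrable_\<Omega>: "integrable lborel (\<lambda>z. indicat_real \<Omega> z * q z)"
proof (rule Bochner_Integration.integrable_bound[OF q_integral(1)])
  show "(\<lambda>z. indicat_real \<Omega> z * q z) \<in> borel_measurable lborel" unfolding q_def by measurable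
qed (auto simp: indicator_def)

lemma sum_integral_p: "(LINT z|lborel. (\<Sum>k=1..n. l k * p k z)) = (\<Sum>k=1..n. l k)"
proof -
  have "(LINT z|lborel. (\<Sum>k=1..n. l k * p k z)) = (\<Sum>k=1..n. l k * (LINT z|lborel. p k z))"
    by (subst Bochner_Integration.integral_sum) (auto simp: p_integral(1))
  also have "\<dots> = (\<Sum>k=1..n. l k)"
    by (rule sum.cong) (auto simp: p_integral(2) l_def)
  finally show ?thesis .
qed

lemma integrable_sum_p: "integrable lborel (\<lambda>z. \<Sum>k=1..n. c k * p k z)"
  by (auto simp: p_integral(1))

lemma sum_l_le: "(\<Sum>k=1..n. l k) \<le> area"
proof -
  have "(LINT z|lborel. (\<Sum>k=1..n. l k * p k z)) \<le> (LINT z|lborel. q z)"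
    by (rule integral_mono[OF integrable_sum_p q_integral(1) q_expansion(1)])
  then show ?thesis by (simp only: sum_integral_p q_integral(2))
qed

text \<open>The first n + 1 values are all at least \<open>l (Suc n)\<close> and sum to at most the
  area. This rate makes the truncation error vanish.\<close>

lemma l_Suc_le: "l (Suc n) \<le> area / real (Suc n)"
proof -
  have "real (Suc n) * l (Suc n) = (\<Sum>k=1..Suc n. l (Suc n))" by simp
  also have "\<dots> \<le> (\<Sum>k=1..Suc n. l k)" by (rule sum_mono) (rule l_antimono, auto)
  also have "\<dots> \<le> area" by (rule sum_l_le)
  finally show ?thesis by (simp add: pos_le_divide_eq mult.commute)
qed

text \<open>The k-th spectrogram has mass \<open>l k\<close> on \<Omega>, so its coefficient
  \<open>l k\<close> in the expansion of \<open>q\<close> is squared; the uniform error is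
  integrated over \<Omega>.\<close>

lemma integral_q_\<Omega>_le: "(LINT z|lborel. indicat_real \<Omega> z * q z) \<le> (\<Sum>k=1..n. (l k)\<^sup>2) + l (Suc n) * area"
proof -
  have i\<Omega>: "integrable lborel (indicat_real \<Omega>)" using \<Omega>_finite by (simp add: integrable_indicator_iff)
  have i: "integrable lborel (\<lambda>z. \<Sum>k=1..n. l k * (indicat_real \<Omega> z * p k z))"
    using p_integral_\<Omega>(1) by auto
  have "(LINT z|lborel. indicat_real \<Omega> z * q z)
      \<le> (LINT z|lborel. (\<Sum>k=1..n. l k * (indicat_real \<Omega> z * p k z)) + l (Suc n) * indicat_real \<Omega> z)"
  proof (rule integral_mono[OF q_integrable_\<Omega>])
    show "integrable lborel (\<lambda>z. (\<Sum>k=1..n. l k * (indicat_real \<Omega> z * p k z)) + l (Suc n) * indicat_real \<Omega> z)"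
      using i i\<Omega> by auto
    show "indicat_real \<Omega> z * q z \<le> (\<Sum>k=1..n. l k * (indicat_real \<Omega> z * p k z)) + l (Suc n) * indicat_real \<Omega> z" for z
      using q_expansion(2)[of z n] by (cases "z \<in> \<Omega>") auto
  qed
  also have "\<dots> = (LINT z|lborel. (\<Sum>k=1..n. l k * (indicat_real \<Omega> z * p k z))) + (LINT z|lborel. l (Suc n) * indicat_real \<Omega> z)"
    by (rule Bochner_Integration.integral_add[OF i]) (use i\<Omega> in simp)
  also have "(LINT z|lborel. (\<Sum>k=1..n. l k * (indicat_real \<Omega> z * p k z))) = (\<Sum>k=1..n. (l k)\<^sup>2)"
    by (subst Bochner_Integration.integral_sum) (auto simp: p_integral_\<Omega> power2_eq_square)
  finally show ?thesis by simp
qed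

definition A :: nat where "A = nat \<lceil>area\<rceil>"

text \<open>The tail sum S of the overview, written as a difference so that no series
  appears.\<close>

definition S :: real where "S = area - (\<Sum>k=1..A. l k)"

lemma A_bounds:
  assumes "area > 0"
  shows "1 \<le> A" "area \<le> real A" "real A \<le> area + 1"
  using assms unfolding A_def by linarith+

text \<open>If \<open>A\<close> were outside \<open>K\<close>, then \<open>l A = 0\<close> and the
  expansion of \<open>q\<close> with A - 1 terms would have no error. The area would be a sum of A -
  1 eigenvalues, each at most 1, but A - 1 is less than the area.\<close>

lemma enough_eigenvalues:
  assumes pos: "area > 0" and k: "1 \<le> k" "k \<le> A"
  shows "k \<in> K"
proof -
  have "A \<in> K"
  proof (rule ccontr)
    assume "A \<notin> K"
    obtain n where n: "A = Suc n" using A_bounds(1)[OF pos] by (cases A) auto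
    have "q z \<le> (\<Sum>k=1..n. l k * p k z)" for z
      using q_expansion(2)[of z n] \<open>A \<notin> K\<close> n by (simp add: l_def)
    then have "(LINT z|lborel. q z) \<le> (LINT z|lborel. (\<Sum>k=1..n. l k * p k z))"
      by (intro integral_mono[OF q_integral(1) integrable_sum_p])
    then have "area \<le> (\<Sum>k=1..n. l k)" by (simp only: sum_integral_p q_integral(2))
    also have "\<dots> \<le> (\<Sum>k=1..n. 1)" by (rule sum_mono) (rule l_le_1)
    finally have "area \<le> real n" by simp
    moreover have "real n < area" using n pos unfolding A_def by linarith
    ultimately show False by simp
  qed
  then show ?thesis using k by (auto simp: K_def intro: order_trans[of "enat k" "enat A"])
qed

text \<open>
  This is \<open>\<Sum>k>A. l k \<le> \<Sum>k. l k (1 - l k)\<close> with the right-hand side written as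
  \<open>\<bar>\<Omega>\<bar> - \<integral>\<^sub>\<Omega> q\<close>: compare each factor with \<open>l A\<close> and use \<open>\<Sum>k\<le>A. (1 - l k) \<ge> S\<close>.
\<close>

lemma integral_q_\<Omega>_le_sum:
  assumes pos: "area > 0"
  shows "(LINT z|lborel. indicat_real \<Omega> z * q z) \<le> area - S"
proof (rule LIMSEQ_le_const)
  \<comment> \<open>The vanishing term is \<open>l (Suc n) * area\<close> from
    \<open>integral_q_\<Omega>_le\<close>, estimated by \<open>l_Suc_le\<close>.\<close>
  show "(\<lambda>n. (area - S) + area * area * (1 / real (Suc n))) \<longlonglongrightarrow> area - S"
    by (rule tendsto_eq_intros LIMSEQ_Suc[OF lim_1_over_n] refl)+ simp
  have head: "(\<Sum>k=1..A. (l k)\<^sup>2) + l A * S \<le> (\<Sum>k=1..A. l k)"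
  proof -
    have "l A * S \<le> l A * (\<Sum>k=1..A. 1 - l k)"
      using A_bounds(2)[OF pos] by (intro mult_left_mono l_nonneg) (simp add: S_def sum_subtractf)
    also have "\<dots> \<le> (\<Sum>k=1..A. l k * (1 - l k))"
      unfolding sum_distrib_left
      by (intro sum_mono mult_right_mono l_antimono) (auto simp: l_le_1)
    also have "\<dots> = (\<Sum>k=1..A. l k) - (\<Sum>k=1..A. (l k)\<^sup>2)"
      by (simp add: sum_subtractf right_diff_distrib power2_eq_square)
    finally show ?thesis by simp
  qed
  have "(LINT z|lborel. indicat_real \<Omega> z * q z) \<le> (area - S) + area * area * (1 / real (Suc n))" if "A \<le> n" for n
  proof -
    have split: "(\<Sum>k=1..n. f k) = (\<Sum>k=1..A. f k) + (\<Sum>k=Suc A..n. f k)" for f :: "nat \<Rightarrow> real"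
      using sum.ub_add_nat[of 1 A f "n - A"] A_bounds(1)[OF pos] that by simp
    \<comment> \<open>Beyond \<open>A\<close> one factor of each square is at most
      \<open>l A\<close>; the remaining finite sum is at most \<open>S\<close> by
      \<open>sum_l_le\<close>.\<close>
    have "(\<Sum>k=Suc A..n. (l k)\<^sup>2) \<le> (\<Sum>k=Suc A..n. l A * l k)"
      unfolding power2_eq_square
      using A_bounds(1)[OF pos] by (intro sum_mono mult_right_mono l_antimono l_nonneg) auto
    also have "\<dots> = l A * (\<Sum>k=Suc A..n. l k)" by (simp add: sum_distrib_left)
    also have "\<dots> \<le> l A * S"
      using sum_l_le[of n] split[of l] by (intro mult_left_mono l_nonneg) (simp add: S_def)
    finally have tail: "(\<Sum>k=Suc A..n. (l k)\<^sup>2) \<le> l A * S" .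
    have "l (Suc n) * area \<le> area / real (Suc n) * area"
      by (rule mult_right_mono[OF l_Suc_le]) simp
    then have "l (Suc n) * area \<le> area * area * (1 / real (Suc n))" by simp
    then show ?thesis
      using integral_q_\<Omega>_le[of n] split[of "\<lambda>k. (l k)\<^sup>2"] tail head by (simp add: S_def)
  qed
  then show "\<exists>N. \<forall>n\<ge>N. (LINT z|lborel. indicat_real \<Omega> z * q z) \<le> (area - S) + area * area * (1 / real (Suc n))"
    by blast
qed

lemma S_bounds: "0 \<le> S" "S \<le> area"
  using sum_l_le[of A] by (auto simp: S_def intro: sum_nonneg l_nonneg)

text \<open>Cutting at \<open>A\<close> writes the error as a difference of two nonnegative
  functions, with integrals A - |\<Omega>| + S and S. The second is kept as \<open>q\<close> minus a
  finite sum.\<close>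

lemma accumulated_spectrogram_error:
  assumes pos: "area > 0"
  shows "integrable lborel (\<lambda>z. accumulated_spectrogram g \<Omega> h z - q z)"
    and "norm1 (\<lambda>z. accumulated_spectrogram g \<Omega> h z - q z) \<le> 1 + 2 * S"
proof -
  have acc: "accumulated_spectrogram g \<Omega> h z = (\<Sum>k=1..A. p k z)" for z
    unfolding accumulated_spectrogram_def A_def[symmetric]
    by (rule sum.cong) (use enough_eigenvalues[OF pos] in \<open>auto simp: p_def\<close>)
  have i1: "integrable lborel (\<lambda>z. \<Sum>k=1..A. p k z)" using integrable_sum_p[of "\<lambda>_. 1" A] by simp
  show iF: "integrable lborel (\<lambda>z. accumulated_spectrogram g \<Omega> h z - q z)"
    unfolding acc using i1 q_integral(1) by (rule Bochner_Integration.integrable_diff)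
  have i2: "integrable lborel (\<lambda>z. q z - (\<Sum>k=1..A. l k * p k z))"
    by (rule Bochner_Integration.integrable_diff[OF q_integral(1) integrable_sum_p])
  have bound: "\<bar>accumulated_spectrogram g \<Omega> h z - q z\<bar>
      \<le> (\<Sum>k=1..A. (1 - l k) * p k z) + (q z - (\<Sum>k=1..A. l k * p k z))" for z
  proof -
    have "accumulated_spectrogram g \<Omega> h z - q z = (\<Sum>k=1..A. (1 - l k) * p k z) - (q z - (\<Sum>k=1..A. l k * p k z))"
      by (simp add: acc left_diff_distrib sum_subtractf)
    moreover have "0 \<le> (\<Sum>k=1..A. (1 - l k) * p k z)"
      by (intro sum_nonneg mult_nonneg_nonneg p_nonneg) (simp add: l_le_1)
    moreover have "0 \<le> q z - (\<Sum>k=1..A. l k * p k z)" using q_expansion(1)[where z=z and n=A] by simp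
    ultimately show ?thesis by linarith
  qed
  have "norm1 (\<lambda>z. accumulated_spectrogram g \<Omega> h z - q z)
      \<le> (LINT z|lborel. (\<Sum>k=1..A. (1 - l k) * p k z) + (q z - (\<Sum>k=1..A. l k * p k z)))"
    unfolding norm1_def
    by (rule integral_mono[OF integrable_abs[OF iF] Bochner_Integration.integrable_add[OF integrable_sum_p i2] bound])
  also have "\<dots> = (LINT z|lborel. (\<Sum>k=1..A. (1 - l k) * p k z)) + (LINT z|lborel. q z - (\<Sum>k=1..A. l k * p k z))"
    by (rule Bochner_Integration.integral_add[OF integrable_sum_p i2])
  also have "(LINT z|lborel. (\<Sum>k=1..A. (1 - l k) * p k z)) = (\<Sum>k=1..A. 1 - l k)"
  proof -
    have "(LINT z|lborel. (\<Sum>k=1..A. (1 - l k) * p k z)) = (\<Sum>k=1..A. (1 - l k) * (LINT z|lborel. p k z))"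
      by (subst Bochner_Integration.integral_sum) (auto simp: p_integral(1))
    also have "\<dots> = (\<Sum>k=1..A. 1 - l k)"
      by (rule sum.cong) (use enough_eigenvalues[OF pos] in \<open>auto simp: p_integral(2)\<close>)
    finally show ?thesis .
  qed
  also have "(LINT z|lborel. q z - (\<Sum>k=1..A. l k * p k z)) = area - (\<Sum>k=1..A. l k)"
    unfolding Bochner_Integration.integral_diff[OF q_integral(1) integrable_sum_p] sum_integral_p q_integral(2) ..
  also have "(\<Sum>k=1..A. 1 - l k) + (area - (\<Sum>k=1..A. l k)) \<le> 1 + 2 * S"
    using A_bounds(3)[OF pos] by (simp add: S_def sum_subtractf)
  finally show "norm1 (\<lambda>z. accumulated_spectrogram g \<Omega> h z - q z) \<le> 1 + 2 * S" .
qed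

end

theorem theorem1p4:
  fixes g :: "real ^ 'd \<Rightarrow> complex"
    and \<Omega> :: "((real ^ 'd) \<times> (real ^ 'd)) set"
    and N :: enat
    and lam :: "nat \<Rightarrow> real"
    and h :: "nat \<Rightarrow> real ^ 'd \<Rightarrow> complex"
  assumes "g \<in> Mstar" and "norm2 g = 1"
    and "compact \<Omega>" and "finite_perimeter \<Omega>" and "measure lborel \<Omega> > 0"
    and "nonzero_eigensystem (loc_op g \<Omega>) N lam h"
  shows "let F = (\<lambda>z. accumulated_spectrogram g \<Omega> h z
                   - convolution (indicat_real \<Omega>) (\<lambda>w. (cmod (stft g g w))\<^sup>2) z)
         in integrable lborel F \<and>
            1 / measure lborel \<Omega> * norm1 F
              \<le> 1 / measure lborel \<Omega>
                + 4 * Mstar_norm g * sqrt (perimeter \<Omega> / measure lborel \<Omega>)"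
proof -
  interpret localization_eigensystem g \<Omega> N lam h
    by unfold_locales (use assms in \<open>auto simp: Mstar_def\<close>)
  define a where "a = measure lborel \<Omega>"
  define m where "m = Mstar_norm g"
  define P where "P = perimeter \<Omega>"
  have a: "a > 0" using assms(5) by (simp add: a_def)
  have m: "m \<ge> 0" unfolding m_def Mstar_norm_def by (rule real_sqrt_ge_zero, rule integral_nonneg_AE) simp
  have P: "P \<ge> 0" unfolding P_def by (rule perimeter_nonneg)
  have "S \<le> P * m\<^sup>2"
    using measure_le_form_plus_perimeter[OF assms(1,4)] integral_q_\<Omega>_le_sum[OF assms(5)]
    by (simp add: q_def P_def m_def)
  \<comment> \<open>One factor S is bounded by the area, the other by the perimeter estimate; this
    produces the square root.\<close>
  then have "S\<^sup>2 \<le> a * (P * m\<^sup>2)"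
    unfolding power2_eq_square[of S] using S_bounds a by (intro mult_mono) (auto simp: a_def)
  also have "\<dots> = (a * m)\<^sup>2 * (P / a)" using a by (simp add: power2_eq_square)
  also have "\<dots> = (a * m * sqrt (P / a))\<^sup>2"
    using P a by (simp add: power_mult_distrib)
  finally have S_le: "S \<le> a * m * sqrt (P / a)"
    by (rule power2_le_imp_le) (use a m P in simp)
  have q: "convolution (indicat_real \<Omega>) (\<lambda>w. (cmod (stft g g w))\<^sup>2) z = q z" for z
    by (simp add: q_def form_tf_shift)
  define F where "F = (\<lambda>z. accumulated_spectrogram g \<Omega> h z - q z)"
  have "norm1 F \<le> 1 + 2 * S" unfolding F_def by (rule accumulated_spectrogram_error(2)[OF assms(5)])
  \<comment> \<open>Here 2 S is at most twice the bound in \<open>S_le\<close>; doubling again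
    reaches the stated constant 4.\<close>
  also have "\<dots> \<le> 1 + 4 * (a * m * sqrt (P / a))"
    using S_le S_bounds(1) by simp
  finally have "1 / a * norm1 F \<le> 1 / a * (1 + 4 * (a * m * sqrt (P / a)))"
    using a by (intro mult_left_mono) auto
  also have "\<dots> = 1 / a + 4 * m * sqrt (P / a)" using a by (simp add: field_simps)
  finally have "1 / a * norm1 F \<le> 1 / a + 4 * m * sqrt (P / a)" .
  moreover have "integrable lborel F" unfolding F_def by (rule accumulated_spectrogram_error(1)[OF assms(5)])
  ultimately show ?thesis unfolding Let_def q F_def a_def m_def P_def by blast
qed

end
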